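(* Let $(\mathcal N,P,h)$ be a 2-dimensional almost paracomplex Riemannian manifold with sectional (Gaussian) curvature $k'$, and let $(\mathcal C(\mathcal N),\phi,\xi,\eta,g)$ be the 3-dimensional apapR manifold with $\mathcal C(\mathcal N)=\mathbb R^+\times\mathcal N$, $g\big((x',a\tfrac{d}{dt}),(y',b\tfrac{d}{dt})\big)=t^2h(x',y')+ab$, $\phi(x',a\tfrac{d}{dt})=(Px',0)$, $\xi=\tfrac{d}{dt}$, $\eta=dt$. Then $(\mathcal C(\mathcal N),\phi,\xi,\eta,g)$ is flat (i.e. the curvature tensor of the Levi-Civita connection of $g$ vanishes) if and only if $k'=1$.
   Context: An almost paracomplex Riemannian manifold $(\mathcal N,P,h)$ of dimension $2n$ is a differentiable manifold with an endomorphism $P$ of $T\mathcal N$ satisfying $P^2=I$, $P\neq I$, $\operatorname{tr}P=0$ and a Riemannian metric $h$ with $h(Px',Py')=h(x',y')$. When $\dim\mathcal N=2$, the curvature tensor of $h$ has the form $R'=k'\pi_1'$, where $\pi_1'(x',y')z'=h(y',z')x'-h(x',z')y'$ and $k'$ is the pointwise constant sectional curvature of $h$ (a function on $\mathcal N$). An almost paracontact almost paracomplex Riemannian manifold (apapR manifold) $(\mathcal M,\phi,\xi,\eta,g)$ is a $(2n+1)$-dimensional differentiable manifold with an endomorphism $\phi$ of $T\mathcal M$, a vector field $\xi$, a 1-form $\eta$ and a Riemannian metric $g$ such that $\phi^2=\mathcal I-\eta\otimes\xi$, $\eta(\xi)=1$, $\eta\circ\phi=0$, $\phi\xi=0$,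 $\operatorname{tr}\phi=0$, $g(\phi x,\phi y)=g(x,y)-\eta(x)\eta(y)$. Curvature convention: $R(x,y)=[\nabla_x,\nabla_y]-\nabla_{[x,y]}$ with $\nabla$ the Levi-Civita connection. $\mathbb R^+$ is the set of positive reals, $t$ is its coordinate; tangent vectors of $\mathbb R^+\times\mathcal N$ are written $(x',a\tfrac{d}{dt})$ with $x'$ tangent to $\mathcal N$. *)

theory Defs
  imports "HOL-Analysis.Analysis" "HOL-Library.Function_Algebras"
begin

instantiation "fun" :: (type, real_vector) real_vector
begin

definition scaleR_fun :: "real \<Rightarrow> ('a \<Rightarrow> 'b) \<Rightarrow> 'a \<Rightarrow> 'b"
  where "scaleR_fun r f = (\<lambda>x. r *\<^sub>R f x)"

instance
  by standard (simp_all add: scaleR_fun_def plus_fun_def fun_eq_iff scaleR_right_distrib scaleR_left_distrib)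

end

section \<open>Smooth maps between Euclidean spaces\<close>

text \<open>In the next two definitions the set \<open>S\<close> is meant to be open.\<close>

primrec Ck_on :: "nat \<Rightarrow> 'e set \<Rightarrow> ('e::euclidean_space \<Rightarrow> 'f::real_normed_vector) \<Rightarrow> bool" where
  "Ck_on 0 S f \<longleftrightarrow> continuous_on S f"
| "Ck_on (Suc k) S f \<longleftrightarrow> (\<forall>x\<in>S. f differentiable at x) \<and>
     (\<forall>v. Ck_on k S (\<lambda>x. frechet_derivative f (at x) v))"

definition smooth_on :: "'e set \<Rightarrow> ('e::euclidean_space \<Rightarrow> 'f::real_normed_vector) \<Rightarrow> bool"
  where "smooth_on S f \<longleftrightarrow> (\<forall>k. Ck_on k S f)"

section \<open>Smooth manifolds\<close>

text \<open>
  A chart is a pair of its domain and the coordinate map; the values of the map outside the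
  domain are irrelevant. The model space is a Euclidean space \<open>'e\<close>, so the dimension of the
  manifold is \<open>DIM('e)\<close>. The atlas is any atlas generating the smooth structure, not
  necessarily the maximal one.
\<close>

type_synonym ('a, 'e) chart = "'a set \<times> ('a \<Rightarrow> 'e)"

record ('a, 'e) mfd =
  top_of :: "'a topology"
  atlas :: "('a, 'e) chart set"

abbreviation carrier :: "('a, 'e) mfd \<Rightarrow> 'a set"
  where "carrier M \<equiv> topspace (top_of M)"

abbreviation chart_dom :: "('a, 'e) chart \<Rightarrow> 'a set"
  where "chart_dom c \<equiv> fst c"

abbreviation coord :: "('a, 'e) chart \<Rightarrow> 'a \<Rightarrow> 'e"
  where "coord c \<equiv> snd c"

definition param :: "('a, 'e) chart \<Rightarrow> 'e \<Rightarrow> 'a"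
  where "param c = inv_into (chart_dom c) (coord c)"

definition is_chart :: "'a topology \<Rightarrow> ('a, 'e::euclidean_space) chart \<Rightarrow> bool"
  where "is_chart X c \<longleftrightarrow> openin X (chart_dom c) \<and> open (coord c ` chart_dom c) \<and>
    homeomorphic_map (subtopology X (chart_dom c)) (top_of_set (coord c ` chart_dom c)) (coord c)"

definition smooth_manifold :: "('a, 'e::euclidean_space) mfd \<Rightarrow> bool"
  where "smooth_manifold M \<longleftrightarrow>
    Hausdorff_space (top_of M) \<and> second_countable (top_of M) \<and>
    (\<forall>c\<in>atlas M. is_chart (top_of M) c) \<and>
    carrier M = (\<Union>c\<in>atlas M. chart_dom c) \<and>
    (\<forall>c\<in>atlas M. \<forall>d\<in>atlas M.
       smooth_on (coord c ` (chart_dom c \<inter> chart_dom d)) (coord d \<circ> param c))"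

definition charts_at :: "('a, 'e) mfd \<Rightarrow> 'a \<Rightarrow> ('a, 'e) chart set"
  where "charts_at M p = {c \<in> atlas M. p \<in> chart_dom c}"

section \<open>Tangent vectors\<close>

text \<open>
  A tangent vector at \<open>p\<close> assigns to every chart around \<open>p\<close> its vector of components, subject to
  the usual transformation law. Its value at all other charts is \<open>0\<close>, so that equality of
  tangent vectors is equality of functions, and the tangent space is a linear subspace of the
  space of all functions.
\<close>

type_synonym ('a, 'e) tvec = "('a, 'e) chart \<Rightarrow> 'e"

definition tangent_space :: "('a, 'e::euclidean_space) mfd \<Rightarrow> 'a \<Rightarrow> ('a, 'e) tvec set"
  where "tangent_space M p = {v.
    (\<forall>c\<in>charts_at M p. \<forall>d\<in>charts_at M p.
       v d = frechet_derivative (coord d \<circ> param c) (at (coord c p)) (v c)) \<and>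
    (\<forall>c. c \<notin> charts_at M p \<longrightarrow> v c = 0)}"

definition smooth_function :: "('a, 'e::euclidean_space) mfd \<Rightarrow> 'a set \<Rightarrow> ('a \<Rightarrow> real) \<Rightarrow> bool"
  where "smooth_function M U f \<longleftrightarrow> openin (top_of M) U \<and>
    (\<forall>c\<in>atlas M. smooth_on (coord c ` (U \<inter> chart_dom c)) (f \<circ> param c))"

definition vector_field ::
    "('a, 'e::euclidean_space) mfd \<Rightarrow> 'a set \<Rightarrow> ('a \<Rightarrow> ('a, 'e) tvec) \<Rightarrow> bool"
  where "vector_field M U X \<longleftrightarrow> openin (top_of M) U \<and> (\<forall>p\<in>U. X p \<in> tangent_space M p) \<and>
    (\<forall>c\<in>atlas M. smooth_on (coord c ` (U \<inter> chart_dom c)) (\<lambda>u. X (param c u) c))"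

text \<open>Both for the derivative \<open>v f\<close> of a smooth function and for the trace of an endomorphism of a
  tangent space the choice of the chart around \<open>p\<close> is immaterial.\<close>

definition dir_deriv ::
    "('a, 'e::euclidean_space) mfd \<Rightarrow> 'a \<Rightarrow> ('a, 'e) tvec \<Rightarrow> ('a \<Rightarrow> real) \<Rightarrow> real"
  where "dir_deriv M p v f =
    (let c = (SOME c. c \<in> charts_at M p)
     in frechet_derivative (f \<circ> param c) (at (coord c p)) (v c))"

definition coord_vec :: "('a, 'e::euclidean_space) mfd \<Rightarrow> 'a \<Rightarrow> ('a, 'e) chart \<Rightarrow> 'e \<Rightarrow> ('a, 'e) tvec"
  where "coord_vec M p c e = (\<lambda>d. if d \<in> charts_at M p
    then frechet_derivative (coord d \<circ> param c) (at (coord c p)) e else 0)"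

definition trace_at ::
    "('a, 'e::euclidean_space) mfd \<Rightarrow> 'a \<Rightarrow> (('a, 'e) tvec \<Rightarrow> ('a, 'e) tvec) \<Rightarrow> real"
  where "trace_at M p L =
    (let c = (SOME c. c \<in> charts_at M p)
     in \<Sum>e\<in>Basis. L (coord_vec M p c e) c \<bullet> e)"

definition lie_bracket :: "('a, 'e::euclidean_space) mfd \<Rightarrow>
    ('a \<Rightarrow> ('a, 'e) tvec) \<Rightarrow> ('a \<Rightarrow> ('a, 'e) tvec) \<Rightarrow> 'a \<Rightarrow> ('a, 'e) tvec"
  where "lie_bracket M X Y p = (\<lambda>c. if c \<in> charts_at M p
    then frechet_derivative (\<lambda>u. Y (param c u) c) (at (coord c p)) (X p c)
       - frechet_derivative (\<lambda>u. X (param c u) c) (at (coord c p)) (Y p c)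
    else 0)"

section \<open>Tensor fields\<close>

text \<open>
  Tensor fields act pointwise on tangent vectors; smoothness means that they send smooth vector
  fields on open sets to smooth functions or vector fields. The values at points outside the
  manifold or at arguments outside the tangent space are irrelevant.
\<close>

definition endomorphism_field ::
    "('a, 'e::euclidean_space) mfd \<Rightarrow> ('a \<Rightarrow> ('a, 'e) tvec \<Rightarrow> ('a, 'e) tvec) \<Rightarrow> bool"
  where "endomorphism_field M L \<longleftrightarrow>
    (\<forall>p\<in>carrier M. \<forall>x\<in>tangent_space M p. \<forall>y\<in>tangent_space M p. \<forall>r.
       L p x \<in> tangent_space M p \<and> L p (x + y) = L p x + L p y \<and> L p (r *\<^sub>R x) = r *\<^sub>R L p x) \<and>
    (\<forall>U X. vector_field M U X \<longrightarrow> vector_field M U (\<lambda>p. L p (X p)))"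

definition one_form ::
    "('a, 'e::euclidean_space) mfd \<Rightarrow> ('a \<Rightarrow> ('a, 'e) tvec \<Rightarrow> real) \<Rightarrow> bool"
  where "one_form M \<eta> \<longleftrightarrow>
    (\<forall>p\<in>carrier M. \<forall>x\<in>tangent_space M p. \<forall>y\<in>tangent_space M p. \<forall>r.
       \<eta> p (x + y) = \<eta> p x + \<eta> p y \<and> \<eta> p (r *\<^sub>R x) = r * \<eta> p x) \<and>
    (\<forall>U X. vector_field M U X \<longrightarrow> smooth_function M U (\<lambda>p. \<eta> p (X p)))"

definition riemannian_metric ::
    "('a, 'e::euclidean_space) mfd \<Rightarrow> ('a \<Rightarrow> ('a, 'e) tvec \<Rightarrow> ('a, 'e) tvec \<Rightarrow> real) \<Rightarrow> bool"
  where "riemannian_metric M g \<longleftrightarrow>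
    (\<forall>p\<in>carrier M. \<forall>x\<in>tangent_space M p. \<forall>y\<in>tangent_space M p. \<forall>z\<in>tangent_space M p. \<forall>r.
       g p (x + y) z = g p x z + g p y z \<and> g p (r *\<^sub>R x) z = r * g p x z \<and>
       g p x y = g p y x) \<and>
    (\<forall>p\<in>carrier M. \<forall>x\<in>tangent_space M p. x \<noteq> 0 \<longrightarrow> g p x x > 0) \<and>
    (\<forall>U X Y. vector_field M U X \<longrightarrow> vector_field M U Y \<longrightarrow>
       smooth_function M U (\<lambda>p. g p (X p) (Y p)))"

section \<open>The Levi-Civita connection and its curvature\<close>

text \<open>
  \<open>D p x Y\<close> is the covariant derivative at \<open>p\<close> of a vector field \<open>Y\<close>, defined on some
  neighbourhood of \<open>p\<close>, in the direction of a tangent vector \<open>x\<close> at \<open>p\<close>. The fourth clause says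
  that it depends only on the germ of \<open>Y\<close> at \<open>p\<close>.
\<close>

type_synonym ('a, 'e) connection =
  "'a \<Rightarrow> ('a, 'e) tvec \<Rightarrow> ('a \<Rightarrow> ('a, 'e) tvec) \<Rightarrow> ('a, 'e) tvec"

definition affine_connection ::
    "('a, 'e::euclidean_space) mfd \<Rightarrow> ('a, 'e) connection \<Rightarrow> bool"
  where "affine_connection M D \<longleftrightarrow>
    (\<forall>U Y. vector_field M U Y \<longrightarrow>
       (\<forall>p\<in>U. \<forall>x\<in>tangent_space M p. \<forall>y\<in>tangent_space M p. \<forall>r.
          D p x Y \<in> tangent_space M p \<and>
          D p (x + y) Y = D p x Y + D p y Y \<and> D p (r *\<^sub>R x) Y = r *\<^sub>R D p x Y)) \<and>
    (\<forall>U Y Z. vector_field M U Y \<longrightarrow> vector_field M U Z \<longrightarrow>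
       (\<forall>p\<in>U. \<forall>x\<in>tangent_space M p. D p x (\<lambda>q. Y q + Z q) = D p x Y + D p x Z)) \<and>
    (\<forall>U f Y. smooth_function M U f \<longrightarrow> vector_field M U Y \<longrightarrow>
       (\<forall>p\<in>U. \<forall>x\<in>tangent_space M p.
          D p x (\<lambda>q. f q *\<^sub>R Y q) = dir_deriv M p x f *\<^sub>R Y p + f p *\<^sub>R D p x Y)) \<and>
    (\<forall>U Y Z. vector_field M U Y \<longrightarrow> vector_field M U Z \<longrightarrow> (\<forall>q\<in>U. Y q = Z q) \<longrightarrow>
       (\<forall>p\<in>U. \<forall>x\<in>tangent_space M p. D p x Y = D p x Z)) \<and>
    (\<forall>U X Y. vector_field M U X \<longrightarrow> vector_field M U Y \<longrightarrow>
       vector_field M U (\<lambda>p. D p (X p) Y))"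

definition levi_civita :: "('a, 'e::euclidean_space) mfd \<Rightarrow>
    ('a \<Rightarrow> ('a, 'e) tvec \<Rightarrow> ('a, 'e) tvec \<Rightarrow> real) \<Rightarrow> ('a, 'e) connection \<Rightarrow> bool"
  where "levi_civita M g D \<longleftrightarrow> affine_connection M D \<and>
    (\<forall>U X Y. vector_field M U X \<longrightarrow> vector_field M U Y \<longrightarrow>
       (\<forall>p\<in>U. D p (X p) Y - D p (Y p) X = lie_bracket M X Y p)) \<and>
    (\<forall>U Y Z. vector_field M U Y \<longrightarrow> vector_field M U Z \<longrightarrow>
       (\<forall>p\<in>U. \<forall>x\<in>tangent_space M p.
          dir_deriv M p x (\<lambda>q. g q (Y q) (Z q)) = g p (D p x Y) (Z p) + g p (Y p) (D p x Z)))"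

definition curvature :: "('a, 'e::euclidean_space) mfd \<Rightarrow> ('a, 'e) connection \<Rightarrow>
    ('a \<Rightarrow> ('a, 'e) tvec) \<Rightarrow> ('a \<Rightarrow> ('a, 'e) tvec) \<Rightarrow> ('a \<Rightarrow> ('a, 'e) tvec) \<Rightarrow> 'a \<Rightarrow> ('a, 'e) tvec"
  where "curvature M D X Y Z p =
    D p (X p) (\<lambda>q. D q (Y q) Z) - D p (Y p) (\<lambda>q. D q (X q) Z) - D p (lie_bracket M X Y p) Z"

definition flat :: "('a, 'e::euclidean_space) mfd \<Rightarrow> ('a, 'e) connection \<Rightarrow> bool"
  where "flat M D \<longleftrightarrow>
    (\<forall>U X Y Z. vector_field M U X \<longrightarrow> vector_field M U Y \<longrightarrow> vector_field M U Z \<longrightarrow>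
       (\<forall>p\<in>U. curvature M D X Y Z p = 0))"

definition sectional_curvature :: "('a, 'e::euclidean_space) mfd \<Rightarrow>
    ('a \<Rightarrow> ('a, 'e) tvec \<Rightarrow> ('a, 'e) tvec \<Rightarrow> real) \<Rightarrow> ('a, 'e) connection \<Rightarrow>
    ('a \<Rightarrow> ('a, 'e) tvec) \<Rightarrow> ('a \<Rightarrow> ('a, 'e) tvec) \<Rightarrow> 'a \<Rightarrow> real"
  where "sectional_curvature M g D X Y p =
    g p (curvature M D X Y Y p) (X p) /
      (g p (X p) (X p) * g p (Y p) (Y p) - (g p (X p) (Y p))\<^sup>2)"

text \<open>The function \<open>k\<close> on the manifold gives the sectional curvature of every tangent plane; on a
  surface there is one plane at each point and \<open>k\<close> is the Gaussian curvature.\<close>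

definition has_sectional_curvature :: "('a, 'e::euclidean_space) mfd \<Rightarrow>
    ('a \<Rightarrow> ('a, 'e) tvec \<Rightarrow> ('a, 'e) tvec \<Rightarrow> real) \<Rightarrow> ('a, 'e) connection \<Rightarrow> ('a \<Rightarrow> real) \<Rightarrow> bool"
  where "has_sectional_curvature M g D k \<longleftrightarrow>
    (\<forall>U X Y. vector_field M U X \<longrightarrow> vector_field M U Y \<longrightarrow>
       (\<forall>p\<in>U. X p \<noteq> Y p \<longrightarrow> independent {X p, Y p} \<longrightarrow> sectional_curvature M g D X Y p = k p))"

section \<open>Almost paracomplex and almost paracontact almost paracomplex Riemannian manifolds\<close>

definition almost_paracomplex_riemannian :: "('a, 'e::euclidean_space) mfd \<Rightarrow>
    ('a \<Rightarrow> ('a, 'e) tvec \<Rightarrow> ('a, 'e) tvec) \<Rightarrow>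
    ('a \<Rightarrow> ('a, 'e) tvec \<Rightarrow> ('a, 'e) tvec \<Rightarrow> real) \<Rightarrow> bool"
  where "almost_paracomplex_riemannian N P h \<longleftrightarrow>
    smooth_manifold N \<and> even DIM('e) \<and> endomorphism_field N P \<and> riemannian_metric N h \<and>
    (\<forall>p\<in>carrier N. \<forall>x\<in>tangent_space N p. P p (P p x) = x) \<and>
    \<not> (\<forall>p\<in>carrier N. \<forall>x\<in>tangent_space N p. P p x = x) \<and>
    (\<forall>p\<in>carrier N. trace_at N p (P p) = 0) \<and>
    (\<forall>p\<in>carrier N. \<forall>x\<in>tangent_space N p. \<forall>y\<in>tangent_space N p. h p (P p x) (P p y) = h p x y)"

definition apapR_manifold :: "('a, 'e::euclidean_space) mfd \<Rightarrow>
    ('a \<Rightarrow> ('a, 'e) tvec \<Rightarrow> ('a, 'e) tvec) \<Rightarrow> ('a \<Rightarrow> ('a, 'e) tvec) \<Rightarrow>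
    ('a \<Rightarrow> ('a, 'e) tvec \<Rightarrow> real) \<Rightarrow> ('a \<Rightarrow> ('a, 'e) tvec \<Rightarrow> ('a, 'e) tvec \<Rightarrow> real) \<Rightarrow> bool"
  where "apapR_manifold M \<phi> \<xi> \<eta> g \<longleftrightarrow>
    smooth_manifold M \<and> odd DIM('e) \<and> endomorphism_field M \<phi> \<and>
    vector_field M (carrier M) \<xi> \<and> one_form M \<eta> \<and> riemannian_metric M g \<and>
    (\<forall>p\<in>carrier M.
       \<eta> p (\<xi> p) = 1 \<and> \<phi> p (\<xi> p) = 0 \<and> trace_at M p (\<phi> p) = 0 \<and>
       (\<forall>x\<in>tangent_space M p. \<phi> p (\<phi> p x) = x - \<eta> p x *\<^sub>R \<xi> p \<and> \<eta> p (\<phi> p x) = 0 \<and>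
          (\<forall>y\<in>tangent_space M p. g p (\<phi> p x) (\<phi> p y) = g p x y - \<eta> p x * \<eta> p y)))"

section \<open>The cone\<close>

text \<open>
  The underlying manifold is the product of the positive reals with \<open>N\<close>; the factors are ordered
  such that points are \<open>(p, t)\<close> and tangent vectors \<open>(x, a d/dt)\<close>.
\<close>

definition cone_chart :: "('a, 'e) chart \<Rightarrow> ('a \<times> real, 'e \<times> real) chart"
  where "cone_chart c = (chart_dom c \<times> {0<..}, \<lambda>(p, t). (coord c p, t))"

definition cone_mfd :: "('a, 'e::euclidean_space) mfd \<Rightarrow> ('a \<times> real, 'e \<times> real) mfd"
  where "cone_mfd N = \<lparr>top_of = prod_topology (top_of N) (top_of_set {0<..}),
                   atlas = cone_chart ` atlas N\<rparr>"

text \<open>\<open>cone_vec N p x a\<close> is the tangent vector \<open>(x, a d/dt)\<close> at any of the points \<open>(p, t)\<close>: in the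
  chart induced by a chart \<open>c\<close> around \<open>p\<close> its components are \<open>(x c, a)\<close>. These are all the
  tangent vectors at \<open>(p, t)\<close>, as \<open>tangent_space_cone\<close> below shows.\<close>

definition cone_vec ::
    "('a, 'e::euclidean_space) mfd \<Rightarrow> 'a \<Rightarrow> ('a, 'e) tvec \<Rightarrow> real \<Rightarrow> ('a \<times> real, 'e \<times> real) tvec"
  where "cone_vec N p x a = (\<lambda>C. if C \<in> cone_chart ` charts_at N p
    then (x (inv_into (charts_at N p) cone_chart C), a) else 0)"

lemma inj_cone_chart: "inj cone_chart"
proof (rule injI)
  fix c d :: "('a, 'e) chart"
  assume eq: "cone_chart c = cone_chart d"
  have "coord c p = coord d p" for p
    using eq by (auto simp: cone_chart_def dest!: fun_cong[of _ _ "(p, 1)"])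
  moreover have "p \<in> chart_dom c \<longleftrightarrow> p \<in> chart_dom d" for p
  proof -
    have "(p, 1::real) \<in> chart_dom c \<times> {0<..} \<longleftrightarrow> (p, 1::real) \<in> chart_dom d \<times> {0<..}"
      using eq by (simp add: cone_chart_def)
    then show ?thesis by simp
  qed
  ultimately show "c = d"
    by (auto simp: prod_eq_iff)
qed

lemma cone_vec_cone_chart: "c \<in> charts_at N p \<Longrightarrow> cone_vec N p x a (cone_chart c) = (x c, a)"
  by (simp add: cone_vec_def inv_into_f_f inj_on_subset[OF inj_cone_chart])

lemma charts_at_cone: "t > 0 \<Longrightarrow> charts_at (cone_mfd N) (p, t) = cone_chart ` charts_at N p"
  by (auto simp: charts_at_def cone_mfd_def cone_chart_def)

lemma cone_transition_deriv:
  assumes N: "smooth_manifold N" and c: "c \<in> charts_at N p" and d: "d \<in> charts_at N p" and t: "t > 0"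
  shows "frechet_derivative (coord (cone_chart d) \<circ> param (cone_chart c)) (at (coord (cone_chart c) (p, t)))
    = (\<lambda>w. (frechet_derivative (coord d \<circ> param c) (at (coord c p)) (fst w), snd w))"
proof -
  let ?S = "coord c ` (chart_dom c \<inter> chart_dom d)"
  have cA: "c \<in> atlas N" "p \<in> chart_dom c" and dA: "d \<in> atlas N" "p \<in> chart_dom d"
    using c d by (auto simp: charts_at_def)
  have chc: "is_chart (top_of N) c" and chd: "is_chart (top_of N) d"
    using N cA dA by (auto simp: smooth_manifold_def)
  have inj: "inj_on (coord c) (chart_dom c)"
    using chc homeomorphic_imp_injective_map[of "subtopology (top_of N) (chart_dom c)"]
      openin_subset[of "top_of N" "chart_dom c"]
    by (auto simp: is_chart_def topspace_subtopology Int_absorb1)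
  have opS: "open ?S"
  proof -
    have "openin (subtopology (top_of N) (chart_dom c)) (chart_dom c \<inter> chart_dom d)"
      using chc chd by (auto simp: is_chart_def openin_subtopology)
    then have "openin (top_of_set (coord c ` chart_dom c)) ?S"
      using chc unfolding is_chart_def
      by (auto dest: homeomorphic_imp_open_map simp: open_map_def)
    then show ?thesis
      using chc by (meson is_chart_def openin_open_eq)
  qed
  have "Ck_on (Suc 0) ?S (coord d \<circ> param c)"
    using N cA dA unfolding smooth_manifold_def smooth_on_def by blast
  then have "(coord d \<circ> param c) differentiable at (coord c p)"
    using cA dA by auto
  then have D: "((coord d \<circ> param c) has_derivative
      frechet_derivative (coord d \<circ> param c) (at (coord c p))) (at (coord c p))"
    by (simp add: frechet_derivative_works)
  have D2: "((\<lambda>w. ((coord d \<circ> param c) (fst w), snd w)) has_derivative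
     (\<lambda>w. (frechet_derivative (coord d \<circ> param c) (at (coord c p)) (fst w), snd w))) (at (coord c p, t))"
    by (rule has_derivative_Pair[OF has_derivative_compose[OF has_derivative_fst[OF has_derivative_ident], of "coord d \<circ> param c"]
      has_derivative_snd[OF has_derivative_ident]]) (simp only: fst_conv D)
  have par: "param (cone_chart c) (u, s) = (param c u, s)" if "u \<in> coord c ` chart_dom c" "s > 0" for u s
    unfolding param_def
  proof (rule inv_into_f_eq)
    show "inj_on (coord (cone_chart c)) (chart_dom (cone_chart c))"
      using inj by (auto simp: cone_chart_def inj_on_def)
    show "(inv_into (chart_dom c) (coord c) u, s) \<in> chart_dom (cone_chart c)"
      using that by (simp add: cone_chart_def inv_into_into)
    show "coord (cone_chart c) (inv_into (chart_dom c) (coord c) u, s) = (u, s)"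
      using that by (simp add: cone_chart_def f_inv_into_f)
  qed
  have "((coord (cone_chart d) \<circ> param (cone_chart c)) has_derivative
     (\<lambda>w. (frechet_derivative (coord d \<circ> param c) (at (coord c p)) (fst w), snd w))) (at (coord c p, t))"
  proof (rule has_derivative_transform_within_open[OF D2])
    show "open (?S \<times> {0::real<..})" by (intro open_Times opS open_greaterThan)
    show "(coord c p, t) \<in> ?S \<times> {0<..}" using cA dA t by auto
    fix w assume "w \<in> ?S \<times> {0::real<..}"
    then obtain u s where w: "w = (u, s)" "u \<in> coord c ` chart_dom c" "s > 0" by auto
    show "((coord d \<circ> param c) (fst w), snd w) = (coord (cone_chart d) \<circ> param (cone_chart c)) w"
      using w par by (simp add: cone_chart_def)
  qed
  from frechet_derivative_at[OF this] show ?thesis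
    by (simp add: cone_chart_def)
qed

lemma tangent_space_cone:
  assumes "smooth_manifold N" "p \<in> carrier N" "t > 0"
  shows "tangent_space (cone_mfd N) (p, t) = {cone_vec N p x a | x a. x \<in> tangent_space N p}"
proof (intro set_eqI iffI)
  fix v assume v: "v \<in> tangent_space (cone_mfd N) (p, t)"
  obtain c0 where c0: "c0 \<in> charts_at N p"
    using assms by (auto simp: smooth_manifold_def charts_at_def)
  have tr: "v (cone_chart d) = (frechet_derivative (coord d \<circ> param c) (at (coord c p)) (fst (v (cone_chart c))), snd (v (cone_chart c)))"
    if "c \<in> charts_at N p" "d \<in> charts_at N p" for c d
  proof -
    have "v (cone_chart d) = frechet_derivative (coord (cone_chart d) \<circ> param (cone_chart c))
        (at (coord (cone_chart c) (p, t))) (v (cone_chart c))"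
      using v that unfolding tangent_space_def charts_at_cone[OF assms(3)] by blast
    then show ?thesis
      unfolding cone_transition_deriv[OF assms(1) that assms(3)] .
  qed
  have z: "v C = 0" if "C \<notin> cone_chart ` charts_at N p" for C
    using v that unfolding tangent_space_def charts_at_cone[OF assms(3)] by blast
  define x where "x = (\<lambda>c. fst (v (cone_chart c)))"
  define a where "a = snd (v (cone_chart c0))"
  have "x \<in> tangent_space N p"
    unfolding tangent_space_def
  proof (intro CollectI conjI ballI allI impI)
    fix c d assume "c \<in> charts_at N p" "d \<in> charts_at N p"
    from tr[OF this]
    show "x d = frechet_derivative (coord d \<circ> param c) (at (coord c p)) (x c)"
      unfolding x_def prod_eq_iff by simp
  next
    fix c assume "c \<notin> charts_at N p"
    then have "cone_chart c \<notin> cone_chart ` charts_at N p"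
      by (simp add: inj_image_mem_iff[OF inj_cone_chart])
    then show "x c = 0" unfolding x_def using z by simp
  qed
  moreover have "v = cone_vec N p x a"
  proof
    fix C show "v C = cone_vec N p x a C"
    proof (cases "C \<in> cone_chart ` charts_at N p")
      case True
      then obtain c where c: "c \<in> charts_at N p" "C = cone_chart c" by auto
      have "snd (v (cone_chart c)) = a" using tr[OF c0 c(1)] unfolding a_def prod_eq_iff by simp
      then show ?thesis using c by (metis cone_vec_cone_chart prod.collapse x_def)
    next
      case False then show ?thesis using z by (simp add: cone_vec_def)
    qed
  qed
  ultimately show "v \<in> {cone_vec N p x a | x a. x \<in> tangent_space N p}" by blast
next
  fix v assume "v \<in> {cone_vec N p x a | x a. x \<in> tangent_space N p}"
  then obtain x a where v: "v = cone_vec N p x a" and x: "x \<in> tangent_space N p" by blast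
  have "v (cone_chart d) = frechet_derivative (coord (cone_chart d) \<circ> param (cone_chart c))
      (at (coord (cone_chart c) (p, t))) (v (cone_chart c))"
    if "c \<in> charts_at N p" "d \<in> charts_at N p" for c d
  proof -
    have "x d = frechet_derivative (coord d \<circ> param c) (at (coord c p)) (x c)"
      using x that unfolding tangent_space_def by blast
    then show ?thesis
      unfolding v cone_transition_deriv[OF assms(1) that assms(3)]
      using that by (simp add: cone_vec_cone_chart)
  qed
  moreover have "v C = 0" if "C \<notin> cone_chart ` charts_at N p" for C
    using that by (simp add: v cone_vec_def)
  ultimately show "v \<in> tangent_space (cone_mfd N) (p, t)"
    unfolding tangent_space_def charts_at_cone[OF assms(3)] by blast
qed

end

theory Submission
  imports Defs
begin

text \<open>
  Write \<open>X\<up>\<close> for the lift \<open>(X, 0)\<close> of a vector field \<open>X\<close> on \<open>N\<close> to the cone and \<open>\<xi>\<close> for the radial field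
  \<open>d/dt\<close>. The theorem rests on computing the Levi-Civita connection \<open>\<nabla>\<close> of the cone from the one of \<open>N\<close>:
  \<open>\<nabla>\<^bsub>X\<up>\<^esub> Y\<up> = (\<nabla>'\<^bsub>X\<^esub> Y)\<up> - t h(X,Y) \<xi>\<close>, \<open>\<nabla>\<^bsub>X\<up>\<^esub> \<xi> = \<nabla>\<^bsub>\<xi>\<^esub> X\<up> = X\<up> / t\<close> and \<open>\<nabla>\<^bsub>\<xi>\<^esub> \<xi> = 0\<close>
  (lemmas \<open>D_lift_lift\<close>, \<open>D_lift_radial\<close>, \<open>D_radial_lift\<close>, \<open>D_radial_radial\<close>). The radial
  term in the first formula and the factor \<open>1/t\<close> in the others both come from differentiating the factor
  \<open>t\<^sup>2\<close> of the metric along \<open>\<xi>\<close>; in the curvature they combine to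
  \<open>R(X\<up>, Y\<up>) Z\<up> = (R'(X,Y) Z - (h(Y,Z) X - h(X,Z) Y))\<up>\<close>, while every component of \<open>R\<close> with an
  argument \<open>\<xi>\<close> vanishes. So the cone over a manifold of any dimension is flat exactly if \<open>R'\<close> is the
  curvature tensor of the unit sphere (lemmas \<open>flat_coneD\<close>, \<open>flat_coneI\<close>). On a surface
  the symmetries of \<open>R'\<close> leave only the component \<open>h(R'(X,Y) Y, X)\<close>, and the condition becomes \<open>k' = 1\<close>.

  The connections are only characterised by their properties, never given by a formula. They are
  identified by testing against all tangent vectors: \<open>koszul\<close> expresses \<open>g(\<nabla>\<^bsub>X\<^esub> Y, Z)\<close>
  by the metric and Lie brackets, and both are known for lifts and \<open>\<xi>\<close>.

  Flatness speaks about arbitrary vector fields on the cone, most of which are not combinations of lifts with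
  constant coefficients. Hence the curvature has to be shown to be linear over smooth functions
  in each argument, after which it may be checked on a local frame of lifts and \<open>\<xi>\<close>
  (\<open>curvature_eq_0_from_frame\<close>). For the third argument this linearity, like the skew-symmetry
  \<open>g(R(X,Y) Z, Z) = 0\<close>, needs \<open>[X,Y] f = X(Y f) - Y(X f)\<close>, that is, the symmetry of second
  derivatives; for this reason the development begins with calculus of smooth maps.
\<close>

section \<open>Calculus of smooth maps\<close>

lemma frechet_derivative_cong_open:
  assumes "open S" "x \<in> S" "\<And>y. y \<in> S \<Longrightarrow> f y = g y"
  shows "frechet_derivative f (at x) = frechet_derivative g (at x)"
proof -
  have "(f has_derivative f') (at x) \<longleftrightarrow> (g has_derivative f') (at x)" for f'
    using has_derivative_transform_within_open[of f f' x UNIV S g]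
      has_derivative_transform_within_open[of g f' x UNIV S f] assms by auto
  then show ?thesis by (simp add: frechet_derivative_def)
qed

lemma differentiable_cong_open:
  assumes "open S" "x \<in> S" "\<And>y. y \<in> S \<Longrightarrow> f y = g y"
  shows "f differentiable at x \<longleftrightarrow> g differentiable at x"
  using has_derivative_transform_within_open[of f _ x UNIV S g]
      has_derivative_transform_within_open[of g _ x UNIV S f] assms
  by (auto simp: differentiable_def)

lemma Ck_on_cong:
  assumes "open S" "\<And>x. x \<in> S \<Longrightarrow> f x = g x"
  shows "Ck_on k S f \<longleftrightarrow> Ck_on k S g"
  using assms(2)
proof (induction k arbitrary: f g)
  case 0 then show ?case by (simp cong: continuous_on_cong)
next
  case (Suc k)
  have "Ck_on k S (\<lambda>x. frechet_derivative f (at x) v) \<longleftrightarrow> Ck_on k S (\<lambda>x. frechet_derivative g (at x) v)" for v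
  proof (rule Suc.IH)
    fix x assume "x \<in> S"
    from frechet_derivative_cong_open[OF assms(1) this Suc.prems]
    show "frechet_derivative f (at x) v = frechet_derivative g (at x) v" by simp
  qed
  moreover have "f differentiable at x \<longleftrightarrow> g differentiable at x" if "x \<in> S" for x
    by (rule differentiable_cong_open[OF assms(1) that Suc.prems])
  ultimately show ?case by simp
qed

lemma Ck_on_subset: "Ck_on k T f \<Longrightarrow> S \<subseteq> T \<Longrightarrow> Ck_on k S f"
  by (induction k arbitrary: f) (auto intro: continuous_on_subset)

lemma Ck_on_imp_continuous_on: "Ck_on k S f \<Longrightarrow> continuous_on S f"
  by (cases k) (auto intro!: continuous_at_imp_continuous_on differentiable_imp_continuous_within)

lemma Ck_on_Suc_imp: "Ck_on (Suc k) S f \<Longrightarrow> Ck_on k S f"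
proof (induction k arbitrary: f)
  case 0 then show ?case using Ck_on_imp_continuous_on[OF 0] by simp
next
  case (Suc k)
  have "f differentiable at x" if "x \<in> S" for x
    using Suc.prems that Ck_on.simps(2) by blast
  moreover have "Ck_on k S (\<lambda>x. frechet_derivative f (at x) v)" for v
    by (rule Suc.IH) (use Suc.prems Ck_on.simps(2) in blast)
  ultimately show ?case by simp
qed

text \<open>This rule lets a derivative be supplied in any convenient form, instead of the
  choice-based \<open>frechet_derivative\<close>.\<close>

lemma Ck_on_SucI:
  assumes "open S" "\<And>x. x \<in> S \<Longrightarrow> (f has_derivative f' x) (at x)" "\<And>v. Ck_on k S (\<lambda>x. f' x v)"
  shows "Ck_on (Suc k) S f"
proof -
  have "Ck_on k S (\<lambda>x. frechet_derivative f (at x) v) \<longleftrightarrow> Ck_on k S (\<lambda>x. f' x v)" for v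
    by (rule Ck_on_cong[OF assms(1)]) (simp add: frechet_derivative_at[OF assms(2), symmetric])
  moreover have "f differentiable at x" if "x \<in> S" for x using assms(2)[OF that] by (rule differentiableI)
  ultimately show ?thesis using assms(3) by simp
qed

lemma Ck_on_SucD:
  assumes "Ck_on (Suc k) S f" "x \<in> S"
  shows "(f has_derivative frechet_derivative f (at x)) (at x)"
  using assms by (simp add: frechet_derivative_works)

lemma Ck_on_const: "Ck_on k S (\<lambda>x. c)"
  by (induction k arbitrary: c) simp_all

lemma Ck_on_bounded_linear:
  assumes S: "open S" and L: "bounded_linear L" and f: "Ck_on k S f"
  shows "Ck_on k S (\<lambda>x. L (f x))"
  using f
proof (induction k arbitrary: f)
  case 0 then show ?case
    using bounded_linear.continuous_on[OF L] by auto
next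
  case (Suc k)
  show ?case
  proof (rule Ck_on_SucI[OF S])
    show "((\<lambda>x. L (f x)) has_derivative (\<lambda>v. L (frechet_derivative f (at x) v))) (at x)" if "x \<in> S" for x
      by (rule bounded_linear.has_derivative[OF L Ck_on_SucD[OF Suc.prems that]])
  qed (use Suc in auto)
qed

lemma Ck_on_add:
  assumes S: "open S" and "Ck_on k S f" "Ck_on k S g"
  shows "Ck_on k S (\<lambda>x. f x + g x)"
  using assms(2,3)
proof (induction k arbitrary: f g)
  case 0 then show ?case by (auto intro: continuous_intros)
next
  case (Suc k)
  show ?case
  proof (rule Ck_on_SucI[OF S])
    show "((\<lambda>x. f x + g x) has_derivative (\<lambda>v. frechet_derivative f (at x) v + frechet_derivative g (at x) v)) (at x)" if "x \<in> S" for x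
      using Ck_on_SucD[OF Suc.prems(1) that] Ck_on_SucD[OF Suc.prems(2) that] by (rule has_derivative_add)
  qed (use Suc in auto)
qed

lemma Ck_on_sum:
  assumes "open S" "\<And>i. i \<in> I \<Longrightarrow> Ck_on k S (f i)"
  shows "Ck_on k S (\<lambda>x. \<Sum>i\<in>I. f i x)"
  using assms(2)
  by (induction I rule: infinite_finite_induct) (auto intro: Ck_on_const Ck_on_add assms(1))

lemma Ck_on_scaleR:
  fixes f :: "'e::euclidean_space \<Rightarrow> real"
  assumes S: "open S" and "Ck_on k S f" "Ck_on k S g"
  shows "Ck_on k S (\<lambda>x. f x *\<^sub>R g x)"
  using assms(2,3)
proof (induction k arbitrary: f g)
  case 0 then show ?case by (auto intro: continuous_intros)
next
  case (Suc k)
  show ?case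
  proof (rule Ck_on_SucI[OF S])
    show "((\<lambda>x. f x *\<^sub>R g x) has_derivative
        (\<lambda>v. f x *\<^sub>R frechet_derivative g (at x) v + frechet_derivative f (at x) v *\<^sub>R g x)) (at x)" if "x \<in> S" for x
      using Ck_on_SucD[OF Suc.prems(1) that] Ck_on_SucD[OF Suc.prems(2) that] by (rule has_derivative_scaleR)
    show "Ck_on k S (\<lambda>x. f x *\<^sub>R frechet_derivative g (at x) v + frechet_derivative f (at x) v *\<^sub>R g x)" for v
      using Suc.prems Ck_on_Suc_imp[OF Suc.prems(1)] Ck_on_Suc_imp[OF Suc.prems(2)]
      by (intro Ck_on_add[OF S] Suc.IH) auto
  qed
qed

lemma Ck_on_inverse:
  fixes f :: "'e::euclidean_space \<Rightarrow> real"
  assumes S: "open S" and "Ck_on k S f" and nz: "\<And>x. x \<in> S \<Longrightarrow> f x \<noteq> 0"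
  shows "Ck_on k S (\<lambda>x. inverse (f x))"
  using assms(2)
proof (induction k)
  case 0 then show ?case using nz by (auto intro: continuous_intros)
next
  case (Suc k)
  have IH: "Ck_on k S (\<lambda>x. inverse (f x))" by (rule Suc.IH[OF Ck_on_Suc_imp[OF Suc.prems]])
  show ?case
  proof (rule Ck_on_SucI[OF S])
    show "((\<lambda>x. inverse (f x)) has_derivative
        (\<lambda>v. (- 1) *\<^sub>R (inverse (f x) *\<^sub>R (inverse (f x) *\<^sub>R frechet_derivative f (at x) v)))) (at x)" if "x \<in> S" for x
      using Deriv.has_derivative_inverse[OF nz[OF that] Ck_on_SucD[OF Suc.prems that]]
      by (simp add: mult.commute mult.left_commute)
    show "Ck_on k S (\<lambda>x. (- 1) *\<^sub>R (inverse (f x) *\<^sub>R (inverse (f x) *\<^sub>R frechet_derivative f (at x) v)))" for v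
      using Suc.prems IH by (intro Ck_on_scaleR[OF S] Ck_on_const) auto
  qed
qed

lemma linear_eq_sum_Basis:
  fixes L :: "'e::euclidean_space \<Rightarrow> 'f::real_vector"
  assumes "linear L"
  shows "L w = (\<Sum>i\<in>Basis. (w \<bullet> i) *\<^sub>R L i)"
proof -
  have "L w = L (\<Sum>i\<in>Basis. (w \<bullet> i) *\<^sub>R i)" by (simp add: euclidean_representation)
  then show ?thesis by (simp add: linear_sum[OF assms] linear_scale[OF assms])
qed

text \<open>The chain rule writes the derivative of the composition as a finite sum of products
  of derivatives of \<open>g\<close> with partial derivatives of \<open>f\<close> composed with \<open>g\<close>; to these the induction
  hypothesis, which is for all \<open>f\<close>, and the product rule apply.\<close>

lemma Ck_on_compose:
  fixes f :: "'e::euclidean_space \<Rightarrow> 'f::real_normed_vector" and g :: "'d::euclidean_space \<Rightarrow> 'e"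
  assumes S: "open S" and T: "open T" and "Ck_on k S g" "Ck_on k T f" and gST: "g ` S \<subseteq> T"
  shows "Ck_on k S (\<lambda>x. f (g x))"
  using assms(3,4)
proof (induction k arbitrary: f)
  case 0 then show ?case
    using continuous_on_compose2[of T f S g] gST by auto
next
  case (Suc k)
  have lin: "linear (frechet_derivative f (at y))" if "y \<in> T" for y
    using Ck_on_SucD[OF Suc.prems(2) that] has_derivative_linear by blast
  show ?case
  proof (rule Ck_on_SucI[OF S])
    fix x assume x: "x \<in> S"
    then have "g x \<in> T" using gST by auto
    have "(\<lambda>v. frechet_derivative f (at (g x)) (frechet_derivative g (at x) v)) =
      (\<lambda>v. \<Sum>i\<in>Basis. (frechet_derivative g (at x) v \<bullet> i) *\<^sub>R frechet_derivative f (at (g x)) i)"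
      by (rule ext) (rule linear_eq_sum_Basis[OF lin[OF \<open>g x \<in> T\<close>]])
    with has_derivative_compose[OF Ck_on_SucD[OF Suc.prems(1) x] Ck_on_SucD[OF Suc.prems(2) \<open>g x \<in> T\<close>]]
    show "((\<lambda>x. f (g x)) has_derivative
      (\<lambda>v. \<Sum>i\<in>Basis. (frechet_derivative g (at x) v \<bullet> i) *\<^sub>R frechet_derivative f (at (g x)) i)) (at x)"
      by (simp only:)
  next
    show "Ck_on k S (\<lambda>x. \<Sum>i\<in>Basis. (frechet_derivative g (at x) v \<bullet> i) *\<^sub>R frechet_derivative f (at (g x)) i)" for v
    proof (intro Ck_on_sum[OF S] Ck_on_scaleR[OF S] Ck_on_bounded_linear[OF S bounded_linear_inner_left])
      show "Ck_on k S (\<lambda>x. frechet_derivative g (at x) v)"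
        using Suc.prems(1) by simp
      show "Ck_on k S (\<lambda>x. frechet_derivative f (at (g x)) i)" for i
        by (rule Suc.IH[OF Ck_on_Suc_imp[OF Suc.prems(1)]]) (use Suc.prems(2) in simp)
    qed
  qed
qed

lemma smooth_on_cong: "open S \<Longrightarrow> (\<And>x. x \<in> S \<Longrightarrow> f x = g x) \<Longrightarrow> smooth_on S f \<longleftrightarrow> smooth_on S g"
  unfolding smooth_on_def using Ck_on_cong by blast

lemma smooth_on_subset: "smooth_on T f \<Longrightarrow> S \<subseteq> T \<Longrightarrow> smooth_on S f"
  unfolding smooth_on_def using Ck_on_subset by blast

lemma smooth_on_const: "smooth_on S (\<lambda>x. c)"
  by (simp add: smooth_on_def Ck_on_const)

lemma smooth_on_add: "open S \<Longrightarrow> smooth_on S f \<Longrightarrow> smooth_on S g \<Longrightarrow> smooth_on S (\<lambda>x. f x + g x)"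
  by (simp add: smooth_on_def Ck_on_add)

lemma smooth_on_sum: "open S \<Longrightarrow> (\<And>i. i \<in> I \<Longrightarrow> smooth_on S (f i)) \<Longrightarrow> smooth_on S (\<lambda>x. \<Sum>i\<in>I. f i x)"
  by (simp add: smooth_on_def Ck_on_sum)

lemma smooth_on_scaleR:
  fixes f :: "'e::euclidean_space \<Rightarrow> real"
  shows "open S \<Longrightarrow> smooth_on S f \<Longrightarrow> smooth_on S g \<Longrightarrow> smooth_on S (\<lambda>x. f x *\<^sub>R g x)"
  by (simp add: smooth_on_def Ck_on_scaleR)

lemma smooth_on_mult:
  fixes f g :: "'e::euclidean_space \<Rightarrow> real"
  shows "open S \<Longrightarrow> smooth_on S f \<Longrightarrow> smooth_on S g \<Longrightarrow> smooth_on S (\<lambda>x. f x * g x)"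
  using smooth_on_scaleR[of S f g] by simp

lemma smooth_on_inverse:
  fixes f :: "'e::euclidean_space \<Rightarrow> real"
  shows "open S \<Longrightarrow> smooth_on S f \<Longrightarrow> (\<And>x. x \<in> S \<Longrightarrow> f x \<noteq> 0) \<Longrightarrow> smooth_on S (\<lambda>x. inverse (f x))"
  by (simp add: smooth_on_def Ck_on_inverse)

lemma smooth_on_bounded_linear:
  "open S \<Longrightarrow> bounded_linear L \<Longrightarrow> smooth_on S f \<Longrightarrow> smooth_on S (\<lambda>x. L (f x))"
  by (simp add: smooth_on_def Ck_on_bounded_linear)

lemma smooth_on_compose:
  fixes f :: "'e::euclidean_space \<Rightarrow> 'f::real_normed_vector" and g :: "'d::euclidean_space \<Rightarrow> 'e"
  shows "open S \<Longrightarrow> open T \<Longrightarrow> smooth_on S g \<Longrightarrow> smooth_on T f \<Longrightarrow> g ` S \<subseteq> T \<Longrightarrow> smooth_on S (\<lambda>x. f (g x))"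
  unfolding smooth_on_def using Ck_on_compose by blast

lemma smooth_on_ident:
  assumes "open S"
  shows "smooth_on S (\<lambda>x. x)"
  unfolding smooth_on_def
proof
  fix k show "Ck_on k S (\<lambda>x. x)"
    using Ck_on_SucI[OF assms has_derivative_ident Ck_on_const] by (cases k) auto
qed

lemma smooth_on_imp_has_derivative:
  "smooth_on S f \<Longrightarrow> x \<in> S \<Longrightarrow> (f has_derivative frechet_derivative f (at x)) (at x)"
  unfolding smooth_on_def using Ck_on_SucD by blast

lemma smooth_on_imp_linear:
  "smooth_on S f \<Longrightarrow> x \<in> S \<Longrightarrow> linear (frechet_derivative f (at x))"
  using smooth_on_imp_has_derivative has_derivative_linear by blast

lemma smooth_on_frechet_derivative:
  "smooth_on S f \<Longrightarrow> smooth_on S (\<lambda>x. frechet_derivative f (at x) v)"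
  unfolding smooth_on_def by (metis Ck_on.simps(2))

lemma smooth_on_imp_continuous_on: "smooth_on S f \<Longrightarrow> continuous_on S f"
  unfolding smooth_on_def using Ck_on.simps(1) by blast

lemma has_real_derivative_along_line:
  fixes f :: "'e::euclidean_space \<Rightarrow> real"
  assumes "(f has_derivative D) (at (a + s *\<^sub>R v))"
  shows "((\<lambda>s. f (a + s *\<^sub>R v)) has_real_derivative D v) (at s)"
proof -
  have "((\<lambda>s. a + s *\<^sub>R v) has_derivative (\<lambda>r. r *\<^sub>R v)) (at s)"
    by (auto intro!: derivative_eq_intros)
  from has_derivative_compose[OF this assms]
  have "((\<lambda>s. f (a + s *\<^sub>R v)) has_derivative (\<lambda>r. D (r *\<^sub>R v))) (at s)" .
  moreover have "(\<lambda>r. D (r *\<^sub>R v)) = (*) (D v)"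
    using linear_scale[OF has_derivative_linear[OF assms]] by auto
  ultimately show ?thesis by (simp add: has_field_derivative_def)
qed

text \<open>The second difference of \<open>f\<close> on a small parallelogram is, by two applications of the mean
  value theorem, the value of an iterated directional derivative at some point of it.\<close>

lemma second_difference_mean_value:
  fixes f :: "'e::euclidean_space \<Rightarrow> real"
  assumes f: "smooth_on S f" and \<delta>: "0 < \<delta>"
    and inS: "\<And>r s. r \<in> {0..\<delta>} \<Longrightarrow> s \<in> {0..\<delta>} \<Longrightarrow> u + r *\<^sub>R v + s *\<^sub>R w \<in> S"
  obtains r s where "r \<in> {0..\<delta>}" "s \<in> {0..\<delta>}"
    "f (u + \<delta> *\<^sub>R v + \<delta> *\<^sub>R w) - f (u + \<delta> *\<^sub>R v) - f (u + \<delta> *\<^sub>R w) + f u =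
     \<delta>\<^sup>2 * frechet_derivative (\<lambda>x. frechet_derivative f (at x) v) (at (u + r *\<^sub>R v + s *\<^sub>R w)) w"
proof -
  let ?d = "\<lambda>x. frechet_derivative f (at x) v"
  define G where "G = (\<lambda>r. f (u + \<delta> *\<^sub>R w + r *\<^sub>R v) - f (u + r *\<^sub>R v))"
  have G: "(G has_real_derivative ?d (u + \<delta> *\<^sub>R w + r *\<^sub>R v) - ?d (u + r *\<^sub>R v)) (at r)" if "r \<in> {0..\<delta>}" for r
  proof -
    have 1: "u + \<delta> *\<^sub>R w + r *\<^sub>R v \<in> S" "u + r *\<^sub>R v \<in> S"
      using inS[of r \<delta>] inS[of r 0] that \<delta> by (auto simp: algebra_simps)
    show ?thesis unfolding G_def
      by (intro DERIV_diff has_real_derivative_along_line smooth_on_imp_has_derivative[OF f] 1)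
  qed
  obtain r where r: "0 < r" "r < \<delta>" "G \<delta> - G 0 = (\<delta> - 0) * (?d (u + \<delta> *\<^sub>R w + r *\<^sub>R v) - ?d (u + r *\<^sub>R v))"
    using MVT2[OF \<delta>, of G "\<lambda>r. ?d (u + \<delta> *\<^sub>R w + r *\<^sub>R v) - ?d (u + r *\<^sub>R v)"] G by auto
  have H: "((\<lambda>s. ?d ((u + r *\<^sub>R v) + s *\<^sub>R w)) has_real_derivative
      frechet_derivative ?d (at (u + r *\<^sub>R v + s *\<^sub>R w)) w) (at s)" if "s \<in> {0..\<delta>}" for s
    using inS[of r s] r that
    by (intro has_real_derivative_along_line smooth_on_imp_has_derivative[OF smooth_on_frechet_derivative[OF f]]) auto
  obtain s where s: "0 < s" "s < \<delta>" "?d ((u + r *\<^sub>R v) + \<delta> *\<^sub>R w) - ?d ((u + r *\<^sub>R v) + 0 *\<^sub>R w) =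
      (\<delta> - 0) * frechet_derivative ?d (at (u + r *\<^sub>R v + s *\<^sub>R w)) w"
    using MVT2[OF \<delta>, of "\<lambda>s. ?d ((u + r *\<^sub>R v) + s *\<^sub>R w)"
        "\<lambda>s. frechet_derivative ?d (at (u + r *\<^sub>R v + s *\<^sub>R w)) w"] H by auto
  have "f (u + \<delta> *\<^sub>R v + \<delta> *\<^sub>R w) - f (u + \<delta> *\<^sub>R v) - f (u + \<delta> *\<^sub>R w) + f u = G \<delta> - G 0"
    by (simp add: G_def algebra_simps)
  also have "\<dots> = \<delta>\<^sup>2 * frechet_derivative ?d (at (u + r *\<^sub>R v + s *\<^sub>R w)) w"
    using r(3) s(3) by (simp add: algebra_simps power2_eq_square)
  finally show ?thesis using that[of r s] r s by auto
qed

text \<open>Both iterated derivatives at \<open>u\<close> are limits of the same second difference divided by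
  \<open>\<delta>\<^sup>2\<close>: the difference is symmetric in \<open>v\<close> and \<open>w\<close>, so the mean value theorem may be applied in either order.\<close>

lemma Clairaut:
  fixes f :: "'e::euclidean_space \<Rightarrow> real"
  assumes f: "smooth_on S f" and S: "open S" and u: "u \<in> S"
  shows "frechet_derivative (\<lambda>x. frechet_derivative f (at x) v) (at u) w =
         frechet_derivative (\<lambda>x. frechet_derivative f (at x) w) (at u) v" (is "?A u = ?B u")
proof (rule ccontr)
  assume ne: "?A u \<noteq> ?B u"
  define \<epsilon> where "\<epsilon> = \<bar>?A u - ?B u\<bar> / 2"
  have \<epsilon>: "\<epsilon> > 0" using ne by (simp add: \<epsilon>_def)
  have cont: "continuous_on S ?A" "continuous_on S ?B"
    by (intro smooth_on_imp_continuous_on smooth_on_frechet_derivative f)+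
  obtain d1 where d1: "d1 > 0" "\<And>x. x \<in> S \<Longrightarrow> dist x u < d1 \<Longrightarrow> dist (?A x) (?A u) < \<epsilon>"
    using cont(1)[unfolded continuous_on_iff, rule_format, OF u \<epsilon>] by blast
  obtain d2 where d2: "d2 > 0" "\<And>x. x \<in> S \<Longrightarrow> dist x u < d2 \<Longrightarrow> dist (?B x) (?B u) < \<epsilon>"
    using cont(2)[unfolded continuous_on_iff, rule_format, OF u \<epsilon>] by blast
  obtain d3 where d3: "d3 > 0" "ball u d3 \<subseteq> S" using S u open_contains_ball by blast
  define d where "d = min d1 (min d2 d3)"
  \<comment> \<open>The summand 1 avoids division by zero for \<open>v = w = 0\<close>; with this \<open>\<delta>\<close> the parallelogram stays within distance \<open>d\<close>.\<close>
  define \<delta> where "\<delta> = d / (norm v + norm w + 1)"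
  have nn: "norm v + norm w + 1 > 0" by (simp add: add_nonneg_pos)
  have dp: "d > 0" using d1 d2 d3 by (simp add: d_def)
  have \<delta>: "\<delta> > 0" using dp nn by (simp add: \<delta>_def)
  have close: "dist (u + r *\<^sub>R v + s *\<^sub>R w) u < d" if "r \<in> {0..\<delta>}" "s \<in> {0..\<delta>}" for r s
  proof -
    have "dist (u + r *\<^sub>R v + s *\<^sub>R w) u = norm (r *\<^sub>R v + s *\<^sub>R w)"
      by (simp add: dist_norm algebra_simps)
    also have "\<dots> \<le> r * norm v + s * norm w"
      using that by (intro norm_triangle_le) simp
    also have "\<dots> \<le> \<delta> * norm v + \<delta> * norm w"
      using that by (intro add_mono mult_right_mono) auto
    also have "\<dots> < \<delta> * (norm v + norm w + 1)" using \<delta> by (simp add: algebra_simps)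
    also have "\<dots> = d" using nn by (simp add: \<delta>_def)
    finally show ?thesis .
  qed
  have inS: "u + r *\<^sub>R v + s *\<^sub>R w \<in> S" if "r \<in> {0..\<delta>}" "s \<in> {0..\<delta>}" for r s
    using close[OF that] d3 by (auto simp: d_def dist_commute)
  obtain r s where rs: "r \<in> {0..\<delta>}" "s \<in> {0..\<delta>}"
    "f (u + \<delta> *\<^sub>R v + \<delta> *\<^sub>R w) - f (u + \<delta> *\<^sub>R v) - f (u + \<delta> *\<^sub>R w) + f u = \<delta>\<^sup>2 * ?A (u + r *\<^sub>R v + s *\<^sub>R w)"
    using second_difference_mean_value[OF f \<delta> inS] by blast
  have inS': "u + r *\<^sub>R w + s *\<^sub>R v \<in> S" if "r \<in> {0..\<delta>}" "s \<in> {0..\<delta>}" for r s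
    using inS[OF that(2,1)] by (simp add: algebra_simps)
  obtain r' s' where rs': "r' \<in> {0..\<delta>}" "s' \<in> {0..\<delta>}"
    "f (u + \<delta> *\<^sub>R w + \<delta> *\<^sub>R v) - f (u + \<delta> *\<^sub>R w) - f (u + \<delta> *\<^sub>R v) + f u = \<delta>\<^sup>2 * ?B (u + r' *\<^sub>R w + s' *\<^sub>R v)"
    using second_difference_mean_value[OF f \<delta> inS'] by blast
  have "\<delta>\<^sup>2 * ?A (u + r *\<^sub>R v + s *\<^sub>R w) = \<delta>\<^sup>2 * ?B (u + s' *\<^sub>R v + r' *\<^sub>R w)"
    using rs(3) rs'(3) by (simp add: algebra_simps)
  then have eq: "?A (u + r *\<^sub>R v + s *\<^sub>R w) = ?B (u + s' *\<^sub>R v + r' *\<^sub>R w)" using \<delta> by simp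
  have "dist (?A (u + r *\<^sub>R v + s *\<^sub>R w)) (?A u) < \<epsilon>" "dist (?B (u + s' *\<^sub>R v + r' *\<^sub>R w)) (?B u) < \<epsilon>"
    using d1(2)[OF inS[OF rs(1,2)]] d2(2)[OF inS[OF rs'(2,1)]] close[OF rs(1,2)] close[OF rs'(2,1)]
    by (auto simp: d_def)
  then have "\<bar>?A u - ?B u\<bar> < 2 * \<epsilon>" unfolding eq dist_real_def by linarith
  then show False by (simp add: \<epsilon>_def)
qed

lemma smooth_on_frechet_derivative_apply:
  assumes "open S" "smooth_on S F" "smooth_on S b"
  shows "smooth_on S (\<lambda>u. frechet_derivative F (at u) (b u))"
proof -
  have "smooth_on S (\<lambda>u. \<Sum>i\<in>Basis. (b u \<bullet> i) *\<^sub>R frechet_derivative F (at u) i)"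
    using assms by (intro smooth_on_sum smooth_on_scaleR smooth_on_frechet_derivative
      smooth_on_bounded_linear[OF _ bounded_linear_inner_left]) auto
  moreover have "frechet_derivative F (at u) (b u) = (\<Sum>i\<in>Basis. (b u \<bullet> i) *\<^sub>R frechet_derivative F (at u) i)"
    if "u \<in> S" for u
    by (rule linear_eq_sum_Basis[OF smooth_on_imp_linear[OF assms(2) that]])
  ultimately show ?thesis
    using smooth_on_cong[OF assms(1)] by (metis (no_types, lifting))
qed

text \<open>The product rule for a derivative \<open>DF(u)(b(u))\<close> whose argument varies with \<open>u\<close>; the sum is
  the second derivative of \<open>F\<close> in the directions \<open>b(u)\<close> and \<open>w\<close>.\<close>

lemma frechet_derivative_frechet_derivative_apply:
  assumes S: "open S" "u \<in> S" and F: "smooth_on S F" and b: "smooth_on S b"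
  shows "frechet_derivative (\<lambda>u. frechet_derivative F (at u) (b u)) (at u) w =
    frechet_derivative F (at u) (frechet_derivative b (at u) w) +
    (\<Sum>i\<in>Basis. (b u \<bullet> i) *\<^sub>R frechet_derivative (\<lambda>u. frechet_derivative F (at u) i) (at u) w)"
proof -
  note lin = linear_eq_sum_Basis[OF smooth_on_imp_linear[OF F]]
  have "((\<lambda>u. \<Sum>i\<in>Basis. (b u \<bullet> i) *\<^sub>R frechet_derivative F (at u) i) has_derivative
     (\<lambda>w. \<Sum>i\<in>Basis. (b u \<bullet> i) *\<^sub>R frechet_derivative (\<lambda>u. frechet_derivative F (at u) i) (at u) w
       + (frechet_derivative b (at u) w \<bullet> i) *\<^sub>R frechet_derivative F (at u) i)) (at u)"
    by (intro has_derivative_sum has_derivative_scaleR has_derivative_inner_left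
      smooth_on_imp_has_derivative[OF b S(2)]
      smooth_on_imp_has_derivative[OF smooth_on_frechet_derivative[OF F] S(2)])
  from fun_cong[OF frechet_derivative_at[OF this], of w, symmetric]
  have "frechet_derivative (\<lambda>u. \<Sum>i\<in>Basis. (b u \<bullet> i) *\<^sub>R frechet_derivative F (at u) i) (at u) w =
     (\<Sum>i\<in>Basis. (b u \<bullet> i) *\<^sub>R frechet_derivative (\<lambda>u. frechet_derivative F (at u) i) (at u) w) +
     (\<Sum>i\<in>Basis. (frechet_derivative b (at u) w \<bullet> i) *\<^sub>R frechet_derivative F (at u) i)"
    by (simp only: sum.distrib)
  also have "(\<Sum>i\<in>Basis. (frechet_derivative b (at u) w \<bullet> i) *\<^sub>R frechet_derivative F (at u) i) =
     frechet_derivative F (at u) (frechet_derivative b (at u) w)"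
    by (rule lin[OF S(2), symmetric])
  also have "frechet_derivative (\<lambda>u. \<Sum>i\<in>Basis. (b u \<bullet> i) *\<^sub>R frechet_derivative F (at u) i) (at u) =
     frechet_derivative (\<lambda>u. frechet_derivative F (at u) (b u)) (at u)"
    by (rule frechet_derivative_cong_open[OF S]) (rule lin[symmetric])
  finally show ?thesis by (simp only: add.commute)
qed

section \<open>Manifolds in charts\<close>

lemma scaleR_fun_apply: "(r *\<^sub>R f) x = r *\<^sub>R f x"
  by (simp add: scaleR_fun_def)

locale smooth_mfd =
  fixes M :: "('a, 'e::euclidean_space) mfd"
  assumes smooth_manifold: "smooth_manifold M"
begin

lemma is_chart: "c \<in> atlas M \<Longrightarrow> is_chart (top_of M) c"
  using smooth_manifold by (simp add: smooth_manifold_def)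

lemma openin_chart_dom: "c \<in> atlas M \<Longrightarrow> openin (top_of M) (chart_dom c)"
  using is_chart by (simp add: is_chart_def)

lemma inj_on_coord: "c \<in> atlas M \<Longrightarrow> inj_on (coord c) (chart_dom c)"
  using is_chart[of c] openin_chart_dom[of c] homeomorphic_imp_injective_map openin_subset
  by (fastforce simp: is_chart_def Int_absorb1)

lemma open_coord_image:
  assumes "c \<in> atlas M" "openin (top_of M) U"
  shows "open (coord c ` (U \<inter> chart_dom c))"
proof -
  have "openin (subtopology (top_of M) (chart_dom c)) (U \<inter> chart_dom c)"
    using assms(2) by (auto simp: openin_subtopology)
  then have "openin (top_of_set (coord c ` chart_dom c)) (coord c ` (U \<inter> chart_dom c))"
    using is_chart[OF assms(1)] unfolding is_chart_def
    by (auto dest: homeomorphic_imp_open_map simp: open_map_def)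
  then show ?thesis
    using is_chart[OF assms(1)] by (meson is_chart_def openin_open_eq)
qed

lemma param_coord: "c \<in> atlas M \<Longrightarrow> q \<in> chart_dom c \<Longrightarrow> param c (coord c q) = q"
  by (simp add: param_def inj_on_coord)

lemma charts_at_atlas: "c \<in> charts_at M q \<Longrightarrow> c \<in> atlas M"
  and charts_at_dom: "c \<in> charts_at M q \<Longrightarrow> q \<in> chart_dom c"
  by (auto simp: charts_at_def)

lemma charts_atI: "c \<in> atlas M \<Longrightarrow> q \<in> chart_dom c \<Longrightarrow> c \<in> charts_at M q"
  by (simp add: charts_at_def)

lemma carrier_charts_at: "q \<in> carrier M \<Longrightarrow> \<exists>c. c \<in> charts_at M q"
  using smooth_manifold by (auto simp: smooth_manifold_def charts_at_def)

lemma openin_carrier: "openin (top_of M) U \<Longrightarrow> q \<in> U \<Longrightarrow> q \<in> carrier M"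
  using openin_subset by blast

lemma charts_at_carrier: "c \<in> charts_at M q \<Longrightarrow> q \<in> carrier M"
  unfolding charts_at_def using openin_carrier[OF openin_chart_dom] by blast

lemma smooth_transition:
  "c \<in> atlas M \<Longrightarrow> d \<in> atlas M \<Longrightarrow> smooth_on (coord c ` (chart_dom c \<inter> chart_dom d)) (coord d \<circ> param c)"
  using smooth_manifold unfolding smooth_manifold_def by blast

lemma open_overlap: "c \<in> atlas M \<Longrightarrow> d \<in> atlas M \<Longrightarrow> open (coord c ` (chart_dom c \<inter> chart_dom d))"
  using open_coord_image[OF _ openin_chart_dom] by (metis Int_commute)

abbreviation transition :: "'a \<Rightarrow> ('a, 'e) chart \<Rightarrow> ('a, 'e) chart \<Rightarrow> 'e \<Rightarrow> 'e" where
  "transition q c d \<equiv> frechet_derivative (coord d \<circ> param c) (at (coord c q))"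

lemma has_derivative_transition:
  assumes "c \<in> charts_at M q" "d \<in> charts_at M q"
  shows "((coord d \<circ> param c) has_derivative transition q c d) (at (coord c q))"
  by (rule smooth_on_imp_has_derivative[OF smooth_transition]) (use assms in \<open>auto simp: charts_at_def\<close>)

lemma linear_transition: "c \<in> charts_at M q \<Longrightarrow> d \<in> charts_at M q \<Longrightarrow> linear (transition q c d)"
  using has_derivative_transition has_derivative_linear by blast

text \<open>Every independence of the choice of a chart below is an instance of this change of
  coordinates.\<close>

lemma chain_param:
  assumes c: "c \<in> charts_at M q" and d: "d \<in> charts_at M q"
    and U: "openin (top_of M) U" "q \<in> U"
    and f: "((f \<circ> param d) has_derivative f') (at (coord d q))"
  shows "((f \<circ> param c) has_derivative (\<lambda>v. f' (transition q c d v))) (at (coord c q))"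
proof -
  let ?S = "coord c ` ((chart_dom c \<inter> chart_dom d))"
  have cd: "c \<in> atlas M" "q \<in> chart_dom c" "d \<in> atlas M" "q \<in> chart_dom d"
    using c d by (auto simp: charts_at_def)
  have "(coord d \<circ> param c) (coord c q) = coord d q" by (simp add: param_coord cd)
  with has_derivative_compose[OF has_derivative_transition[OF c d], of "f \<circ> param d" f'] f
  have "((\<lambda>x. (f \<circ> param d) ((coord d \<circ> param c) x)) has_derivative (\<lambda>v. f' (transition q c d v))) (at (coord c q))"
    by simp
  then show ?thesis
    by (rule has_derivative_transform_within_open[OF _ open_overlap[OF cd(1,3)]])
      (use cd in \<open>auto simp: param_coord\<close>)
qed

lemma transition_trans:
  assumes c: "c \<in> charts_at M q" and d: "d \<in> charts_at M q" and e: "e \<in> charts_at M q"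
  shows "transition q d e (transition q c d v) = transition q c e v"
  using chain_param[OF c d openin_chart_dom[OF charts_at_atlas[OF c]] charts_at_dom[OF c]
      has_derivative_transition[OF d e]] frechet_derivative_at by metis

lemma transition_self:
  assumes "c \<in> charts_at M q"
  shows "transition q c c v = v"
proof -
  have c: "c \<in> atlas M" "q \<in> chart_dom c" using assms by (auto simp: charts_at_def)
  have "((coord c \<circ> param c) has_derivative (\<lambda>v. v)) (at (coord c q))"
    by (rule has_derivative_transform_within_open[OF has_derivative_ident open_overlap[OF c(1) c(1)]])
      (use c in \<open>auto simp: param_coord\<close>)
  then show ?thesis using frechet_derivative_at by metis
qed

lemma tangent_space_transition:
  "v \<in> tangent_space M q \<Longrightarrow> c \<in> charts_at M q \<Longrightarrow> d \<in> charts_at M q \<Longrightarrow> v d = transition q c d (v c)"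
  unfolding tangent_space_def by blast

lemma tangent_space_outside: "v \<in> tangent_space M q \<Longrightarrow> c \<notin> charts_at M q \<Longrightarrow> v c = 0"
  unfolding tangent_space_def by blast

lemma tangent_spaceI:
  assumes "\<And>c d. c \<in> charts_at M q \<Longrightarrow> d \<in> charts_at M q \<Longrightarrow> v d = transition q c d (v c)"
    and "\<And>c. c \<notin> charts_at M q \<Longrightarrow> v c = 0"
  shows "v \<in> tangent_space M q"
  unfolding tangent_space_def using assms by blast

lemma tangent_space_add:
  assumes v: "v \<in> tangent_space M q" and w: "w \<in> tangent_space M q"
  shows "v + w \<in> tangent_space M q"
proof (rule tangent_spaceI)
  fix c d assume cd: "c \<in> charts_at M q" "d \<in> charts_at M q"
  show "(v + w) d = transition q c d ((v + w) c)"
    using tangent_space_transition[OF v cd] tangent_space_transition[OF w cd]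
      linear_add[OF linear_transition[OF cd]] by simp
qed (simp add: tangent_space_outside[OF v] tangent_space_outside[OF w])

lemma tangent_space_scaleR:
  assumes v: "v \<in> tangent_space M q"
  shows "r *\<^sub>R v \<in> tangent_space M q"
proof (rule tangent_spaceI)
  fix c d assume cd: "c \<in> charts_at M q" "d \<in> charts_at M q"
  show "(r *\<^sub>R v) d = transition q c d ((r *\<^sub>R v) c)"
    using tangent_space_transition[OF v cd] linear_scale[OF linear_transition[OF cd]]
    by (simp add: scaleR_fun_apply)
qed (simp add: tangent_space_outside[OF v] scaleR_fun_apply)

lemma tangent_space_0: "0 \<in> tangent_space M q"
  by (rule tangent_spaceI) (simp_all add: linear_0[OF linear_transition])

lemma tangent_space_sum: "(\<And>i. i \<in> I \<Longrightarrow> v i \<in> tangent_space M q) \<Longrightarrow> sum v I \<in> tangent_space M q"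
  by (induction I rule: infinite_finite_induct) (simp_all add: tangent_space_0 tangent_space_add)

lemma tangent_space_diff: "v \<in> tangent_space M q \<Longrightarrow> w \<in> tangent_space M q \<Longrightarrow> v - w \<in> tangent_space M q"
  using tangent_space_add[OF _ tangent_space_scaleR, of v q w "-1"] by simp

lemma coord_vec_tangent:
  assumes "c \<in> charts_at M q"
  shows "coord_vec M q c e \<in> tangent_space M q"
  by (rule tangent_spaceI) (simp_all add: coord_vec_def transition_trans[OF assms])

lemma coord_vec_self: "c \<in> charts_at M q \<Longrightarrow> coord_vec M q c e c = e"
  by (simp add: coord_vec_def transition_self)

text \<open>By the transformation law a tangent vector is determined by its components in a single chart,
  so identities between tangent vectors can be verified there.\<close>

lemma tangent_eqI:
  assumes "v \<in> tangent_space M q" "w \<in> tangent_space M q" "c \<in> charts_at M q" "v c = w c"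
  shows "v = w"
proof
  fix d show "v d = w d"
    using assms tangent_space_transition[of v q c d] tangent_space_transition[of w q c d]
      tangent_space_outside[of v q d] tangent_space_outside[of w q d]
    by (cases "d \<in> charts_at M q") auto
qed

lemma coord_vec_component: "v \<in> tangent_space M q \<Longrightarrow> c \<in> charts_at M q \<Longrightarrow> coord_vec M q c (v c) = v"
  by (rule tangent_eqI[of _ q _ c]) (auto simp: coord_vec_tangent coord_vec_self)

lemma smooth_function_openin: "smooth_function M U f \<Longrightarrow> openin (top_of M) U"
  by (simp add: smooth_function_def)

lemma vector_field_openin: "vector_field M U X \<Longrightarrow> openin (top_of M) U"
  by (simp add: vector_field_def)

lemma vector_field_tangent: "vector_field M U X \<Longrightarrow> q \<in> U \<Longrightarrow> X q \<in> tangent_space M q"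
  by (simp add: vector_field_def)

lemma vector_field_subset:
  assumes "vector_field M U X" "openin (top_of M) V" "V \<subseteq> U"
  shows "vector_field M V X"
  unfolding vector_field_def
proof (intro conjI ballI)
  fix c assume "c \<in> atlas M"
  then have "smooth_on (coord c ` (U \<inter> chart_dom c)) (\<lambda>u. X (param c u) c)"
    using assms by (simp add: vector_field_def)
  then show "smooth_on (coord c ` (V \<inter> chart_dom c)) (\<lambda>u. X (param c u) c)"
    by (rule smooth_on_subset) (use assms in auto)
qed (use assms vector_field_tangent in auto)

lemma smooth_function_cong:
  assumes "smooth_function M U f" "\<And>q. q \<in> U \<Longrightarrow> f q = f' q"
  shows "smooth_function M U f'"
  unfolding smooth_function_def
proof (intro conjI ballI)
  fix c assume c: "c \<in> atlas M"
  have "smooth_on (coord c ` (U \<inter> chart_dom c)) (f \<circ> param c) \<longleftrightarrow>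
      smooth_on (coord c ` (U \<inter> chart_dom c)) (f' \<circ> param c)"
    by (rule smooth_on_cong) (use assms open_coord_image[OF c] param_coord[OF c] in \<open>auto simp: smooth_function_def\<close>)
  then show "smooth_on (coord c ` (U \<inter> chart_dom c)) (f' \<circ> param c)"
    using assms(1) c by (simp add: smooth_function_def)
qed (use assms smooth_function_openin in auto)

lemma vector_field_cong:
  assumes "vector_field M U X" "\<And>q. q \<in> U \<Longrightarrow> X q = X' q"
  shows "vector_field M U X'"
  unfolding vector_field_def
proof (intro conjI ballI)
  fix c assume c: "c \<in> atlas M"
  have "smooth_on (coord c ` (U \<inter> chart_dom c)) (\<lambda>u. X (param c u) c) \<longleftrightarrow>
      smooth_on (coord c ` (U \<inter> chart_dom c)) (\<lambda>u. X' (param c u) c)"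
    by (rule smooth_on_cong) (use assms open_coord_image[OF c] param_coord[OF c] in \<open>auto simp: vector_field_def\<close>)
  then show "smooth_on (coord c ` (U \<inter> chart_dom c)) (\<lambda>u. X' (param c u) c)"
    using assms(1) c by (simp add: vector_field_def)
qed (use assms vector_field_openin vector_field_tangent in \<open>auto simp flip: assms(2)\<close>)

lemma smooth_function_const: "openin (top_of M) U \<Longrightarrow> smooth_function M U (\<lambda>q. r)"
  by (simp add: smooth_function_def smooth_on_const comp_def)

lemma smooth_function_add:
  "smooth_function M U f \<Longrightarrow> smooth_function M U f' \<Longrightarrow> smooth_function M U (\<lambda>q. f q + f' q)"
  by (simp add: smooth_function_def comp_def smooth_on_add open_coord_image)

lemma smooth_function_mult:
  "smooth_function M U f \<Longrightarrow> smooth_function M U f' \<Longrightarrow> smooth_function M U (\<lambda>q. f q * f' q)"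
  by (simp add: smooth_function_def comp_def smooth_on_mult open_coord_image)

lemma vector_field_0: "openin (top_of M) U \<Longrightarrow> vector_field M U (\<lambda>q. 0)"
  by (simp add: vector_field_def tangent_space_0 smooth_on_const)

lemma vector_field_add:
  "vector_field M U X \<Longrightarrow> vector_field M U Y \<Longrightarrow> vector_field M U (\<lambda>q. X q + Y q)"
  by (simp add: vector_field_def smooth_on_add open_coord_image tangent_space_add)

lemma vector_field_scaleR:
  "smooth_function M U f \<Longrightarrow> vector_field M U X \<Longrightarrow> vector_field M U (\<lambda>q. f q *\<^sub>R X q)"
  by (simp add: vector_field_def smooth_function_def comp_def smooth_on_scaleR open_coord_image
      tangent_space_scaleR scaleR_fun_apply)

lemma vector_field_diff:
  assumes "vector_field M U X" "vector_field M U Y"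
  shows "vector_field M U (\<lambda>q. X q - Y q)"
proof -
  have "vector_field M U (\<lambda>q. X q + (- 1) *\<^sub>R Y q)"
    by (intro vector_field_add vector_field_scaleR smooth_function_const assms vector_field_openin[OF assms(1)])
  then show ?thesis by simp
qed

lemma vector_field_coord_vec:
  assumes c: "c \<in> atlas M"
  shows "vector_field M (chart_dom c) (\<lambda>q. coord_vec M q c e)"
  unfolding vector_field_def
proof (intro conjI ballI)
  fix d assume d: "d \<in> atlas M"
  let ?S = "coord d ` (chart_dom c \<inter> chart_dom d)"
  have S: "open ?S" using open_coord_image[OF d openin_chart_dom[OF c]] .
  have "smooth_on ?S (\<lambda>u. frechet_derivative (coord d \<circ> param c) (at ((coord c \<circ> param d) u)) e)"
  proof (rule smooth_on_compose[OF S open_overlap[OF c d],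
        where f = "\<lambda>w. frechet_derivative (coord d \<circ> param c) (at w) e" and g = "coord c \<circ> param d"])
    show "smooth_on ?S (coord c \<circ> param d)" using smooth_transition[OF d c] by (simp add: Int_commute)
    show "(coord c \<circ> param d) ` ?S \<subseteq> coord c ` (chart_dom c \<inter> chart_dom d)"
      using param_coord[OF d] by auto
  qed (rule smooth_on_frechet_derivative[OF smooth_transition[OF c d]])
  moreover have "coord_vec M (param d u) c e d = frechet_derivative (coord d \<circ> param c) (at ((coord c \<circ> param d) u)) e"
    if "u \<in> ?S" for u
    using that param_coord[OF d] d by (auto simp: coord_vec_def charts_at_def)
  ultimately show "smooth_on ?S (\<lambda>u. coord_vec M (param d u) c e d)"
    using smooth_on_cong[OF S] by (metis (no_types, lifting))
qed (use openin_chart_dom c coord_vec_tangent charts_atI in auto)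

lemma smooth_function_component:
  assumes X: "vector_field M U X" and c: "c \<in> atlas M" and U: "U \<subseteq> chart_dom c"
  shows "smooth_function M U (\<lambda>q. X q c \<bullet> i)"
  unfolding smooth_function_def
proof (intro conjI ballI)
  fix d assume d: "d \<in> atlas M"
  let ?S = "coord d ` (U \<inter> chart_dom d)"
  have S: "open ?S" using open_coord_image[OF d vector_field_openin[OF X]] .
  have sub: "?S \<subseteq> coord d ` (chart_dom d \<inter> chart_dom c)" using U by auto
  have "smooth_on ?S (\<lambda>u. frechet_derivative (coord c \<circ> param d) (at u) (X (param d u) d) \<bullet> i)"
    using X d by (intro smooth_on_bounded_linear[OF S bounded_linear_inner_left]
        smooth_on_frechet_derivative_apply[OF S] smooth_on_subset[OF smooth_transition[OF d c] sub])
      (simp add: vector_field_def)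
  moreover have "((\<lambda>q. X q c \<bullet> i) \<circ> param d) u = frechet_derivative (coord c \<circ> param d) (at u) (X (param d u) d) \<bullet> i"
    if "u \<in> ?S" for u
  proof -
    from that obtain q where q: "q \<in> U" "q \<in> chart_dom d" "u = coord d q" by auto
    then show ?thesis
      using tangent_space_transition[OF vector_field_tangent[OF X], of q d c] U c d param_coord[OF d]
      by (auto simp: charts_at_def)
  qed
  ultimately show "smooth_on ?S ((\<lambda>q. X q c \<bullet> i) \<circ> param d)"
    using smooth_on_cong[OF S] by (metis (no_types, lifting))
qed (rule vector_field_openin[OF X])

lemma smooth_function_has_derivative:
  assumes "smooth_function M U f" "q \<in> U" "c \<in> charts_at M q"
  shows "((f \<circ> param c) has_derivative frechet_derivative (f \<circ> param c) (at (coord c q))) (at (coord c q))"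
  by (rule smooth_on_imp_has_derivative[of "coord c ` (U \<inter> chart_dom c)"])
    (use assms in \<open>auto simp: smooth_function_def charts_at_def\<close>)

lemma dir_deriv_chart:
  assumes f: "smooth_function M U f" "q \<in> U" and c: "c \<in> charts_at M q" and v: "v \<in> tangent_space M q"
  shows "dir_deriv M q v f = frechet_derivative (f \<circ> param c) (at (coord c q)) (v c)"
proof -
  define d where "d = (SOME c. c \<in> charts_at M q)"
  have d: "d \<in> charts_at M q" unfolding d_def using c by (rule someI)
  have "((f \<circ> param c) has_derivative (\<lambda>v. frechet_derivative (f \<circ> param d) (at (coord d q)) (transition q c d v))) (at (coord c q))"
    by (rule chain_param[OF c d smooth_function_openin[OF f(1)] f(2) smooth_function_has_derivative[OF f d]])
  from frechet_derivative_at[OF this, symmetric] tangent_space_transition[OF v c d]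
  show ?thesis by (simp add: dir_deriv_def flip: d_def)
qed

lemma smooth_function_dir_deriv:
  assumes f: "smooth_function M U f" and X: "vector_field M U X"
  shows "smooth_function M U (\<lambda>q. dir_deriv M q (X q) f)"
  unfolding smooth_function_def
proof (intro conjI ballI)
  fix c assume c: "c \<in> atlas M"
  let ?S = "coord c ` (U \<inter> chart_dom c)"
  have S: "open ?S" using open_coord_image[OF c vector_field_openin[OF X]] .
  have "smooth_on ?S (\<lambda>u. frechet_derivative (f \<circ> param c) (at u) (X (param c u) c))"
    using f X c by (intro smooth_on_frechet_derivative_apply[OF S]) (auto simp: smooth_function_def vector_field_def)
  moreover have "((\<lambda>q. dir_deriv M q (X q) f) \<circ> param c) u = frechet_derivative (f \<circ> param c) (at u) (X (param c u) c)"
    if "u \<in> ?S" for u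
    using that dir_deriv_chart[OF f _ charts_atI[OF c] vector_field_tangent[OF X]] param_coord[OF c] by auto
  ultimately show "smooth_on ?S ((\<lambda>q. dir_deriv M q (X q) f) \<circ> param c)"
    using smooth_on_cong[OF S] by (metis (no_types, lifting))
qed (rule vector_field_openin[OF X])

lemma dir_deriv_eqI:
  assumes f: "smooth_function M U f" "q \<in> U" and v: "v \<in> tangent_space M q" and c: "c \<in> charts_at M q"
    and "((f \<circ> param c) has_derivative f') (at (coord c q))"
  shows "dir_deriv M q v f = f' (v c)"
  using dir_deriv_chart[OF f c v] frechet_derivative_at[OF assms(5)] by simp

lemma dir_deriv_add:
  assumes f: "smooth_function M U f" "smooth_function M U f'" "q \<in> U" and v: "v \<in> tangent_space M q"
  shows "dir_deriv M q v (\<lambda>q. f q + f' q) = dir_deriv M q v f + dir_deriv M q v f'"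
proof -
  obtain c where c: "c \<in> charts_at M q" using carrier_charts_at openin_carrier smooth_function_openin f by metis
  have "((\<lambda>q. f q + f' q) \<circ> param c has_derivative (\<lambda>v. frechet_derivative (f \<circ> param c) (at (coord c q)) v
     + frechet_derivative (f' \<circ> param c) (at (coord c q)) v)) (at (coord c q))"
    using has_derivative_add[OF smooth_function_has_derivative[OF f(1,3) c] smooth_function_has_derivative[OF f(2,3) c]]
    by (simp add: comp_def)
  from dir_deriv_eqI[OF smooth_function_add[OF f(1,2)] f(3) v c this]
  show ?thesis using dir_deriv_chart[OF f(1,3) c v] dir_deriv_chart[OF f(2,3) c v] by simp
qed

lemma dir_deriv_mult:
  assumes f: "smooth_function M U f" "smooth_function M U f'" "q \<in> U" and v: "v \<in> tangent_space M q"
  shows "dir_deriv M q v (\<lambda>q. f q * f' q) = dir_deriv M q v f * f' q + f q * dir_deriv M q v f'"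
proof -
  obtain c where c: "c \<in> charts_at M q" using carrier_charts_at openin_carrier smooth_function_openin f by metis
  have q: "param c (coord c q) = q" using c param_coord by (auto simp: charts_at_def)
  have "((\<lambda>q. f q * f' q) \<circ> param c has_derivative (\<lambda>v. f q * frechet_derivative (f' \<circ> param c) (at (coord c q)) v
     + frechet_derivative (f \<circ> param c) (at (coord c q)) v * f' q)) (at (coord c q))"
    using has_derivative_mult[OF smooth_function_has_derivative[OF f(1,3) c] smooth_function_has_derivative[OF f(2,3) c]]
    by (simp add: comp_def q)
  from dir_deriv_eqI[OF smooth_function_mult[OF f(1,2)] f(3) v c this]
  show ?thesis using dir_deriv_chart[OF f(1,3) c v] dir_deriv_chart[OF f(2,3) c v] by simp
qed

lemma dir_deriv_const:
  assumes "q \<in> carrier M" "v \<in> tangent_space M q"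
  shows "dir_deriv M q v (\<lambda>q. r) = 0"
proof -
  obtain c where c: "c \<in> charts_at M q" using carrier_charts_at assms by metis
  show ?thesis
    using dir_deriv_eqI[OF smooth_function_const[OF openin_topspace] assms c, of r "\<lambda>v. 0"] by (simp add: comp_def)
qed

lemma dir_deriv_scaleR_vec:
  assumes f: "smooth_function M U f" "q \<in> U" and v: "v \<in> tangent_space M q"
  shows "dir_deriv M q (r *\<^sub>R v) f = r * dir_deriv M q v f"
proof -
  obtain c where c: "c \<in> charts_at M q" using carrier_charts_at openin_carrier smooth_function_openin f by metis
  show ?thesis
    using linear_scale[OF has_derivative_linear[OF smooth_function_has_derivative[OF f c]]]
    by (simp add: dir_deriv_chart[OF f c] v tangent_space_scaleR scaleR_fun_apply)
qed

lemma dir_deriv_cong: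
  assumes f: "smooth_function M U f" "q \<in> U" and v: "v \<in> tangent_space M q"
    and eq: "\<And>x. x \<in> U \<Longrightarrow> f x = f' x"
  shows "dir_deriv M q v f = dir_deriv M q v f'"
proof -
  obtain c where c: "c \<in> charts_at M q" using carrier_charts_at openin_carrier smooth_function_openin f by metis
  have c': "c \<in> atlas M" "q \<in> chart_dom c" using c by (auto simp: charts_at_def)
  have "frechet_derivative (f \<circ> param c) (at (coord c q)) = frechet_derivative (f' \<circ> param c) (at (coord c q))"
    by (rule frechet_derivative_cong_open[OF open_coord_image[OF c'(1) smooth_function_openin[OF f(1)]]])
      (use f c' eq param_coord[OF c'(1)] in auto)
  then show ?thesis
    using dir_deriv_chart[OF f c v] dir_deriv_chart[OF smooth_function_cong[OF f(1) eq] f(2) c v] by simp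
qed

text \<open>In a chart, \<open>X(Y f) - Y(X f)\<close> consists of a first order part, which is the derivative along the
  bracket, and of two second order parts that cancel by the symmetry of second derivatives.\<close>

lemma dir_deriv_lie_bracket:
  assumes f: "smooth_function M U f" and X: "vector_field M U X" and Y: "vector_field M U Y" and q: "q \<in> U"
    and br: "lie_bracket M X Y q \<in> tangent_space M q"
  shows "dir_deriv M q (lie_bracket M X Y q) f =
    dir_deriv M q (X q) (\<lambda>q. dir_deriv M q (Y q) f) - dir_deriv M q (Y q) (\<lambda>q. dir_deriv M q (X q) f)"
proof -
  obtain c where c: "c \<in> charts_at M q" using carrier_charts_at openin_carrier smooth_function_openin f q by metis
  have c': "c \<in> atlas M" "q \<in> chart_dom c" using c by (auto simp: charts_at_def)
  define u where "u = coord c q"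
  let ?S = "coord c ` (U \<inter> chart_dom c)"
  have S: "open ?S" using open_coord_image[OF c'(1) vector_field_openin[OF X]] .
  have u: "u \<in> ?S" using c' q by (auto simp: u_def)
  have pu: "param c u = q" using c' by (simp add: u_def param_coord)
  define F where "F = f \<circ> param c"
  define a where "a = (\<lambda>u. X (param c u) c)"
  define b where "b = (\<lambda>u. Y (param c u) c)"
  have F: "smooth_on ?S F" and a: "smooth_on ?S a" and b: "smooth_on ?S b"
    using f X Y c' by (auto simp: F_def a_def b_def smooth_function_def vector_field_def)
  have second: "dir_deriv M q (Z q) (\<lambda>q. dir_deriv M q (W q) f) =
    frechet_derivative F (at u) (frechet_derivative (\<lambda>u. W (param c u) c) (at u) (Z q c)) +
     (\<Sum>i\<in>Basis. \<Sum>j\<in>Basis. (W q c \<bullet> i) * (Z q c \<bullet> j) * frechet_derivative (\<lambda>u. frechet_derivative F (at u) i) (at u) j)"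
    if Z: "vector_field M U Z" and W: "vector_field M U W" for Z W
  proof -
    have w: "smooth_on ?S (\<lambda>u. W (param c u) c)" using W c' by (simp add: vector_field_def)
    have lin: "linear (frechet_derivative (\<lambda>u. frechet_derivative F (at u) i) (at u))" for i
      by (rule smooth_on_imp_linear[OF smooth_on_frechet_derivative[OF F] u])
    have "dir_deriv M q (Z q) (\<lambda>q. dir_deriv M q (W q) f) =
        frechet_derivative ((\<lambda>q. dir_deriv M q (W q) f) \<circ> param c) (at u) (Z q c)"
      unfolding u_def by (rule dir_deriv_chart[OF smooth_function_dir_deriv[OF f W] q c vector_field_tangent[OF Z q]])
    also have "frechet_derivative ((\<lambda>q. dir_deriv M q (W q) f) \<circ> param c) (at u) =
        frechet_derivative (\<lambda>u. frechet_derivative F (at u) (W (param c u) c)) (at u)"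
      by (rule frechet_derivative_cong_open[OF S u])
        (use dir_deriv_chart[OF f _ charts_atI[OF c'(1)] vector_field_tangent[OF W]] param_coord[OF c'(1)]
          in \<open>auto simp: F_def\<close>)
    also have "\<dots> (Z q c) = frechet_derivative F (at u) (frechet_derivative (\<lambda>u. W (param c u) c) (at u) (Z q c)) +
     (\<Sum>i\<in>Basis. (W (param c u) c \<bullet> i) *\<^sub>R frechet_derivative (\<lambda>u. frechet_derivative F (at u) i) (at u) (Z q c))"
      by (rule frechet_derivative_frechet_derivative_apply[OF S u F w])
    also have "(\<Sum>i\<in>Basis. (W (param c u) c \<bullet> i) *\<^sub>R frechet_derivative (\<lambda>u. frechet_derivative F (at u) i) (at u) (Z q c)) =
       (\<Sum>i\<in>Basis. (W q c \<bullet> i) * (\<Sum>j\<in>Basis. (Z q c \<bullet> j) * frechet_derivative (\<lambda>u. frechet_derivative F (at u) i) (at u) j))"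
      unfolding pu by (rule sum.cong[OF refl]) (subst linear_eq_sum_Basis[OF lin], simp)
    finally show ?thesis by (simp add: sum_distrib_left mult.assoc)
  qed
  have sym: "(\<Sum>i\<in>Basis. \<Sum>j\<in>Basis. (Y q c \<bullet> i) * (X q c \<bullet> j) * frechet_derivative (\<lambda>u. frechet_derivative F (at u) i) (at u) j) =
    (\<Sum>i\<in>Basis. \<Sum>j\<in>Basis. (X q c \<bullet> i) * (Y q c \<bullet> j) * frechet_derivative (\<lambda>u. frechet_derivative F (at u) i) (at u) j)"
    by (subst sum.swap) (auto intro!: sum.cong simp: Clairaut[OF F S u] mult_ac)
  have "dir_deriv M q (lie_bracket M X Y q) f = frechet_derivative F (at u) (lie_bracket M X Y q c)"
    unfolding F_def u_def by (rule dir_deriv_chart[OF f q c br])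
  also have "lie_bracket M X Y q c = frechet_derivative b (at u) (X q c) - frechet_derivative a (at u) (Y q c)"
    using c by (simp add: lie_bracket_def a_def b_def u_def)
  also have "frechet_derivative F (at u) \<dots> = frechet_derivative F (at u) (frechet_derivative b (at u) (X q c)) -
      frechet_derivative F (at u) (frechet_derivative a (at u) (Y q c))"
    by (rule linear_diff[OF smooth_on_imp_linear[OF F u]])
  finally show ?thesis
    unfolding second[OF X Y] second[OF Y X] sym by (simp add: a_def b_def)
qed

lemma tangent_coord_expansion:
  assumes v: "v \<in> tangent_space M q" and c: "c \<in> charts_at M q"
  shows "v = (\<Sum>i\<in>Basis. (v c \<bullet> i) *\<^sub>R coord_vec M q c i)"
proof (rule tangent_eqI[OF v _ c])
  show "(\<Sum>i\<in>Basis. (v c \<bullet> i) *\<^sub>R coord_vec M q c i) \<in> tangent_space M q"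
    by (intro tangent_space_sum tangent_space_scaleR coord_vec_tangent c)
  have "(\<Sum>i\<in>I. (v c \<bullet> i) *\<^sub>R coord_vec M q c i) c = (\<Sum>i\<in>I. (v c \<bullet> i) *\<^sub>R i)" for I
    by (induction I rule: infinite_finite_induct) (simp_all add: scaleR_fun_apply coord_vec_self c)
  then show "v c = (\<Sum>i\<in>Basis. (v c \<bullet> i) *\<^sub>R coord_vec M q c i) c"
    by (simp add: euclidean_representation)
qed

text \<open>Covariant derivatives and the Koszul formula speak about vector fields; this is what makes them
  applicable to a single tangent vector.\<close>

lemma tangent_extension:
  assumes U: "openin (top_of M) U" and p: "p \<in> U" and y: "y \<in> tangent_space M p"
  obtains V Y where "openin (top_of M) V" "V \<subseteq> U" "p \<in> V" "vector_field M V Y" "Y p = y"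
proof -
  obtain c where c: "c \<in> charts_at M p" using carrier_charts_at openin_carrier U p by blast
  have c': "c \<in> atlas M" "p \<in> chart_dom c" using c by (auto simp: charts_at_def)
  have V: "openin (top_of M) (U \<inter> chart_dom c)" by (intro openin_Int U openin_chart_dom c')
  have "vector_field M (U \<inter> chart_dom c) (\<lambda>q. coord_vec M q c (y c))"
    by (rule vector_field_subset[OF vector_field_coord_vec[OF c'(1)] V]) simp
  then show thesis
    by (intro that[OF V, where Y = "\<lambda>q. coord_vec M q c (y c)"])
      (use p c' coord_vec_component[OF y c] in auto)
qed

text \<open>A vector field inside a chart domain is a combination of coordinate fields with smooth
  coefficients, so a property is inherited from a frame if it is closed under sums and under multiplication by
  smooth functions. The frame \<open>E\<close> has to agree with the coordinate fields only inside \<open>V\<close>: on the cone it will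
  consist of lifts and the radial field, which differ from coordinate fields at irrelevant points.\<close>

lemma frame_induct [consumes 3, case_names cong zero coord frame add scale]:
  assumes X: "vector_field M V X" and c: "c \<in> atlas M" and V: "V \<subseteq> chart_dom c"
    and cong: "\<And>X X'. vector_field M V X \<Longrightarrow> (\<And>q. q \<in> V \<Longrightarrow> X q = X' q) \<Longrightarrow> Q X \<Longrightarrow> Q X'"
    and zero: "Q (\<lambda>q. 0)"
    and E: "\<And>e q. e \<in> Basis \<Longrightarrow> q \<in> V \<Longrightarrow> E e q = coord_vec M q c e"
    and frame: "\<And>e. e \<in> Basis \<Longrightarrow> Q (E e)"
    and add: "\<And>X Y. vector_field M V X \<Longrightarrow> vector_field M V Y \<Longrightarrow> Q X \<Longrightarrow> Q Y \<Longrightarrow> Q (\<lambda>q. X q + Y q)"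
    and scale: "\<And>f X. smooth_function M V f \<Longrightarrow> vector_field M V X \<Longrightarrow> Q X \<Longrightarrow> Q (\<lambda>q. f q *\<^sub>R X q)"
  shows "Q X"
proof -
  note V' = vector_field_openin[OF X]
  have fr: "vector_field M V (\<lambda>q. coord_vec M q c e)" for e
    by (rule vector_field_subset[OF vector_field_coord_vec[OF c] V' V])
  have "vector_field M V (\<lambda>q. \<Sum>i\<in>I. (X q c \<bullet> i) *\<^sub>R coord_vec M q c i) \<and>
      Q (\<lambda>q. \<Sum>i\<in>I. (X q c \<bullet> i) *\<^sub>R coord_vec M q c i)" if "I \<subseteq> Basis" for I
    using finite_subset[OF that finite_Basis] that
  proof (induction I rule: finite_induct)
    case empty show ?case unfolding sum.empty using vector_field_0[OF V'] zero by blast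
  next
    case (insert i I)
    have 1: "vector_field M V (\<lambda>q. (X q c \<bullet> i) *\<^sub>R coord_vec M q c i)"
      by (intro vector_field_scaleR smooth_function_component X c V fr)
    have "vector_field M V (E i)"
      by (rule vector_field_cong[OF fr[of i]]) (use insert.prems E in simp)
    then have "Q (\<lambda>q. coord_vec M q c i)"
      by (rule cong) (use insert.prems E frame in auto)
    then have 2: "Q (\<lambda>q. (X q c \<bullet> i) *\<^sub>R coord_vec M q c i)"
      by (intro scale smooth_function_component X c V fr)
    show ?case
      unfolding sum.insert[OF insert.hyps]
      using insert vector_field_add[OF 1] add[OF 1 _ 2] by blast
  qed
  note sum = this[OF order_refl]
  show ?thesis
    by (rule cong[OF conjunct1[OF sum] _ conjunct2[OF sum]])
      (use tangent_coord_expansion[OF vector_field_tangent[OF X] charts_atI[OF c], symmetric] V in auto)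
qed

end

section \<open>Riemannian manifolds and their curvature\<close>

locale riemannian_mfd = smooth_mfd M
  for M :: "('a, 'e::euclidean_space) mfd" +
  fixes g :: "'a \<Rightarrow> ('a, 'e) tvec \<Rightarrow> ('a, 'e) tvec \<Rightarrow> real"
    and D :: "('a, 'e) connection"
  assumes riemannian_metric: "riemannian_metric M g"
    and levi_civita: "levi_civita M g D"
begin

lemma metric_add_left:
  "p \<in> carrier M \<Longrightarrow> x \<in> tangent_space M p \<Longrightarrow> y \<in> tangent_space M p \<Longrightarrow> z \<in> tangent_space M p \<Longrightarrow>
    g p (x + y) z = g p x z + g p y z"
  using riemannian_metric unfolding riemannian_metric_def by metis

lemma metric_scaleR_left:
  "p \<in> carrier M \<Longrightarrow> x \<in> tangent_space M p \<Longrightarrow> z \<in> tangent_space M p \<Longrightarrow> g p (r *\<^sub>R x) z = r * g p x z"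
  using riemannian_metric unfolding riemannian_metric_def by metis

lemma metric_sym:
  "p \<in> carrier M \<Longrightarrow> x \<in> tangent_space M p \<Longrightarrow> y \<in> tangent_space M p \<Longrightarrow> g p x y = g p y x"
  using riemannian_metric unfolding riemannian_metric_def by metis

lemma metric_pos: "p \<in> carrier M \<Longrightarrow> x \<in> tangent_space M p \<Longrightarrow> x \<noteq> 0 \<Longrightarrow> g p x x > 0"
  using riemannian_metric unfolding riemannian_metric_def by metis

lemma smooth_function_metric:
  "vector_field M U X \<Longrightarrow> vector_field M U Y \<Longrightarrow> smooth_function M U (\<lambda>p. g p (X p) (Y p))"
  using riemannian_metric unfolding riemannian_metric_def by simp

lemma metric_diff_left:
  assumes "p \<in> carrier M" "x \<in> tangent_space M p" "y \<in> tangent_space M p" "z \<in> tangent_space M p"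
  shows "g p (x - y) z = g p x z - g p y z"
  using metric_add_left[of p x "-1 *\<^sub>R y" z] metric_scaleR_left[of p y z "-1"]
    tangent_space_scaleR[of y p "-1"] assms by simp

lemma metric_scaleR_right:
  assumes "p \<in> carrier M" "x \<in> tangent_space M p" "z \<in> tangent_space M p"
  shows "g p z (r *\<^sub>R x) = r * g p z x"
  using metric_scaleR_left[of p x z r] assms metric_sym[of p z] tangent_space_scaleR by metis

lemma metric_add_right:
  assumes "p \<in> carrier M" "x \<in> tangent_space M p" "y \<in> tangent_space M p" "z \<in> tangent_space M p"
  shows "g p z (x + y) = g p z x + g p z y"
  using metric_add_left[OF assms] assms metric_sym[of p z] tangent_space_add by metis

lemma metric_diff_right:
  assumes "p \<in> carrier M" "x \<in> tangent_space M p" "y \<in> tangent_space M p" "z \<in> tangent_space M p"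
  shows "g p z (x - y) = g p z x - g p z y"
  using metric_diff_left[OF assms] assms metric_sym[of p z] tangent_space_diff by metis

lemma metric_0_left: "p \<in> carrier M \<Longrightarrow> z \<in> tangent_space M p \<Longrightarrow> g p 0 z = 0"
  using metric_scaleR_left[of p 0 z 0] tangent_space_0 by simp

lemma metric_nondegenerate:
  assumes p: "p \<in> carrier M" and v: "v \<in> tangent_space M p" and w: "w \<in> tangent_space M p"
    and eq: "\<And>z. z \<in> tangent_space M p \<Longrightarrow> g p v z = g p w z"
  shows "v = w"
proof (rule ccontr)
  assume "v \<noteq> w"
  then have "g p (v - w) (v - w) > 0"
    using metric_pos[OF p tangent_space_diff[OF v w]] by simp
  moreover have "g p (v - w) (v - w) = 0"
    using metric_diff_left[OF p v w tangent_space_diff[OF v w]] eq[OF tangent_space_diff[OF v w]] by simp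
  ultimately show False by simp
qed

text \<open>The strict Cauchy-Schwarz inequality: the determinant times \<open>g(y,y)\<close> is the square length of
  \<open>g(y,y) x - g(x,y) y\<close>.\<close>

lemma gram_determinant_pos:
  assumes p: "p \<in> carrier M" and x: "x \<in> tangent_space M p" and y: "y \<in> tangent_space M p"
    and ind: "x \<noteq> y" "independent {x, y}"
  shows "g p x x * g p y y - (g p x y)\<^sup>2 > 0"
proof -
  let ?z = "g p y y *\<^sub>R x - g p x y *\<^sub>R y"
  have "y \<noteq> 0" using ind dependent_zero[of "{x, y}"] by blast
  then have yy: "g p y y > 0" by (rule metric_pos[OF p y])
  have z: "?z \<in> tangent_space M p" by (intro tangent_space_diff tangent_space_scaleR x y)
  have "?z \<noteq> 0"
  proof
    assume "?z = 0"
    then have "g p y y *\<^sub>R x = g p x y *\<^sub>R y" by simp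
    then have "(1 / g p y y) *\<^sub>R g p y y *\<^sub>R x = (1 / g p y y) *\<^sub>R g p x y *\<^sub>R y" by (rule arg_cong)
    then have "x = (g p x y / g p y y) *\<^sub>R y" using yy by simp
    then have "x \<in> span {y}" by (metis span_base span_scale insertI1)
    then show False using ind by (simp add: independent_insert)
  qed
  then have "g p ?z ?z > 0" by (rule metric_pos[OF p z])
  also have "g p ?z ?z = g p y y * (g p x x * g p y y - (g p x y)\<^sup>2)"
    using metric_sym[OF p x y]
    by (simp add: metric_diff_left metric_diff_right metric_scaleR_left metric_scaleR_right
        tangent_space_scaleR tangent_space_diff p x y algebra_simps power2_eq_square)
  finally show ?thesis using yy by (simp add: zero_less_mult_iff)
qed

lemma affine: "affine_connection M D"
  using levi_civita by (simp add: levi_civita_def)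

lemma D_tangent: "vector_field M U Y \<Longrightarrow> p \<in> U \<Longrightarrow> x \<in> tangent_space M p \<Longrightarrow> D p x Y \<in> tangent_space M p"
  by (rule affine[unfolded affine_connection_def, THEN conjunct1, rule_format, THEN conjunct1]) assumption+

lemma D_add_vec: "vector_field M U Y \<Longrightarrow> p \<in> U \<Longrightarrow> x \<in> tangent_space M p \<Longrightarrow> y \<in> tangent_space M p \<Longrightarrow>
    D p (x + y) Y = D p x Y + D p y Y"
  by (rule affine[unfolded affine_connection_def, THEN conjunct1, rule_format, THEN conjunct2, THEN conjunct1]) assumption+

lemma D_scaleR_vec: "vector_field M U Y \<Longrightarrow> p \<in> U \<Longrightarrow> x \<in> tangent_space M p \<Longrightarrow> D p (r *\<^sub>R x) Y = r *\<^sub>R D p x Y"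
  by (rule affine[unfolded affine_connection_def, THEN conjunct1, rule_format, THEN conjunct2, THEN conjunct2]) assumption+

lemma D_add: "vector_field M U Y \<Longrightarrow> vector_field M U Z \<Longrightarrow> p \<in> U \<Longrightarrow> x \<in> tangent_space M p \<Longrightarrow>
    D p x (\<lambda>q. Y q + Z q) = D p x Y + D p x Z"
  by (rule affine[unfolded affine_connection_def, THEN conjunct2, THEN conjunct1, rule_format]) assumption+

lemma D_scaleR: "smooth_function M U f \<Longrightarrow> vector_field M U Y \<Longrightarrow> p \<in> U \<Longrightarrow> x \<in> tangent_space M p \<Longrightarrow>
    D p x (\<lambda>q. f q *\<^sub>R Y q) = dir_deriv M p x f *\<^sub>R Y p + f p *\<^sub>R D p x Y"
  by (rule affine[unfolded affine_connection_def, THEN conjunct2, THEN conjunct2, THEN conjunct1, rule_format]) assumption+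

lemma D_eq_on: "vector_field M U Y \<Longrightarrow> vector_field M U Z \<Longrightarrow> (\<forall>q\<in>U. Y q = Z q) \<Longrightarrow> p \<in> U \<Longrightarrow>
    x \<in> tangent_space M p \<Longrightarrow> D p x Y = D p x Z"
  by (rule affine[unfolded affine_connection_def, THEN conjunct2, THEN conjunct2, THEN conjunct2, THEN conjunct1, rule_format]) (assumption | blast)+

lemma vector_field_D: "vector_field M U X \<Longrightarrow> vector_field M U Y \<Longrightarrow> vector_field M U (\<lambda>p. D p (X p) Y)"
  by (rule affine[unfolded affine_connection_def, THEN conjunct2, THEN conjunct2, THEN conjunct2, THEN conjunct2, rule_format]) assumption+

lemma torsion_free: "vector_field M U X \<Longrightarrow> vector_field M U Y \<Longrightarrow> p \<in> U \<Longrightarrow>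
    lie_bracket M X Y p = D p (X p) Y - D p (Y p) X"
  using levi_civita[unfolded levi_civita_def, THEN conjunct2, THEN conjunct1, rule_format, of U X Y p] by simp

lemma metric_compatible: "vector_field M U Y \<Longrightarrow> vector_field M U Z \<Longrightarrow> p \<in> U \<Longrightarrow> x \<in> tangent_space M p \<Longrightarrow>
    dir_deriv M p x (\<lambda>q. g q (Y q) (Z q)) = g p (D p x Y) (Z p) + g p (Y p) (D p x Z)"
  by (rule levi_civita[unfolded levi_civita_def, THEN conjunct2, THEN conjunct2, rule_format])

lemma D_cong: "vector_field M U Y \<Longrightarrow> (\<And>q. q \<in> U \<Longrightarrow> Y q = Z q) \<Longrightarrow> p \<in> U \<Longrightarrow>
    x \<in> tangent_space M p \<Longrightarrow> D p x Y = D p x Z"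
  using D_eq_on[OF _ vector_field_cong] by blast

lemma D_diff_vec:
  assumes "vector_field M U Y" "p \<in> U" "x \<in> tangent_space M p" "y \<in> tangent_space M p"
  shows "D p (x - y) Y = D p x Y - D p y Y"
  using D_add_vec[OF assms(1-3) tangent_space_scaleR[OF assms(4)], of "-1"] D_scaleR_vec[OF assms(1,2,4), of "-1"]
  by simp

lemma D_0_vec: "vector_field M U Y \<Longrightarrow> p \<in> U \<Longrightarrow> D p 0 Y = 0"
  using D_scaleR_vec[OF _ _ tangent_space_0, of U Y p 0] by simp

lemma D_0: "p \<in> carrier M \<Longrightarrow> x \<in> tangent_space M p \<Longrightarrow> D p x (\<lambda>q. 0) = 0"
  using D_add[OF vector_field_0 vector_field_0, of "carrier M" p x] by simp

lemma vector_field_lie_bracket: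
  assumes X: "vector_field M U X" and Y: "vector_field M U Y"
  shows "vector_field M U (lie_bracket M X Y)"
  by (rule vector_field_cong[OF vector_field_diff[OF vector_field_D[OF X Y] vector_field_D[OF Y X]]])
    (rule torsion_free[OF X Y, symmetric])

text \<open>Expanding the three derivatives by compatibility with the metric and the three brackets by
  vanishing torsion, all terms cancel in pairs except two equal ones.\<close>

lemma koszul:
  assumes X: "vector_field M U X" and Y: "vector_field M U Y" and Z: "vector_field M U Z" and p: "p \<in> U"
  shows "2 * g p (D p (X p) Y) (Z p) =
      dir_deriv M p (X p) (\<lambda>q. g q (Y q) (Z q)) + dir_deriv M p (Y p) (\<lambda>q. g q (Z q) (X q))
    - dir_deriv M p (Z p) (\<lambda>q. g q (X q) (Y q))
    + g p (lie_bracket M X Y p) (Z p) - g p (lie_bracket M X Z p) (Y p) - g p (lie_bracket M Y Z p) (X p)"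
proof -
  have pM: "p \<in> carrier M" using openin_carrier vector_field_openin X p by blast
  note T = vector_field_tangent[OF X p] vector_field_tangent[OF Y p] vector_field_tangent[OF Z p]
  note DT = D_tangent[OF X p] D_tangent[OF Y p] D_tangent[OF Z p]
  show ?thesis
    using metric_sym[OF pM DT(1)[OF T(3)] T(2)] metric_sym[OF pM DT(2)[OF T(3)] T(1)]
      metric_sym[OF pM DT(3)[OF T(1)] T(2)] metric_sym[OF pM DT(3)[OF T(2)] T(1)]
      metric_sym[OF pM DT(2)[OF T(1)] T(3)] metric_sym[OF pM DT(1)[OF T(2)] T(3)]
    by (simp add: metric_compatible[OF Y Z p T(1)] metric_compatible[OF Z X p T(2)] metric_compatible[OF X Y p T(3)]
      torsion_free[OF X Y p] torsion_free[OF X Z p] torsion_free[OF Y Z p] metric_diff_left[OF pM] T DT)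
qed

lemma curvature_tangent:
  assumes X: "vector_field M U X" and Y: "vector_field M U Y" and Z: "vector_field M U Z" and p: "p \<in> U"
  shows "curvature M D X Y Z p \<in> tangent_space M p"
  unfolding curvature_def
  by (intro tangent_space_diff D_tangent[OF _ p] vector_field_D X Y Z
    vector_field_tangent[OF X p] vector_field_tangent[OF Y p]
    vector_field_tangent[OF vector_field_lie_bracket[OF X Y] p])

text \<open>With vanishing torsion the bracket can be replaced by covariant derivatives, so that linearity
  in the first argument follows from the axioms of a connection, without any formula for the bracket of
  \<open>f X\<close> and \<open>Y\<close>.\<close>

lemma curvature_torsion_free:
  assumes X: "vector_field M U X" and Y: "vector_field M U Y" and Z: "vector_field M U Z" and p: "p \<in> U"
  shows "curvature M D X Y Z p = D p (X p) (\<lambda>q. D q (Y q) Z) - D p (Y p) (\<lambda>q. D q (X q) Z)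
    - D p (D p (X p) Y) Z + D p (D p (Y p) X) Z"
  using D_diff_vec[OF Z p D_tangent[OF Y p vector_field_tangent[OF X p]] D_tangent[OF X p vector_field_tangent[OF Y p]]]
  by (simp add: curvature_def torsion_free[OF X Y p])

lemma curvature_antisym:
  assumes X: "vector_field M U X" and Y: "vector_field M U Y" and Z: "vector_field M U Z" and p: "p \<in> U"
  shows "curvature M D X Y Z p = - curvature M D Y X Z p"
  by (simp add: curvature_torsion_free[OF X Y Z p] curvature_torsion_free[OF Y X Z p])

lemma curvature_cong_left:
  assumes X: "vector_field M U X" and Y: "vector_field M U Y" and Z: "vector_field M U Z" and p: "p \<in> U"
    and eq: "\<And>q. q \<in> U \<Longrightarrow> X q = X' q"
  shows "curvature M D X Y Z p = curvature M D X' Y Z p"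
proof -
  have X': "vector_field M U X'" by (rule vector_field_cong[OF X eq])
  have "D p (Y p) (\<lambda>q. D q (X q) Z) = D p (Y p) (\<lambda>q. D q (X' q) Z)"
    by (rule D_cong[OF vector_field_D[OF X Z] _ p vector_field_tangent[OF Y p]]) (simp add: eq)
  moreover have "D p (Y p) X = D p (Y p) X'"
    by (rule D_cong[OF X eq p vector_field_tangent[OF Y p]])
  ultimately show ?thesis
    by (simp add: curvature_torsion_free[OF X Y Z p] curvature_torsion_free[OF X' Y Z p] eq[OF p])
qed

lemma curvature_add_left:
  assumes X: "vector_field M U X" and X': "vector_field M U X'"
    and Y: "vector_field M U Y" and Z: "vector_field M U Z" and p: "p \<in> U"
  shows "curvature M D (\<lambda>q. X q + X' q) Y Z p = curvature M D X Y Z p + curvature M D X' Y Z p"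
proof -
  note T = vector_field_tangent[OF X p] vector_field_tangent[OF X' p] vector_field_tangent[OF Y p]
  have "D p (Y p) (\<lambda>q. D q (X q + X' q) Z) = D p (Y p) (\<lambda>q. D q (X q) Z + D q (X' q) Z)"
    by (rule D_cong[OF vector_field_D[OF vector_field_add[OF X X'] Z] _ p T(3)])
      (simp add: D_add_vec[OF Z] vector_field_tangent[OF X] vector_field_tangent[OF X'])
  then show ?thesis
    by (simp add: curvature_torsion_free[OF X Y Z p] curvature_torsion_free[OF X' Y Z p]
      curvature_torsion_free[OF vector_field_add[OF X X'] Y Z p]
      D_add[OF vector_field_D[OF X Z] vector_field_D[OF X' Z] p] D_add[OF X X' p]
      D_add_vec[OF Z p] D_add_vec[OF Y p] D_add_vec[OF vector_field_D[OF Y Z] p]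
      T D_tangent[OF X p] D_tangent[OF X' p] D_tangent[OF Y p])
qed

lemma curvature_scaleR_left:
  assumes f: "smooth_function M U f" and X: "vector_field M U X"
    and Y: "vector_field M U Y" and Z: "vector_field M U Z" and p: "p \<in> U"
  shows "curvature M D (\<lambda>q. f q *\<^sub>R X q) Y Z p = f p *\<^sub>R curvature M D X Y Z p"
proof -
  note T = vector_field_tangent[OF X p] vector_field_tangent[OF Y p]
  have "D p (Y p) (\<lambda>q. D q (f q *\<^sub>R X q) Z) = D p (Y p) (\<lambda>q. f q *\<^sub>R D q (X q) Z)"
    by (rule D_cong[OF vector_field_D[OF vector_field_scaleR[OF f X] Z] _ p T(2)])
      (simp add: D_scaleR_vec[OF Z] vector_field_tangent[OF X])
  then show ?thesis
    by (simp add: curvature_torsion_free[OF X Y Z p] curvature_torsion_free[OF vector_field_scaleR[OF f X] Y Z p]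
      D_scaleR[OF f vector_field_D[OF X Z] p] D_scaleR[OF f X p]
      D_add_vec[OF Z p] D_scaleR_vec[OF Z p] D_scaleR_vec[OF Y p] D_scaleR_vec[OF vector_field_D[OF Y Z] p]
      T D_tangent[OF X p] D_tangent[OF Y p] tangent_space_scaleR scaleR_right_distrib scaleR_right_diff_distrib)
qed

lemma curvature_0_left:
  assumes Y: "vector_field M U Y" and Z: "vector_field M U Z" and p: "p \<in> U"
  shows "curvature M D (\<lambda>q. 0) Y Z p = 0"
  using curvature_scaleR_left[OF smooth_function_const[OF vector_field_openin[OF Y], of 0]
    vector_field_0[OF vector_field_openin[OF Y]] Y Z p] by simp

lemma curvature_cong_right:
  assumes X: "vector_field M U X" and Y: "vector_field M U Y" and Z: "vector_field M U Z" and p: "p \<in> U"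
    and eq: "\<And>q. q \<in> U \<Longrightarrow> Z q = Z' q"
  shows "curvature M D X Y Z p = curvature M D X Y Z' p"
proof -
  have *: "D p (V p) (\<lambda>q. D q (W q) Z) = D p (V p) (\<lambda>q. D q (W q) Z')"
    if V: "vector_field M U V" and W: "vector_field M U W" for V W
    by (rule D_cong[OF vector_field_D[OF W Z] _ p vector_field_tangent[OF V p]])
      (rule D_cong[OF Z eq _ vector_field_tangent[OF W]])
  have **: "D p (lie_bracket M X Y p) Z = D p (lie_bracket M X Y p) Z'"
    by (rule D_cong[OF Z eq p vector_field_tangent[OF vector_field_lie_bracket[OF X Y] p]])
  show ?thesis
    unfolding curvature_def *[OF X Y] *[OF Y X] ** by (rule refl)
qed

lemma curvature_add_right:
  assumes X: "vector_field M U X" and Y: "vector_field M U Y"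
    and Z: "vector_field M U Z" and Z': "vector_field M U Z'" and p: "p \<in> U"
  shows "curvature M D X Y (\<lambda>q. Z q + Z' q) p = curvature M D X Y Z p + curvature M D X Y Z' p"
proof -
  have *: "D p (V p) (\<lambda>q. D q (W q) (\<lambda>q. Z q + Z' q)) = D p (V p) (\<lambda>q. D q (W q) Z) + D p (V p) (\<lambda>q. D q (W q) Z')"
    if V: "vector_field M U V" and W: "vector_field M U W" for V W
  proof -
    have "D p (V p) (\<lambda>q. D q (W q) (\<lambda>q. Z q + Z' q)) = D p (V p) (\<lambda>q. D q (W q) Z + D q (W q) Z')"
      by (rule D_cong[OF vector_field_D[OF W vector_field_add[OF Z Z']] _ p vector_field_tangent[OF V p]])
        (rule D_add[OF Z Z' _ vector_field_tangent[OF W]])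
    then show ?thesis
      using D_add[OF vector_field_D[OF W Z] vector_field_D[OF W Z'] p vector_field_tangent[OF V p]] by simp
  qed
  show ?thesis
    by (simp add: curvature_def *[OF X Y] *[OF Y X]
      D_add[OF Z Z' p vector_field_tangent[OF vector_field_lie_bracket[OF X Y] p]])
qed

text \<open>The second derivatives of \<open>f\<close> that arise in \<open>\<nabla>\<^bsub>X\<^esub> \<nabla>\<^bsub>Y\<^esub> (f Z)\<close> cancel against the derivative of \<open>f\<close>
  along the bracket; the mixed first order terms are symmetric in \<open>X\<close> and \<open>Y\<close>.\<close>

lemma curvature_scaleR_right:
  assumes f: "smooth_function M U f" and X: "vector_field M U X" and Y: "vector_field M U Y"
    and Z: "vector_field M U Z" and p: "p \<in> U"
  shows "curvature M D X Y (\<lambda>q. f q *\<^sub>R Z q) p = f p *\<^sub>R curvature M D X Y Z p"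
proof -
  have *: "D p (V p) (\<lambda>q. D q (W q) (\<lambda>q. f q *\<^sub>R Z q)) =
      dir_deriv M p (V p) (\<lambda>q. dir_deriv M q (W q) f) *\<^sub>R Z p
      + (dir_deriv M p (W p) f *\<^sub>R D p (V p) Z + dir_deriv M p (V p) f *\<^sub>R D p (W p) Z)
      + f p *\<^sub>R D p (V p) (\<lambda>q. D q (W q) Z)"
    if V: "vector_field M U V" and W: "vector_field M U W" for V W
  proof -
    note Wf = smooth_function_dir_deriv[OF f W] and DWZ = vector_field_D[OF W Z] and Vp = vector_field_tangent[OF V p]
    have "D p (V p) (\<lambda>q. D q (W q) (\<lambda>q. f q *\<^sub>R Z q)) =
        D p (V p) (\<lambda>q. dir_deriv M q (W q) f *\<^sub>R Z q + f q *\<^sub>R D q (W q) Z)"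
      by (rule D_cong[OF vector_field_D[OF W vector_field_scaleR[OF f Z]] _ p Vp])
        (rule D_scaleR[OF f Z _ vector_field_tangent[OF W]])
    also have "\<dots> = D p (V p) (\<lambda>q. dir_deriv M q (W q) f *\<^sub>R Z q) + D p (V p) (\<lambda>q. f q *\<^sub>R D q (W q) Z)"
      by (rule D_add[OF vector_field_scaleR[OF Wf Z] vector_field_scaleR[OF f DWZ] p Vp])
    finally show ?thesis
      by (simp add: D_scaleR[OF Wf Z p Vp] D_scaleR[OF f DWZ p Vp])
  qed
  note br = vector_field_tangent[OF vector_field_lie_bracket[OF X Y] p]
  show ?thesis
    unfolding curvature_def *[OF X Y] *[OF Y X] D_scaleR[OF f Z p br]
      dir_deriv_lie_bracket[OF f X Y p br]
    by (simp add: algebra_simps)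
qed

lemma curvature_0_right:
  assumes X: "vector_field M U X" and Y: "vector_field M U Y" and p: "p \<in> U"
  shows "curvature M D X Y (\<lambda>q. 0) p = 0"
  using curvature_scaleR_right[OF smooth_function_const[OF vector_field_openin[OF Y], of 0] X Y
    vector_field_0[OF vector_field_openin[OF Y]] p] by simp

text \<open>The arguments are expanded in the frame one after the other. Antisymmetry exchanges the
  first two, so that linearity in the first and in the third argument suffices.\<close>

lemma curvature_eq_0_from_frame:
  assumes X: "vector_field M U X" and Y: "vector_field M U Y" and Z: "vector_field M U Z" and p: "p \<in> U"
    and c: "c \<in> charts_at M p"
    and E: "\<And>e q. e \<in> Basis \<Longrightarrow> q \<in> chart_dom c \<Longrightarrow> E e q = coord_vec M q c e"
    and frame: "\<And>i j k. i \<in> Basis \<Longrightarrow> j \<in> Basis \<Longrightarrow> k \<in> Basis \<Longrightarrow>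
      curvature M D (E i) (E j) (E k) p = 0"
  shows "curvature M D X Y Z p = 0"
proof -
  define V where "V = U \<inter> chart_dom c"
  have c': "c \<in> atlas M" "p \<in> chart_dom c" using c by (auto simp: charts_at_def)
  have V: "openin (top_of M) V" unfolding V_def by (intro openin_Int vector_field_openin[OF X] openin_chart_dom c')
  have VU: "V \<subseteq> U" and Vc: "V \<subseteq> chart_dom c" and pV: "p \<in> V" using p c' by (auto simp: V_def)
  note XV = vector_field_subset[OF X V VU] and YV = vector_field_subset[OF Y V VU] and ZV = vector_field_subset[OF Z V VU]
  have EV: "E e q = coord_vec M q c e" if "e \<in> Basis" "q \<in> V" for e q
    by (rule E) (use that Vc in auto)
  have vE: "vector_field M V (E e)" if "e \<in> Basis" for e
    by (rule vector_field_cong[OF vector_field_subset[OF vector_field_coord_vec[OF c'(1), of e] V Vc]])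
      (simp add: EV that)
  have 1: "curvature M D X (E j) (E k) p = 0" if jk: "j \<in> Basis" "k \<in> Basis" for j k
  proof (rule frame_induct[OF XV c'(1) Vc, where E = E and Q = "\<lambda>X. curvature M D X (E j) (E k) p = 0"])
    note fields = vE[OF jk(1)] vE[OF jk(2)] pV
    show "curvature M D X' (E j) (E k) p = 0"
      if "vector_field M V X" "\<And>q. q \<in> V \<Longrightarrow> X q = X' q" "curvature M D X (E j) (E k) p = 0" for X X'
      using curvature_cong_left[OF that(1) fields that(2)] that(3) by metis
  qed (simp_all only: EV frame jk curvature_0_left[OF vE vE pV] curvature_add_left[OF _ _ vE vE pV]
      curvature_scaleR_left[OF _ _ vE vE pV] scaleR_zero_right add_0)
  have 2: "curvature M D Y X (E k) p = 0" if k: "k \<in> Basis" for k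
  proof (rule frame_induct[OF YV c'(1) Vc, where E = E and Q = "\<lambda>Y. curvature M D Y X (E k) p = 0"])
    note fields = XV vE[OF k] pV
    show "curvature M D Y' X (E k) p = 0"
      if "vector_field M V Y" "\<And>q. q \<in> V \<Longrightarrow> Y q = Y' q" "curvature M D Y X (E k) p = 0" for Y Y'
      using curvature_cong_left[OF that(1) fields that(2)] that(3) by metis
    show "curvature M D (E e) X (E k) p = 0" if "e \<in> Basis" for e
      by (simp only: curvature_antisym[OF vE[OF that] fields] 1[OF that k] minus_zero)
  qed (simp_all only: EV k curvature_0_left[OF XV vE pV] curvature_add_left[OF _ _ XV vE pV]
      curvature_scaleR_left[OF _ _ XV vE pV] scaleR_zero_right add_0)
  show ?thesis
  proof (rule frame_induct[OF ZV c'(1) Vc, where E = E and Q = "\<lambda>Z. curvature M D X Y Z p = 0"])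
    show "curvature M D X Y Z' p = 0"
      if "vector_field M V Z" "\<And>q. q \<in> V \<Longrightarrow> Z q = Z' q" "curvature M D X Y Z p = 0" for Z Z'
      using curvature_cong_right[OF XV YV that(1) pV that(2)] that(3) by metis
    show "curvature M D X Y (E e) p = 0" if "e \<in> Basis" for e
      by (simp only: curvature_antisym[OF XV YV vE[OF that] pV] 2[OF that] minus_zero)
  qed (simp_all only: EV curvature_0_right[OF XV YV pV] curvature_add_right[OF XV YV _ _ pV]
      curvature_scaleR_right[OF _ XV YV _ pV] scaleR_zero_right add_0)
qed

text \<open>Differentiating the function \<open>g(Z,Z)\<close> twice gives
  \<open>X(Y f) - Y(X f) = 2 g(\<nabla>\<^bsub>X\<^esub> \<nabla>\<^bsub>Y\<^esub> Z - \<nabla>\<^bsub>Y\<^esub> \<nabla>\<^bsub>X\<^esub> Z, Z)\<close>, and the left hand side is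
  \<open>[X,Y] f = 2 g(\<nabla>\<^bsub>[X,Y]\<^esub> Z, Z)\<close>.\<close>

lemma metric_curvature_skew:
  assumes X: "vector_field M U X" and Y: "vector_field M U Y" and Z: "vector_field M U Z" and p: "p \<in> U"
  shows "g p (curvature M D X Y Z p) (Z p) = 0"
proof -
  have U: "q \<in> carrier M" if "q \<in> U" for q using openin_carrier vector_field_openin X that by blast
  define f where "f = (\<lambda>q. g q (Z q) (Z q))"
  have f: "smooth_function M U f" unfolding f_def by (rule smooth_function_metric[OF Z Z])
  have first: "dir_deriv M q v f = g q (D q v Z) (Z q) + g q (D q v Z) (Z q)"
    if "q \<in> U" "v \<in> tangent_space M q" for q v
    unfolding f_def metric_compatible[OF Z Z that]
    using metric_sym[OF U[OF that(1)] D_tangent[OF Z that] vector_field_tangent[OF Z that(1)]] by simp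
  have second: "dir_deriv M p (V p) (\<lambda>q. dir_deriv M q (W q) f) =
      2 * (g p (D p (V p) (\<lambda>q. D q (W q) Z)) (Z p) + g p (D p (W p) Z) (D p (V p) Z))"
    if V: "vector_field M U V" and W: "vector_field M U W" for V W
  proof -
    note Vp = vector_field_tangent[OF V p] and DWZ = vector_field_D[OF W Z]
    note G = smooth_function_metric[OF DWZ Z]
    have "dir_deriv M p (V p) (\<lambda>q. dir_deriv M q (W q) f) =
        dir_deriv M p (V p) (\<lambda>q. g q (D q (W q) Z) (Z q) + g q (D q (W q) Z) (Z q))"
      by (rule dir_deriv_cong[OF smooth_function_dir_deriv[OF f W] p Vp])
        (rule first[OF _ vector_field_tangent[OF W]])
    then show ?thesis
      unfolding dir_deriv_add[OF G G p Vp] metric_compatible[OF DWZ Z p Vp] by simp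
  qed
  note br = vector_field_tangent[OF vector_field_lie_bracket[OF X Y] p]
  note Xp = vector_field_tangent[OF X p] and Yp = vector_field_tangent[OF Y p] and Zp = vector_field_tangent[OF Z p]
  have "2 * g p (D p (lie_bracket M X Y p) Z) (Z p) =
      2 * g p (D p (X p) (\<lambda>q. D q (Y q) Z)) (Z p) - 2 * g p (D p (Y p) (\<lambda>q. D q (X q) Z)) (Z p)"
    using dir_deriv_lie_bracket[OF f X Y p br] first[OF p br] second[OF X Y] second[OF Y X]
      metric_sym[OF U[OF p] D_tangent[OF Z p Xp] D_tangent[OF Z p Yp]] by simp
  then show ?thesis
    unfolding curvature_def
    by (simp add: metric_diff_left[OF U[OF p]] tangent_space_diff Zp br D_tangent[OF Z p]
      D_tangent[OF vector_field_D[OF Y Z] p Xp] D_tangent[OF vector_field_D[OF X Z] p Yp])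
qed

end

section \<open>Lifts of vector fields to the cone\<close>

lemma cone_vec_add: "cone_vec N p x a + cone_vec N p y b = cone_vec N p (x + y) (a + b)"
  by (rule ext) (simp add: cone_vec_def)

lemma cone_vec_scaleR: "r *\<^sub>R cone_vec N p x a = cone_vec N p (r *\<^sub>R x) (r * a)"
  by (rule ext) (simp add: cone_vec_def scaleR_fun_apply)

lemma cone_vec_diff: "cone_vec N p x a - cone_vec N p y b = cone_vec N p (x - y) (a - b)"
  by (rule ext) (simp add: cone_vec_def)

lemma cone_vec_0: "cone_vec N p 0 0 = 0"
  by (rule ext) (simp add: cone_vec_def zero_prod_def)

definition cone_lift :: "('a, 'e::euclidean_space) mfd \<Rightarrow> ('a \<Rightarrow> ('a, 'e) tvec) \<Rightarrow>
    'a \<times> real \<Rightarrow> ('a \<times> real, 'e \<times> real) tvec"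
  where "cone_lift N X = (\<lambda>z. cone_vec N (fst z) (X (fst z)) 0)"

definition cone_radial :: "('a, 'e::euclidean_space) mfd \<Rightarrow> 'a \<times> real \<Rightarrow> ('a \<times> real, 'e \<times> real) tvec"
  where "cone_radial N = (\<lambda>z. cone_vec N (fst z) 0 1)"

lemma carrier_cone: "carrier (cone_mfd N) = carrier N \<times> {0<..}"
  by (simp add: cone_mfd_def)

lemma openin_cone: "openin (top_of N) U \<Longrightarrow> openin (top_of (cone_mfd N)) (U \<times> {0<..})"
  by (simp add: cone_mfd_def openin_prod_Times_iff)

lemma atlas_cone: "atlas (cone_mfd N) = cone_chart ` atlas N"
  by (simp add: cone_mfd_def)

lemma coord_cone_chart: "coord (cone_chart c) z = (coord c (fst z), snd z)"
  by (simp add: cone_chart_def split_beta)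

lemma chart_dom_cone_chart: "chart_dom (cone_chart c) = chart_dom c \<times> {0<..}"
  by (simp add: cone_chart_def)

lemma cone_chart_image:
  "coord (cone_chart c) ` ((U \<times> {0<..}) \<inter> chart_dom (cone_chart c)) = (coord c ` (U \<inter> chart_dom c)) \<times> {0<..}"
  by (force simp: coord_cone_chart chart_dom_cone_chart image_iff)

context smooth_mfd
begin

lemma cone_chart_charts_at: "c \<in> charts_at M p \<Longrightarrow> t > 0 \<Longrightarrow> cone_chart c \<in> charts_at (cone_mfd M) (p, t)"
  by (simp add: charts_at_cone)

lemma param_cone_chart:
  assumes c: "c \<in> atlas M" and w: "w \<in> (coord c ` (U \<inter> chart_dom c)) \<times> {0<..}"
  shows "param (cone_chart c) w = (param c (fst w), snd w)"
    and "param c (fst w) \<in> U" and "param c (fst w) \<in> chart_dom c" and "snd w > 0"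
proof -
  obtain q t where q: "w = (coord c q, t)" "q \<in> U" "q \<in> chart_dom c" "t > 0" using w by auto
  have "inj_on (coord (cone_chart c)) (chart_dom (cone_chart c))"
    using inj_on_coord[OF c] by (auto simp: inj_on_def coord_cone_chart chart_dom_cone_chart)
  then have "param (cone_chart c) w = (q, t)"
    unfolding param_def by (rule inv_into_f_eq) (use q in \<open>auto simp: coord_cone_chart chart_dom_cone_chart\<close>)
  then show "param (cone_chart c) w = (param c (fst w), snd w)"
    "param c (fst w) \<in> U" "param c (fst w) \<in> chart_dom c" "snd w > 0"
    using q param_coord[OF c] by auto
qed

lemma cone_vec_tangent:
  "p \<in> carrier M \<Longrightarrow> t > 0 \<Longrightarrow> x \<in> tangent_space M p \<Longrightarrow> cone_vec M p x a \<in> tangent_space (cone_mfd M) (p, t)"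
  using tangent_space_cone[OF smooth_manifold] by blast

lemma cone_vec_inject:
  assumes p: "p \<in> carrier M" and x: "x \<in> tangent_space M p" and y: "y \<in> tangent_space M p"
    and eq: "cone_vec M p x a = cone_vec M p y b"
  shows "x = y"
proof -
  obtain c where c: "c \<in> charts_at M p" using carrier_charts_at p by blast
  have "x c = y c" using cone_vec_cone_chart[OF c, of x a] cone_vec_cone_chart[OF c, of y b] eq by simp
  then show ?thesis by (rule tangent_eqI[OF x y c])
qed

lemma smooth_on_cone_base:
  assumes c: "c \<in> atlas M" and U: "openin (top_of M) U" and f: "smooth_on (coord c ` (U \<inter> chart_dom c)) f"
  shows "smooth_on ((coord c ` (U \<inter> chart_dom c)) \<times> {0::real<..}) (\<lambda>w. f (fst w))"
proof (rule smooth_on_compose[where f = f and g = fst, OF _ open_coord_image[OF c U] _ f])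
  show S: "open ((coord c ` (U \<inter> chart_dom c)) \<times> {0::real<..})"
    by (intro open_Times open_coord_image[OF c U] open_greaterThan)
  show "smooth_on ((coord c ` (U \<inter> chart_dom c)) \<times> {0::real<..}) fst"
    using smooth_on_bounded_linear[OF S bounded_linear_fst smooth_on_ident[OF S]] by simp
qed auto

lemma smooth_function_cone_base:
  assumes f: "smooth_function M U f"
  shows "smooth_function (cone_mfd M) (U \<times> {0<..}) (\<lambda>z. f (fst z))"
  unfolding smooth_function_def atlas_cone
proof (intro conjI ballI)
  fix C :: "('a \<times> real, 'e \<times> real) chart" assume "C \<in> cone_chart ` atlas M"
  then obtain c where c: "c \<in> atlas M" "C = cone_chart c" by auto
  let ?S = "(coord c ` (U \<inter> chart_dom c)) \<times> {0::real<..}"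
  have S: "open ?S" by (intro open_Times open_coord_image c smooth_function_openin[OF f] open_greaterThan)
  have "smooth_on ?S (\<lambda>w. (f \<circ> param c) (fst w))"
    by (rule smooth_on_cone_base[OF c(1) smooth_function_openin[OF f]]) (use f c in \<open>simp add: smooth_function_def comp_def\<close>)
  also have "smooth_on ?S (\<lambda>w. (f \<circ> param c) (fst w)) \<longleftrightarrow> smooth_on ?S ((\<lambda>z. f (fst z)) \<circ> param C)"
    by (rule smooth_on_cong[OF S]) (simp add: c param_cone_chart(1)[OF c(1)])
  finally show "smooth_on (coord C ` (U \<times> {0<..} \<inter> chart_dom C)) ((\<lambda>z. f (fst z)) \<circ> param C)"
    unfolding c(2) cone_chart_image .
qed (rule openin_cone[OF smooth_function_openin[OF f]])

lemma smooth_function_cone_radius: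
  assumes U: "openin (top_of M) U" and f: "smooth_on {0<..} f"
  shows "smooth_function (cone_mfd M) (U \<times> {0<..}) (\<lambda>z. f (snd z))"
  unfolding smooth_function_def atlas_cone
proof (intro conjI ballI)
  fix C :: "('a \<times> real, 'e \<times> real) chart" assume "C \<in> cone_chart ` atlas M"
  then obtain c where c: "c \<in> atlas M" "C = cone_chart c" by auto
  let ?S = "(coord c ` (U \<inter> chart_dom c)) \<times> {0::real<..}"
  have S: "open ?S" by (intro open_Times open_coord_image c U open_greaterThan)
  have "smooth_on ?S snd"
    using smooth_on_bounded_linear[OF S bounded_linear_snd smooth_on_ident[OF S]] by simp
  then have "smooth_on ?S (\<lambda>w. f (snd w))"
    by (rule smooth_on_compose[where f = f and g = snd, OF S open_greaterThan _ f]) auto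
  also have "smooth_on ?S (\<lambda>w. f (snd w)) \<longleftrightarrow> smooth_on ?S ((\<lambda>z. f (snd z)) \<circ> param C)"
    by (rule smooth_on_cong[OF S]) (simp add: c param_cone_chart(1)[OF c(1)])
  finally show "smooth_on (coord C ` (U \<times> {0<..} \<inter> chart_dom C)) ((\<lambda>z. f (snd z)) \<circ> param C)"
    unfolding c(2) cone_chart_image .
qed (rule openin_cone[OF U])

lemma cone_lift_component:
  assumes "c \<in> atlas M" "w \<in> (coord c ` (U \<inter> chart_dom c)) \<times> {0<..}"
  shows "cone_lift M X (param (cone_chart c) w) (cone_chart c) = (X (param c (fst w)) c, 0)"
  using param_cone_chart[OF assms] by (simp add: cone_lift_def cone_vec_cone_chart charts_atI assms(1))

lemma cone_radial_component:
  assumes "c \<in> atlas M" "w \<in> (coord c ` (U \<inter> chart_dom c)) \<times> {0<..}"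
  shows "cone_radial M (param (cone_chart c) w) (cone_chart c) = (0, 1)"
  using param_cone_chart[OF assms] by (simp add: cone_radial_def cone_vec_cone_chart charts_atI assms(1))

lemma vector_field_cone_lift:
  assumes X: "vector_field M U X"
  shows "vector_field (cone_mfd M) (U \<times> {0<..}) (cone_lift M X)"
  unfolding vector_field_def atlas_cone
proof (intro conjI ballI)
  note U = vector_field_openin[OF X]
  show "openin (top_of (cone_mfd M)) (U \<times> {0<..})" by (rule openin_cone[OF U])
  show "cone_lift M X z \<in> tangent_space (cone_mfd M) z" if "z \<in> U \<times> {0<..}" for z
    using that cone_vec_tangent openin_carrier[OF U] vector_field_tangent[OF X] by (auto simp: cone_lift_def)
  fix C :: "('a \<times> real, 'e \<times> real) chart" assume "C \<in> cone_chart ` atlas M"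
  then obtain c where c: "c \<in> atlas M" "C = cone_chart c" by auto
  let ?S = "(coord c ` (U \<inter> chart_dom c)) \<times> {0::real<..}"
  have S: "open ?S" by (intro open_Times open_coord_image c U open_greaterThan)
  have "smooth_on ?S (\<lambda>w. X (param c (fst w)) c)"
    by (rule smooth_on_cone_base[OF c(1) U, where f = "\<lambda>u. X (param c u) c"]) (use X c in \<open>simp add: vector_field_def\<close>)
  then have "smooth_on ?S (\<lambda>w. (X (param c (fst w)) c, 0::real))"
    by (rule smooth_on_bounded_linear[OF S bounded_linear_Pair[OF bounded_linear_ident bounded_linear_zero]])
  also have "smooth_on ?S (\<lambda>w. (X (param c (fst w)) c, 0::real)) \<longleftrightarrow> smooth_on ?S (\<lambda>w. cone_lift M X (param C w) C)"
    by (rule smooth_on_cong[OF S]) (simp add: c cone_lift_component[OF c(1)])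
  finally show "smooth_on (coord C ` (U \<times> {0<..} \<inter> chart_dom C)) (\<lambda>w. cone_lift M X (param C w) C)"
    unfolding c(2) cone_chart_image .
qed

lemma vector_field_cone_radial:
  assumes U: "openin (top_of M) U"
  shows "vector_field (cone_mfd M) (U \<times> {0<..}) (cone_radial M)"
  unfolding vector_field_def atlas_cone
proof (intro conjI ballI)
  show "openin (top_of (cone_mfd M)) (U \<times> {0<..})" by (rule openin_cone[OF U])
  show "cone_radial M z \<in> tangent_space (cone_mfd M) z" if "z \<in> U \<times> {0<..}" for z
    using that cone_vec_tangent openin_carrier[OF U] tangent_space_0 by (auto simp: cone_radial_def)
  fix C :: "('a \<times> real, 'e \<times> real) chart" assume "C \<in> cone_chart ` atlas M"
  then obtain c where c: "c \<in> atlas M" "C = cone_chart c" by auto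
  let ?S = "(coord c ` (U \<inter> chart_dom c)) \<times> {0::real<..}"
  have S: "open ?S" by (intro open_Times open_coord_image c U open_greaterThan)
  have "smooth_on ?S (\<lambda>w. (0::'e, 1::real))" by (rule smooth_on_const)
  also have "smooth_on ?S (\<lambda>w. (0::'e, 1::real)) \<longleftrightarrow> smooth_on ?S (\<lambda>w. cone_radial M (param C w) C)"
    by (rule smooth_on_cong[OF S]) (simp add: c cone_radial_component[OF c(1)])
  finally show "smooth_on (coord C ` (U \<times> {0<..} \<inter> chart_dom C)) (\<lambda>w. cone_radial M (param C w) C)"
    unfolding c(2) cone_chart_image .
qed

end

section \<open>The Levi-Civita connection of the cone\<close>

locale riemannian_cone =
  N: riemannian_mfd N h D' + C: riemannian_mfd "cone_mfd N" g D
  for N :: "('a, 'e::euclidean_space) mfd"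
    and h :: "'a \<Rightarrow> ('a, 'e) tvec \<Rightarrow> ('a, 'e) tvec \<Rightarrow> real"
    and D' :: "('a, 'e) connection"
    and g :: "'a \<times> real \<Rightarrow> ('a \<times> real, 'e \<times> real) tvec \<Rightarrow> ('a \<times> real, 'e \<times> real) tvec \<Rightarrow> real"
    and D :: "('a \<times> real, 'e \<times> real) connection" +
  assumes cone_metric: "\<And>p t x y a b. p \<in> carrier N \<Longrightarrow> t > 0 \<Longrightarrow>
      x \<in> tangent_space N p \<Longrightarrow> y \<in> tangent_space N p \<Longrightarrow>
      g (p, t) (cone_vec N p x a) (cone_vec N p y b) = t\<^sup>2 * h p x y + a * b"
begin

lemma dir_deriv_cone_base:
  assumes f: "smooth_function N U f" and p: "p \<in> U" and t: "t > 0" and x: "x \<in> tangent_space N p"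
  shows "dir_deriv (cone_mfd N) (p, t) (cone_vec N p x a) (\<lambda>z. f (fst z)) = dir_deriv N p x f"
proof -
  have pN: "p \<in> carrier N" using N.openin_carrier N.smooth_function_openin f p by blast
  obtain c where c: "c \<in> charts_at N p" using N.carrier_charts_at pN by blast
  have c': "c \<in> atlas N" "p \<in> chart_dom c" using c by (auto simp: charts_at_def)
  let ?S = "(coord c ` (U \<inter> chart_dom c)) \<times> {0::real<..}"
  have S: "open ?S" by (intro open_Times N.open_coord_image c' N.smooth_function_openin[OF f] open_greaterThan)
  have "((\<lambda>w. (f \<circ> param c) (fst w)) has_derivative
      (\<lambda>w. frechet_derivative (f \<circ> param c) (at (coord c p)) (fst w))) (at (coord c p, t))"
    by (rule has_derivative_compose[OF has_derivative_fst[OF has_derivative_ident]])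
      (use N.smooth_function_has_derivative[OF f p c] in \<open>simp add: comp_def\<close>)
  then have "(((\<lambda>z. f (fst z)) \<circ> param (cone_chart c)) has_derivative
      (\<lambda>w. frechet_derivative (f \<circ> param c) (at (coord c p)) (fst w))) (at (coord (cone_chart c) (p, t)))"
    unfolding coord_cone_chart fst_conv snd_conv
    by (rule has_derivative_transform_within_open[OF _ S])
      (use c' p t in \<open>auto simp: N.param_cone_chart(1)[OF c'(1), of _ U]\<close>)
  from C.dir_deriv_eqI[OF N.smooth_function_cone_base[OF f] _ N.cone_vec_tangent[OF pN t x]
      N.cone_chart_charts_at[OF c t] this]
  show ?thesis using p t by (simp add: cone_vec_cone_chart c N.dir_deriv_chart[OF f p c x])
qed

lemma dir_deriv_cone_radius:
  assumes f: "smooth_on {0<..} f" and f': "(f has_real_derivative f') (at t)"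
    and p: "p \<in> carrier N" and t: "t > 0" and x: "x \<in> tangent_space N p"
  shows "dir_deriv (cone_mfd N) (p, t) (cone_vec N p x a) (\<lambda>z. f (snd z)) = f' * a"
proof -
  obtain c where c: "c \<in> charts_at N p" using N.carrier_charts_at p by blast
  have c': "c \<in> atlas N" "p \<in> chart_dom c" using c by (auto simp: charts_at_def)
  let ?S = "(coord c ` (carrier N \<inter> chart_dom c)) \<times> {0::real<..}"
  have S: "open ?S" by (intro open_Times N.open_coord_image c' openin_topspace open_greaterThan)
  have "((\<lambda>w. f (snd w)) has_derivative (\<lambda>w. f' * snd w)) (at (coord c p, t))"
    by (rule has_derivative_compose[OF has_derivative_snd[OF has_derivative_ident]])
      (use f' in \<open>simp add: has_field_derivative_def\<close>)
  then have "(((\<lambda>z. f (snd z)) \<circ> param (cone_chart c)) has_derivative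
      (\<lambda>w. f' * snd w)) (at (coord (cone_chart c) (p, t)))"
    unfolding coord_cone_chart fst_conv snd_conv
    by (rule has_derivative_transform_within_open[OF _ S])
      (use c' p t in \<open>auto simp: N.param_cone_chart(1)[OF c'(1), of _ "carrier N"]\<close>)
  from C.dir_deriv_eqI[OF N.smooth_function_cone_radius[OF openin_topspace f] _ N.cone_vec_tangent[OF p t x]
      N.cone_chart_charts_at[OF c t] this]
  show ?thesis using p t by (simp add: cone_vec_cone_chart c)
qed

lemma frechet_derivative_cone_lift:
  assumes X: "vector_field N U X" and p: "p \<in> U" and t: "t > 0" and c: "c \<in> charts_at N p"
  shows "frechet_derivative (\<lambda>w. cone_lift N X (param (cone_chart c) w) (cone_chart c)) (at (coord (cone_chart c) (p, t)))
    = (\<lambda>w. (frechet_derivative (\<lambda>u. X (param c u) c) (at (coord c p)) (fst w), 0))"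
proof -
  have c': "c \<in> atlas N" "p \<in> chart_dom c" using c by (auto simp: charts_at_def)
  let ?S = "(coord c ` (U \<inter> chart_dom c)) \<times> {0::real<..}"
  have S: "open ?S" by (intro open_Times N.open_coord_image c' N.vector_field_openin[OF X] open_greaterThan)
  have "((\<lambda>u. X (param c u) c) has_derivative frechet_derivative (\<lambda>u. X (param c u) c) (at (coord c p))) (at (coord c p))"
    by (rule smooth_on_imp_has_derivative[of "coord c ` (U \<inter> chart_dom c)"])
      (use X c' p in \<open>auto simp: vector_field_def\<close>)
  then have "((\<lambda>w. X (param c (fst w)) c) has_derivative
      (\<lambda>w. frechet_derivative (\<lambda>u. X (param c u) c) (at (coord c p)) (fst w))) (at (coord c p, t))"
    by (intro has_derivative_compose[OF has_derivative_fst[OF has_derivative_ident], where g = "\<lambda>u. X (param c u) c"]) simp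
  from has_derivative_Pair[OF this has_derivative_const]
  have "((\<lambda>w. cone_lift N X (param (cone_chart c) w) (cone_chart c)) has_derivative
      (\<lambda>w. (frechet_derivative (\<lambda>u. X (param c u) c) (at (coord c p)) (fst w), 0))) (at (coord (cone_chart c) (p, t)))"
    unfolding coord_cone_chart fst_conv snd_conv
    by (rule has_derivative_transform_within_open[OF _ S])
      (use c' p t in \<open>auto simp: N.cone_lift_component[OF c'(1), of _ U]\<close>)
  then show ?thesis by (rule frechet_derivative_at[symmetric])
qed

lemma frechet_derivative_cone_radial:
  assumes p: "p \<in> carrier N" and t: "t > 0" and c: "c \<in> charts_at N p"
  shows "frechet_derivative (\<lambda>w. cone_radial N (param (cone_chart c) w) (cone_chart c)) (at (coord (cone_chart c) (p, t)))
    = (\<lambda>w. 0)"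
proof -
  have c': "c \<in> atlas N" "p \<in> chart_dom c" using c by (auto simp: charts_at_def)
  let ?S = "(coord c ` (carrier N \<inter> chart_dom c)) \<times> {0::real<..}"
  have S: "open ?S" by (intro open_Times N.open_coord_image c' openin_topspace open_greaterThan)
  have "((\<lambda>w. cone_radial N (param (cone_chart c) w) (cone_chart c)) has_derivative (\<lambda>w. 0))
      (at (coord (cone_chart c) (p, t)))"
    unfolding coord_cone_chart fst_conv snd_conv
    by (rule has_derivative_transform_within_open[OF has_derivative_const S])
      (use c' p t in \<open>auto simp: N.cone_radial_component[OF c'(1), of _ "carrier N"]\<close>)
  then show ?thesis by (rule frechet_derivative_at[symmetric])
qed

text \<open>In a product chart the components of a lift do not depend on \<open>t\<close> and have no radial part, so the
  bracket is computed on \<open>N\<close>.\<close>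

lemma lie_bracket_cone_lift:
  assumes X: "vector_field N U X" and Y: "vector_field N U Y" and p: "p \<in> U" and t: "t > 0"
  shows "lie_bracket (cone_mfd N) (cone_lift N X) (cone_lift N Y) (p, t) = cone_vec N p (lie_bracket N X Y p) 0"
proof -
  have pN: "p \<in> carrier N" using N.openin_carrier N.vector_field_openin X p by blast
  obtain c where c: "c \<in> charts_at N p" using N.carrier_charts_at pN by blast
  have z: "(p, t) \<in> U \<times> {0<..}" using p t by simp
  show ?thesis
  proof (rule C.tangent_eqI[OF _ _ N.cone_chart_charts_at[OF c t]])
    show "lie_bracket (cone_mfd N) (cone_lift N X) (cone_lift N Y) (p, t) \<in> tangent_space (cone_mfd N) (p, t)"
      by (rule C.vector_field_tangent[OF C.vector_field_lie_bracket[OF N.vector_field_cone_lift[OF X]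
        N.vector_field_cone_lift[OF Y]] z])
    show "cone_vec N p (lie_bracket N X Y p) 0 \<in> tangent_space (cone_mfd N) (p, t)"
      by (rule N.cone_vec_tangent[OF pN t N.vector_field_tangent[OF N.vector_field_lie_bracket[OF X Y] p]])
    show "lie_bracket (cone_mfd N) (cone_lift N X) (cone_lift N Y) (p, t) (cone_chart c) =
        cone_vec N p (lie_bracket N X Y p) 0 (cone_chart c)"
      unfolding lie_bracket_def[of "cone_mfd N"] frechet_derivative_cone_lift[OF X p t c]
        frechet_derivative_cone_lift[OF Y p t c] cone_vec_cone_chart[OF c]
      using N.cone_chart_charts_at[OF c t] c
      by (simp add: lie_bracket_def cone_lift_def cone_vec_cone_chart)
  qed
qed

lemma lie_bracket_cone_lift_radial:
  assumes X: "vector_field N U X" and p: "p \<in> U" and t: "t > 0"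
  shows "lie_bracket (cone_mfd N) (cone_lift N X) (cone_radial N) (p, t) = 0"
proof -
  have pN: "p \<in> carrier N" using N.openin_carrier N.vector_field_openin X p by blast
  obtain c where c: "c \<in> charts_at N p" using N.carrier_charts_at pN by blast
  have c': "c \<in> atlas N" "p \<in> chart_dom c" using c by (auto simp: charts_at_def)
  have z: "(p, t) \<in> U \<times> {0<..}" using p t by simp
  have "linear (frechet_derivative (\<lambda>u. X (param c u) c) (at (coord c p)))"
    by (rule smooth_on_imp_linear[of "coord c ` (U \<inter> chart_dom c)"])
      (use X c' p in \<open>auto simp: vector_field_def\<close>)
  then have 0: "frechet_derivative (\<lambda>u. X (param c u) c) (at (coord c p)) 0 = 0" by (rule linear_0)
  show ?thesis
  proof (rule C.tangent_eqI[OF _ C.tangent_space_0 N.cone_chart_charts_at[OF c t]])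
    show "lie_bracket (cone_mfd N) (cone_lift N X) (cone_radial N) (p, t) \<in> tangent_space (cone_mfd N) (p, t)"
      by (rule C.vector_field_tangent[OF C.vector_field_lie_bracket[OF N.vector_field_cone_lift[OF X]
        N.vector_field_cone_radial[OF N.vector_field_openin[OF X]]] z])
    show "lie_bracket (cone_mfd N) (cone_lift N X) (cone_radial N) (p, t) (cone_chart c) = 0 (cone_chart c)"
      unfolding lie_bracket_def[of "cone_mfd N"] frechet_derivative_cone_lift[OF X p t c]
        frechet_derivative_cone_radial[OF pN t c]
      using N.cone_chart_charts_at[OF c t] c 0
      by (simp add: cone_radial_def cone_vec_cone_chart zero_prod_def)
  qed
qed

lemma cone_metric_lift: "p \<in> carrier N \<Longrightarrow> t > 0 \<Longrightarrow> x \<in> tangent_space N p \<Longrightarrow> y \<in> tangent_space N p \<Longrightarrow>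
    g (p, t) (cone_vec N p x 0) (cone_vec N p y 0) = t\<^sup>2 * h p x y"
  by (simp add: cone_metric)

text \<open>The lifts and the radial vector span the tangent space and the metric is nondegenerate: this is
  how all covariant derivatives on the cone are determined.\<close>

lemma tangent_cone_eqI:
  assumes p: "p \<in> carrier N" and t: "t > 0"
    and v: "v \<in> tangent_space (cone_mfd N) (p, t)" and w: "w \<in> tangent_space (cone_mfd N) (p, t)"
    and horizontal: "\<And>z. z \<in> tangent_space N p \<Longrightarrow> g (p, t) v (cone_vec N p z 0) = g (p, t) w (cone_vec N p z 0)"
    and radial: "g (p, t) v (cone_vec N p 0 1) = g (p, t) w (cone_vec N p 0 1)"
  shows "v = w"
proof -
  obtain x a where v': "v = cone_vec N p x a" "x \<in> tangent_space N p"
    using v tangent_space_cone[OF N.smooth_manifold p t] by blast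
  obtain y b where w': "w = cone_vec N p y b" "y \<in> tangent_space N p"
    using w tangent_space_cone[OF N.smooth_manifold p t] by blast
  have "h p x z = h p y z" if "z \<in> tangent_space N p" for z
    using horizontal[OF that] t by (simp add: v' w' cone_metric p that)
  then have "x = y" by (rule N.metric_nondegenerate[OF p v'(2) w'(2)])
  moreover have "a = b"
    using radial t by (simp add: v' w' cone_metric p N.tangent_space_0 N.metric_sym[OF p _ N.tangent_space_0] N.metric_0_left)
  ultimately show ?thesis by (simp add: v' w')
qed

text \<open>The product rule for \<open>g(X\<up>, Y\<up>) = t\<^sup>2 h(X,Y)\<close>.\<close>

lemma dir_deriv_metric_lift:
  assumes X: "vector_field N U X" and Y: "vector_field N U Y" and p: "p \<in> U" and t: "t > 0"
    and x: "x \<in> tangent_space N p"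
  shows "dir_deriv (cone_mfd N) (p, t) (cone_vec N p x a) (\<lambda>z. g z (cone_lift N X z) (cone_lift N Y z)) =
    t\<^sup>2 * dir_deriv N p x (\<lambda>q. h q (X q) (Y q)) + 2 * t * a * h p (X p) (Y p)"
proof -
  have U: "q \<in> carrier N" if "q \<in> U" for q using N.openin_carrier N.vector_field_openin X that by blast
  have z: "(p, t) \<in> U \<times> {0<..}" using p t by simp
  let ?H = "\<lambda>q. h q (X q) (Y q)"
  note H = N.smooth_function_metric[OF X Y] and v = N.cone_vec_tangent[OF U[OF p] t x]
  have sq: "smooth_on {0<..} (\<lambda>t::real. t\<^sup>2)"
    unfolding power2_eq_square by (intro smooth_on_mult smooth_on_ident open_greaterThan)
  have sq': "((\<lambda>t::real. t\<^sup>2) has_real_derivative 2 * t) (at t)"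
    by (auto intro!: derivative_eq_intros)
  have "dir_deriv (cone_mfd N) (p, t) (cone_vec N p x a) (\<lambda>z. g z (cone_lift N X z) (cone_lift N Y z)) =
      dir_deriv (cone_mfd N) (p, t) (cone_vec N p x a) (\<lambda>z. (snd z)\<^sup>2 * ?H (fst z))"
    by (rule C.dir_deriv_cong[OF C.smooth_function_metric[OF N.vector_field_cone_lift[OF X] N.vector_field_cone_lift[OF Y]] z v])
      (auto simp: cone_lift_def cone_metric_lift U N.vector_field_tangent[OF X] N.vector_field_tangent[OF Y])
  also have "\<dots> = (2 * t * a) * ?H p + t\<^sup>2 * dir_deriv N p x ?H"
    using C.dir_deriv_mult[OF N.smooth_function_cone_radius[OF N.vector_field_openin[OF X] sq]
        N.smooth_function_cone_base[OF H] z v]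
      dir_deriv_cone_radius[OF sq sq' U[OF p] t x] dir_deriv_cone_base[OF H p t x] by simp
  finally show ?thesis by simp
qed

text \<open>These three metric coefficients are constant, namely 0, 0 and 1.\<close>

lemma dir_deriv_metric_radial:
  assumes X: "vector_field N U X" and p: "p \<in> U" and t: "t > 0" and v: "v \<in> tangent_space (cone_mfd N) (p, t)"
  shows "dir_deriv (cone_mfd N) (p, t) v (\<lambda>z. g z (cone_lift N X z) (cone_radial N z)) = 0"
    and "dir_deriv (cone_mfd N) (p, t) v (\<lambda>z. g z (cone_radial N z) (cone_lift N X z)) = 0"
    and "dir_deriv (cone_mfd N) (p, t) v (\<lambda>z. g z (cone_radial N z) (cone_radial N z)) = 0"
proof -
  note U = N.vector_field_openin[OF X]
  have UN: "q \<in> carrier N" if "q \<in> U" for q using N.openin_carrier U that by blast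
  have z: "(p, t) \<in> U \<times> {0<..}" using p t by simp
  have zN: "(p, t) \<in> carrier (cone_mfd N)" using UN p t by (simp add: carrier_cone)
  note L = N.vector_field_cone_lift[OF X] and R = N.vector_field_cone_radial[OF U]
  have h0: "h q x 0 = 0" "h q 0 x = 0" if "q \<in> carrier N" "x \<in> tangent_space N q" for q x
    using N.metric_0_left[OF that] N.metric_sym[OF that N.tangent_space_0] by simp_all
  show "dir_deriv (cone_mfd N) (p, t) v (\<lambda>z. g z (cone_lift N X z) (cone_radial N z)) = 0"
    using C.dir_deriv_cong[OF C.smooth_function_metric[OF L R] z v, of "\<lambda>z. 0"] C.dir_deriv_const[OF zN v]
    by (auto simp: cone_lift_def cone_radial_def cone_metric UN N.vector_field_tangent[OF X] N.tangent_space_0 h0)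
  show "dir_deriv (cone_mfd N) (p, t) v (\<lambda>z. g z (cone_radial N z) (cone_lift N X z)) = 0"
    using C.dir_deriv_cong[OF C.smooth_function_metric[OF R L] z v, of "\<lambda>z. 0"] C.dir_deriv_const[OF zN v]
    by (auto simp: cone_lift_def cone_radial_def cone_metric UN N.vector_field_tangent[OF X] N.tangent_space_0 h0)
  show "dir_deriv (cone_mfd N) (p, t) v (\<lambda>z. g z (cone_radial N z) (cone_radial N z)) = 0"
    using C.dir_deriv_cong[OF C.smooth_function_metric[OF R R] z v, of "\<lambda>z. 1"] C.dir_deriv_const[OF zN v]
    by (auto simp: cone_radial_def cone_metric UN N.tangent_space_0 h0)
qed

text \<open>In the Koszul formula tested against a lift \<open>Y\<up>\<close> only the radial derivative
  \<open>2 t h(X,Y)\<close> of the metric survives; the radial part vanishes because \<open>\<xi>\<close> has constant length.\<close>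

lemma D_lift_radial:
  assumes X: "vector_field N U X" and p: "p \<in> U" and t: "t > 0"
  shows "D (p, t) (cone_lift N X (p, t)) (cone_radial N) = inverse t *\<^sub>R cone_lift N X (p, t)" (is "?D = ?R")
proof -
  note U = N.vector_field_openin[OF X]
  have pN: "p \<in> carrier N" using N.openin_carrier U p by blast
  have z: "(p, t) \<in> U \<times> {0<..}" and zN: "(p, t) \<in> carrier (cone_mfd N)" using p t pN by (simp_all add: carrier_cone)
  note L = N.vector_field_cone_lift[OF X] and R = N.vector_field_cone_radial[OF U]
  note Lz = C.vector_field_tangent[OF L z] and Rz = C.vector_field_tangent[OF R z] and Xp = N.vector_field_tangent[OF X p]
  note DT = C.D_tangent[OF R z Lz]
  have r: "cone_radial N (p, t) = cone_vec N p 0 1" by (simp add: cone_radial_def)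
  have l: "cone_lift N X (p, t) = cone_vec N p (X p) 0" by (simp add: cone_lift_def)
  show ?thesis
  proof (rule tangent_cone_eqI[OF pN t DT C.tangent_space_scaleR[OF Lz]])
    have "2 * g (p, t) ?D (cone_vec N p 0 1) = 0"
      using C.metric_compatible[OF R R z Lz] dir_deriv_metric_radial(3)[OF X p t Lz]
        C.metric_sym[OF zN DT Rz] by (simp add: r)
    moreover have "g (p, t) ?R (cone_vec N p 0 1) = 0"
      by (simp add: l cone_vec_scaleR cone_metric pN t N.tangent_space_scaleR Xp N.tangent_space_0
        N.metric_scaleR_left N.metric_sym[OF pN Xp N.tangent_space_0] N.metric_0_left)
    ultimately show "g (p, t) ?D (cone_vec N p 0 1) = g (p, t) ?R (cone_vec N p 0 1)" by simp
  next
    fix y assume y: "y \<in> tangent_space N p"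
    obtain V Y where V: "openin (top_of N) V" "V \<subseteq> U" "p \<in> V" and Y: "vector_field N V Y" and Yp: "Y p = y"
      using N.tangent_extension[OF U p y] by blast
    note XV = N.vector_field_subset[OF X V(1,2)]
    have zV: "(p, t) \<in> V \<times> {0<..}" using V t by simp
    note LV = N.vector_field_cone_lift[OF XV] and RV = N.vector_field_cone_radial[OF V(1)]
      and YV = N.vector_field_cone_lift[OF Y]
    note Yz = C.vector_field_tangent[OF YV zV]
    have ly: "cone_lift N Y (p, t) = cone_vec N p y 0" by (simp add: cone_lift_def Yp)
    have "lie_bracket (cone_mfd N) (cone_radial N) (cone_lift N Y) (p, t) = 0"
      using C.torsion_free[OF RV YV zV] C.torsion_free[OF YV RV zV] lie_bracket_cone_lift_radial[OF Y V(3) t]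
      by (metis minus_diff_eq minus_zero)
    moreover have "g (p, t) (cone_vec N p (lie_bracket N X Y p) 0) (cone_vec N p 0 1) = 0"
      using N.vector_field_tangent[OF N.vector_field_lie_bracket[OF XV Y] V(3)]
      by (simp add: cone_metric pN t N.tangent_space_0 N.metric_sym[OF pN _ N.tangent_space_0] N.metric_0_left)
    ultimately have "2 * g (p, t) ?D (cone_vec N p y 0) = 2 * t * h p y (X p)"
      using C.koszul[OF LV RV YV zV] dir_deriv_metric_radial(1)[OF XV V(3) t Yz]
        dir_deriv_metric_radial(2)[OF Y V(3) t Lz] dir_deriv_metric_lift[OF Y XV V(3) t N.tangent_space_0, of 1]
        lie_bracket_cone_lift_radial[OF XV V(3) t] lie_bracket_cone_lift[OF XV Y V(3) t]
        N.dir_deriv_scaleR_vec[OF N.smooth_function_metric[OF Y XV] V(3) N.tangent_space_0, of 0]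
      by (simp add: r ly Yp C.metric_0_left[OF zN] Yz[unfolded ly] Lz)
    then show "g (p, t) ?D (cone_vec N p y 0) = g (p, t) ?R (cone_vec N p y 0)"
      using t N.metric_sym[OF pN y Xp]
      by (simp add: l cone_vec_scaleR cone_metric pN N.tangent_space_scaleR Xp y N.metric_scaleR_left power2_eq_square)
  qed
qed

lemma D_radial_lift:
  assumes X: "vector_field N U X" and p: "p \<in> U" and t: "t > 0"
  shows "D (p, t) (cone_radial N (p, t)) (cone_lift N X) = inverse t *\<^sub>R cone_lift N X (p, t)"
proof -
  have z: "(p, t) \<in> U \<times> {0<..}" using p t by simp
  show ?thesis
    using C.torsion_free[OF N.vector_field_cone_lift[OF X] N.vector_field_cone_radial[OF N.vector_field_openin[OF X]] z]
    unfolding lie_bracket_cone_lift_radial[OF X p t] D_lift_radial[OF X p t] by (metis eq_iff_diff_eq_0)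
qed

text \<open>Against lifts, the Koszul formula of the cone is \<open>t\<^sup>2\<close> times that of \<open>N\<close>. The radial
  part follows from \<open>\<nabla>\<^bsub>X\<up>\<^esub> \<xi> = X\<up> / t\<close>, because \<open>Y\<up>\<close> and \<open>\<xi>\<close> are orthogonal.\<close>

lemma D_lift_lift:
  assumes X: "vector_field N U X" and Y: "vector_field N U Y" and p: "p \<in> U" and t: "t > 0"
  shows "D (p, t) (cone_lift N X (p, t)) (cone_lift N Y) =
    cone_vec N p (D' p (X p) Y) (- t * h p (X p) (Y p))" (is "?D = ?R")
proof -
  note U = N.vector_field_openin[OF X]
  have pN: "p \<in> carrier N" using N.openin_carrier U p by blast
  have z: "(p, t) \<in> U \<times> {0<..}" and zN: "(p, t) \<in> carrier (cone_mfd N)" using p t pN by (simp_all add: carrier_cone)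
  note LX = N.vector_field_cone_lift[OF X] and LY = N.vector_field_cone_lift[OF Y] and R = N.vector_field_cone_radial[OF U]
  note Xz = C.vector_field_tangent[OF LX z] and Yz = C.vector_field_tangent[OF LY z] and Rz = C.vector_field_tangent[OF R z]
    and Xp = N.vector_field_tangent[OF X p] and Yp = N.vector_field_tangent[OF Y p]
  note DT = C.D_tangent[OF LY z Xz] and DT' = N.D_tangent[OF Y p Xp]
  have r: "cone_radial N (p, t) = cone_vec N p 0 1" by (simp add: cone_radial_def)
  have l: "cone_lift N X (p, t) = cone_vec N p (X p) 0" for X by (simp add: cone_lift_def)
  show ?thesis
  proof (rule tangent_cone_eqI[OF pN t DT N.cone_vec_tangent[OF pN t DT']])
    have 1: "0 = g (p, t) ?D (cone_vec N p 0 1) + g (p, t) (cone_lift N Y (p, t)) (inverse t *\<^sub>R cone_lift N X (p, t))"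
      using C.metric_compatible[OF LY R z Xz] dir_deriv_metric_radial(1)[OF Y p t Xz]
      by (simp add: r D_lift_radial[OF X p t])
    have 2: "g (p, t) (cone_lift N Y (p, t)) (inverse t *\<^sub>R cone_lift N X (p, t)) = t * h p (X p) (Y p)"
      using t N.metric_sym[OF pN Yp Xp]
      by (simp add: C.metric_scaleR_right[OF zN Xz Yz]) (simp add: l cone_metric pN Xp Yp power2_eq_square)
    show "g (p, t) ?D (cone_vec N p 0 1) = g (p, t) ?R (cone_vec N p 0 1)"
      using 1 unfolding 2 by (simp add: cone_metric pN t DT' N.tangent_space_0 N.metric_sym[OF pN DT' N.tangent_space_0] N.metric_0_left)
  next
    fix y assume y: "y \<in> tangent_space N p"
    obtain V Z where V: "openin (top_of N) V" "V \<subseteq> U" "p \<in> V" and Z: "vector_field N V Z" and Zp: "Z p = y"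
      using N.tangent_extension[OF U p y] by blast
    note XV = N.vector_field_subset[OF X V(1,2)] and YV = N.vector_field_subset[OF Y V(1,2)]
    have zV: "(p, t) \<in> V \<times> {0<..}" using V t by simp
    note br = N.vector_field_tangent[OF N.vector_field_lie_bracket[OF XV YV] V(3)]
      N.vector_field_tangent[OF N.vector_field_lie_bracket[OF XV Z] V(3)]
      N.vector_field_tangent[OF N.vector_field_lie_bracket[OF YV Z] V(3)]
    have "2 * g (p, t) ?D (cone_vec N p y 0) = t\<^sup>2 * (2 * h p (D' p (X p) Y) y)"
      using C.koszul[OF N.vector_field_cone_lift[OF XV] N.vector_field_cone_lift[OF YV] N.vector_field_cone_lift[OF Z] zV]
      unfolding l dir_deriv_metric_lift[OF XV YV V(3) t y] dir_deriv_metric_lift[OF YV Z V(3) t Xp]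
        dir_deriv_metric_lift[OF Z XV V(3) t Yp] lie_bracket_cone_lift[OF XV YV V(3) t]
        lie_bracket_cone_lift[OF XV Z V(3) t] lie_bracket_cone_lift[OF YV Z V(3) t] Zp
        N.koszul[OF XV YV Z V(3), unfolded Zp] cone_metric_lift[OF pN t br(1) y]
        cone_metric_lift[OF pN t br(2) Yp] cone_metric_lift[OF pN t br(3) Xp]
      by (simp add: algebra_simps)
    then show "g (p, t) ?D (cone_vec N p y 0) = g (p, t) ?R (cone_vec N p y 0)"
      by (simp add: cone_metric pN t DT' y)
  qed
qed

lemma D_radial_radial:
  assumes pN: "p \<in> carrier N" and t: "t > 0"
  shows "D (p, t) (cone_radial N (p, t)) (cone_radial N) = 0" (is "?D = 0")
proof -
  have z: "(p, t) \<in> carrier N \<times> {0<..}" and zN: "(p, t) \<in> carrier (cone_mfd N)" using t pN by (simp_all add: carrier_cone)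
  note R = N.vector_field_cone_radial[OF openin_topspace]
  note Rz = C.vector_field_tangent[OF R z]
  note DT = C.D_tangent[OF R z Rz]
  have r: "cone_radial N (p, t) = cone_vec N p 0 1" by (simp add: cone_radial_def)
  show ?thesis
  proof (rule tangent_cone_eqI[OF pN t DT C.tangent_space_0])
    have "2 * g (p, t) ?D (cone_vec N p 0 1) = 0"
      using C.metric_compatible[OF R R z Rz] dir_deriv_metric_radial(3)[OF N.vector_field_0[OF openin_topspace] pN t Rz]
        C.metric_sym[OF zN DT Rz] by (simp add: r)
    then show "g (p, t) ?D (cone_vec N p 0 1) = g (p, t) 0 (cone_vec N p 0 1)"
      by (simp add: C.metric_0_left[OF zN] Rz[unfolded r])
  next
    fix y assume y: "y \<in> tangent_space N p"
    obtain V Y where V: "openin (top_of N) V" "p \<in> V" and Y: "vector_field N V Y" and Yp: "Y p = y"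
      using N.tangent_extension[OF openin_topspace pN y] by blast
    note LY = N.vector_field_cone_lift[OF Y] and RV = N.vector_field_cone_radial[OF V(1)]
    have zV: "(p, t) \<in> V \<times> {0<..}" using V t by simp
    have l: "cone_lift N Y (p, t) = cone_vec N p y 0" by (simp add: cone_lift_def Yp)
    have "g (p, t) (cone_vec N p 0 1) (inverse t *\<^sub>R cone_vec N p y 0) = 0"
      by (simp add: cone_vec_scaleR cone_metric pN t y N.tangent_space_0 N.tangent_space_scaleR N.metric_0_left)
    then have "g (p, t) ?D (cone_vec N p y 0) = 0"
      using C.metric_compatible[OF RV LY zV Rz] dir_deriv_metric_radial(2)[OF Y V(2) t Rz]
      by (simp add: r l D_radial_lift[OF Y V(2) t, unfolded r l])
    then show "g (p, t) ?D (cone_vec N p y 0) = g (p, t) 0 (cone_vec N p y 0)"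
      by (simp add: C.metric_0_left[OF zN] N.cone_vec_tangent[OF pN t y])
  qed
qed

section \<open>The curvature of the cone\<close>

text \<open>The Leibniz rule for the fields \<open>Y\<up> / t\<close>, which are the covariant derivatives that involve the
  radial field once.\<close>

lemma D_inverse_radius_lift:
  assumes Y: "vector_field N U Y" and p: "p \<in> U" and t: "t > 0" and x: "x \<in> tangent_space N p"
  shows "D (p, t) (cone_vec N p x a) (\<lambda>z. inverse (snd z) *\<^sub>R cone_lift N Y z) =
    inverse t *\<^sub>R D (p, t) (cone_vec N p x a) (cone_lift N Y) - (a * (inverse t)\<^sup>2) *\<^sub>R cone_lift N Y (p, t)"
proof -
  note U = N.vector_field_openin[OF Y]
  have pN: "p \<in> carrier N" using N.openin_carrier U p by blast
  have z: "(p, t) \<in> U \<times> {0<..}" using p t by simp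
  have inv: "smooth_on {0<..} (\<lambda>t::real. inverse t)"
    by (rule smooth_on_inverse[OF open_greaterThan smooth_on_ident[OF open_greaterThan]]) simp
  have inv': "((\<lambda>t::real. inverse t) has_real_derivative - (inverse t)\<^sup>2) (at t)"
    using t by (auto intro!: derivative_eq_intros simp: power2_eq_square)
  show ?thesis
    using C.D_scaleR[OF N.smooth_function_cone_radius[OF U inv] N.vector_field_cone_lift[OF Y] z N.cone_vec_tangent[OF pN t x]]
    unfolding dir_deriv_cone_radius[OF inv inv' pN t x]
    by (simp add: algebra_simps)
qed

text \<open>The inner derivative is \<open>(\<nabla>'\<^bsub>Y\<^esub> Z)\<up> - t h(Y,Z) \<xi>\<close>, to which the Leibniz rule is applied in
  a direction \<open>(x, a d/dt)\<close>.\<close>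

lemma D_D_lift_lift:
  assumes Y: "vector_field N U Y" and Z: "vector_field N U Z" and p: "p \<in> U" and t: "t > 0"
    and x: "x \<in> tangent_space N p"
  shows "D (p, t) (cone_vec N p x a) (\<lambda>z. D z (cone_lift N Y z) (cone_lift N Z)) =
    D (p, t) (cone_vec N p x a) (cone_lift N (\<lambda>q. D' q (Y q) Z)) -
    (t * (h p (D' p x Y) (Z p) + h p (Y p) (D' p x Z)) + a * h p (Y p) (Z p)) *\<^sub>R cone_radial N (p, t) -
    (t * h p (Y p) (Z p)) *\<^sub>R D (p, t) (cone_vec N p x a) (cone_radial N)"
proof -
  note U = N.vector_field_openin[OF Y]
  have pN: "p \<in> carrier N" using N.openin_carrier U p by blast
  have z: "(p, t) \<in> U \<times> {0<..}" using p t by simp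
  note LY = N.vector_field_cone_lift[OF Y] and LZ = N.vector_field_cone_lift[OF Z]
    and R = N.vector_field_cone_radial[OF U] and v = N.cone_vec_tangent[OF pN t x, of a]
    and LYZ = N.vector_field_cone_lift[OF N.vector_field_D[OF Y Z]]
  let ?H = "\<lambda>q. h q (Y q) (Z q)"
  \<comment> \<open>The coefficient \<open>- t h(Y,Z)\<close> of \<open>\<xi>\<close>, written as a function of \<open>t\<close> times a function on \<open>N\<close> to match the product rule.\<close>
  let ?F = "\<lambda>z. (- 1 * snd z) * ?H (fst z)"
  note H = N.smooth_function_metric[OF Y Z]
  have neg: "smooth_on {0<..} (\<lambda>t::real. - 1 * t)"
    by (intro smooth_on_mult smooth_on_const smooth_on_ident open_greaterThan)
  have neg': "((\<lambda>t::real. - 1 * t) has_real_derivative - 1) (at t)"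
    by (auto intro!: derivative_eq_intros)
  note smooth_radius = N.smooth_function_cone_radius[OF U neg] and smooth_H = N.smooth_function_cone_base[OF H]
  note F = C.smooth_function_mult[OF smooth_radius smooth_H]
  have 1: "D (p, t) (cone_vec N p x a) (\<lambda>z. D z (cone_lift N Y z) (cone_lift N Z)) =
      D (p, t) (cone_vec N p x a) (\<lambda>z. cone_lift N (\<lambda>q. D' q (Y q) Z) z + ?F z *\<^sub>R cone_radial N z)"
  proof (rule C.D_cong[OF C.vector_field_D[OF LY LZ] _ z v])
    fix w :: "'a \<times> real" assume "w \<in> U \<times> {0<..}"
    then obtain q s where w: "w = (q, s)" "q \<in> U" "s > 0" by auto
    show "D w (cone_lift N Y w) (cone_lift N Z) = cone_lift N (\<lambda>q. D' q (Y q) Z) w + ?F w *\<^sub>R cone_radial N w"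
      unfolding w(1) D_lift_lift[OF Y Z w(2,3)]
      by (simp add: cone_lift_def cone_radial_def cone_vec_scaleR cone_vec_add)
  qed
  have 2: "dir_deriv (cone_mfd N) (p, t) (cone_vec N p x a) ?F =
      - (t * (h p (D' p x Y) (Z p) + h p (Y p) (D' p x Z)) + a * h p (Y p) (Z p))"
    using C.dir_deriv_mult[OF smooth_radius smooth_H z v]
    unfolding dir_deriv_cone_radius[OF neg neg' pN t x] dir_deriv_cone_base[OF H p t x] N.metric_compatible[OF Y Z p x]
    by simp
  show ?thesis
    unfolding 1 C.D_add[OF LYZ C.vector_field_scaleR[OF F R] z v] C.D_scaleR[OF F R z v] 2
    by (simp add: algebra_simps)
qed

text \<open>The terms \<open>h(Y,Z) X\<close> and \<open>h(X,Z) Y\<close> arise from differentiating \<open>\<xi>\<close> in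
  \<open>- t h(Y,Z) \<xi>\<close>: the factors \<open>t\<close> and \<open>1/t\<close> cancel. The radial components add up to zero since \<open>\<nabla>'\<close>
  is metric and torsion free.\<close>

lemma curvature_lift_lift_lift:
  assumes X: "vector_field N U X" and Y: "vector_field N U Y" and Z: "vector_field N U Z" and p: "p \<in> U" and t: "t > 0"
  shows "curvature (cone_mfd N) D (cone_lift N X) (cone_lift N Y) (cone_lift N Z) (p, t) =
    cone_vec N p (curvature N D' X Y Z p - (h p (Y p) (Z p) *\<^sub>R X p - h p (X p) (Z p) *\<^sub>R Y p)) 0"
proof -
  have pN: "p \<in> carrier N" using N.openin_carrier N.vector_field_openin X p by blast
  have tt: "t * (inverse t * r) = r" for r using t by simp
  note br = N.vector_field_lie_bracket[OF X Y]
  note T = N.vector_field_tangent[OF X p] N.vector_field_tangent[OF Y p] N.vector_field_tangent[OF Z p]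
  have second: "D (p, t) (cone_lift N V (p, t)) (\<lambda>z. D z (cone_lift N W z) (cone_lift N Z)) =
    cone_vec N p (D' p (V p) (\<lambda>q. D' q (W q) Z) - h p (W p) (Z p) *\<^sub>R V p)
      (- t * (h p (V p) (D' p (W p) Z) + h p (D' p (V p) W) (Z p) + h p (W p) (D' p (V p) Z)))"
    if V: "vector_field N U V" and W: "vector_field N U W" for V W
  proof -
    have l: "cone_vec N p (V p) 0 = cone_lift N V (p, t)" by (simp add: cone_lift_def)
    show ?thesis
      using D_D_lift_lift[OF W Z p t N.vector_field_tangent[OF V p], of 0]
      unfolding l D_lift_lift[OF V N.vector_field_D[OF W Z] p t] D_lift_radial[OF V p t]
      by (simp add: cone_radial_def cone_vec_scaleR cone_vec_diff algebra_simps tt flip: l)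
  qed
  have "D (p, t) (lie_bracket (cone_mfd N) (cone_lift N X) (cone_lift N Y) (p, t)) (cone_lift N Z) =
      cone_vec N p (D' p (lie_bracket N X Y p) Z) (- t * h p (lie_bracket N X Y p) (Z p))"
    using D_lift_lift[OF br Z p t] unfolding lie_bracket_cone_lift[OF X Y p t]
    by (simp add: cone_lift_def[of N "lie_bracket N X Y"])
  moreover have "h p (lie_bracket N X Y p) (Z p) = h p (D' p (X p) Y) (Z p) - h p (D' p (Y p) X) (Z p)"
    unfolding N.torsion_free[OF X Y p]
    by (rule N.metric_diff_left[OF pN N.D_tangent[OF Y p T(1)] N.D_tangent[OF X p T(2)] T(3)])
  ultimately show ?thesis
    unfolding curvature_def second[OF X Y] second[OF Y X]
    by (simp add: cone_vec_diff algebra_simps)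
qed

text \<open>Since \<open>\<nabla> \<xi>\<close> is division by \<open>t\<close> and \<open>t\<close> is constant along lifts, this component is \<open>1/t\<close> times the
  torsion of \<open>X\<up>\<close> and \<open>Y\<up>\<close>.\<close>

lemma curvature_lift_lift_radial:
  assumes X: "vector_field N U X" and Y: "vector_field N U Y" and p: "p \<in> U" and t: "t > 0"
  shows "curvature (cone_mfd N) D (cone_lift N X) (cone_lift N Y) (cone_radial N) (p, t) = 0"
proof -
  have z: "(p, t) \<in> U \<times> {0<..}" using p t by simp
  note R = N.vector_field_cone_radial[OF N.vector_field_openin[OF X]]
  have second: "D (p, t) (cone_lift N X (p, t)) (\<lambda>z. D z (cone_lift N Y z) (cone_radial N)) =
      inverse t *\<^sub>R D (p, t) (cone_lift N X (p, t)) (cone_lift N Y)"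
    if X: "vector_field N U X" and Y: "vector_field N U Y" for X Y
  proof -
    note Xz = C.vector_field_tangent[OF N.vector_field_cone_lift[OF X] z]
    have "D (p, t) (cone_lift N X (p, t)) (\<lambda>z. D z (cone_lift N Y z) (cone_radial N)) =
        D (p, t) (cone_lift N X (p, t)) (\<lambda>z. inverse (snd z) *\<^sub>R cone_lift N Y z)"
      by (rule C.D_cong[OF C.vector_field_D[OF N.vector_field_cone_lift[OF Y] R] _ z Xz])
        (auto simp: D_lift_radial[OF Y])
    then show ?thesis
      using D_inverse_radius_lift[OF Y p t N.vector_field_tangent[OF X p], of 0]
      by (simp add: cone_lift_def[of N X])
  qed
  have "D (p, t) (lie_bracket (cone_mfd N) (cone_lift N X) (cone_lift N Y) (p, t)) (cone_radial N) =
      inverse t *\<^sub>R lie_bracket (cone_mfd N) (cone_lift N X) (cone_lift N Y) (p, t)"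
    using D_lift_radial[OF N.vector_field_lie_bracket[OF X Y] p t] unfolding lie_bracket_cone_lift[OF X Y p t]
    by (simp add: cone_lift_def[of N "lie_bracket N X Y"])
  then show ?thesis
    unfolding curvature_def second[OF X Y] second[OF Y X]
      C.torsion_free[OF N.vector_field_cone_lift[OF X] N.vector_field_cone_lift[OF Y] z]
    by (simp add: scaleR_right_diff_distrib)
qed

text \<open>The derivative of \<open>1/t\<close> along \<open>\<xi>\<close> cancels the contribution of \<open>\<nabla>\<^bsub>\<xi>\<^esub> X\<up> = X\<up> / t\<close>.\<close>

lemma curvature_lift_radial_radial:
  assumes X: "vector_field N U X" and p: "p \<in> U" and t: "t > 0"
  shows "curvature (cone_mfd N) D (cone_lift N X) (cone_radial N) (cone_radial N) (p, t) = 0"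
proof -
  note U = N.vector_field_openin[OF X]
  have UN: "q \<in> carrier N" if "q \<in> U" for q using N.openin_carrier U that by blast
  have z: "(p, t) \<in> U \<times> {0<..}" and zN: "(p, t) \<in> carrier (cone_mfd N)" using p t UN by (simp_all add: carrier_cone)
  note R = N.vector_field_cone_radial[OF U] and LX = N.vector_field_cone_lift[OF X]
  note Xz = C.vector_field_tangent[OF LX z] and Rz = C.vector_field_tangent[OF R z]
  have r: "cone_vec N p 0 1 = cone_radial N (p, t)" by (simp add: cone_radial_def)
  have "D (p, t) (cone_lift N X (p, t)) (\<lambda>z. D z (cone_radial N z) (cone_radial N)) =
      D (p, t) (cone_lift N X (p, t)) (\<lambda>z. 0)"
    by (rule C.D_cong[OF C.vector_field_D[OF R R] _ z Xz]) (use D_radial_radial UN in blast)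
  then have 1: "D (p, t) (cone_lift N X (p, t)) (\<lambda>z. D z (cone_radial N z) (cone_radial N)) = 0"
    using C.D_0[OF zN Xz] by metis
  have "D (p, t) (cone_radial N (p, t)) (\<lambda>z. D z (cone_lift N X z) (cone_radial N)) =
      D (p, t) (cone_radial N (p, t)) (\<lambda>z. inverse (snd z) *\<^sub>R cone_lift N X z)"
    by (rule C.D_cong[OF C.vector_field_D[OF LX R] _ z Rz]) (auto simp: D_lift_radial[OF X])
  then have 2: "D (p, t) (cone_radial N (p, t)) (\<lambda>z. D z (cone_lift N X z) (cone_radial N)) = 0"
    using D_inverse_radius_lift[OF X p t N.tangent_space_0, of 1]
    unfolding r D_radial_lift[OF X p t] by (simp add: power2_eq_square)
  show ?thesis
    unfolding curvature_def 1 2 lie_bracket_cone_lift_radial[OF X p t] C.D_0_vec[OF R z] by simp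
qed

text \<open>Both iterated derivatives are equal to \<open>(\<nabla>'\<^bsub>X\<^esub> Z)\<up> / t - h(X,Z) \<xi>\<close>, and the bracket of \<open>X\<up>\<close> and \<open>\<xi>\<close> is zero.\<close>

lemma curvature_lift_radial_lift:
  assumes X: "vector_field N U X" and Z: "vector_field N U Z" and p: "p \<in> U" and t: "t > 0"
  shows "curvature (cone_mfd N) D (cone_lift N X) (cone_radial N) (cone_lift N Z) (p, t) = 0"
proof -
  note U = N.vector_field_openin[OF X]
  have pN: "p \<in> carrier N" using N.openin_carrier U p by blast
  have z: "(p, t) \<in> U \<times> {0<..}" using p t by simp
  note R = N.vector_field_cone_radial[OF U] and LZ = N.vector_field_cone_lift[OF Z]
    and XZ = N.vector_field_D[OF X Z] and Xp = N.vector_field_tangent[OF X p]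
  note Xz = C.vector_field_tangent[OF N.vector_field_cone_lift[OF X] z]
  have r: "cone_vec N p 0 1 = cone_radial N (p, t)" by (simp add: cone_radial_def)
  have "D (p, t) (cone_lift N X (p, t)) (\<lambda>z. D z (cone_radial N z) (cone_lift N Z)) =
      D (p, t) (cone_lift N X (p, t)) (\<lambda>z. inverse (snd z) *\<^sub>R cone_lift N Z z)"
    by (rule C.D_cong[OF C.vector_field_D[OF R LZ] _ z Xz]) (auto simp: D_radial_lift[OF Z])
  also have "\<dots> = inverse t *\<^sub>R D (p, t) (cone_lift N X (p, t)) (cone_lift N Z)"
    using D_inverse_radius_lift[OF Z p t Xp, of 0] by (simp add: cone_lift_def[of N X])
  finally have 1: "D (p, t) (cone_lift N X (p, t)) (\<lambda>z. D z (cone_radial N z) (cone_lift N Z)) =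
      cone_vec N p (inverse t *\<^sub>R D' p (X p) Z) (- h p (X p) (Z p))"
    unfolding D_lift_lift[OF X Z p t] using t by (simp add: cone_vec_scaleR flip: mult.assoc)
  have h0: "h p (D' p 0 X) (Z p) + h p (X p) (D' p 0 Z) = 0"
    by (simp add: N.D_0_vec[OF X p] N.D_0_vec[OF Z p] N.metric_0_left pN N.vector_field_tangent[OF Z p]
      N.metric_sym[OF pN Xp N.tangent_space_0] Xp)
  have 2: "D (p, t) (cone_radial N (p, t)) (\<lambda>z. D z (cone_lift N X z) (cone_lift N Z)) =
      cone_vec N p (inverse t *\<^sub>R D' p (X p) Z) (- h p (X p) (Z p))"
    using D_D_lift_lift[OF X Z p t N.tangent_space_0, of 1]
    unfolding r h0 D_radial_lift[OF XZ p t] D_radial_radial[OF pN t]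
    by (simp add: cone_lift_def[of N "\<lambda>q. D' q (X q) Z"] cone_radial_def[of N] cone_vec_scaleR cone_vec_diff)
  show ?thesis
    unfolding curvature_def 1 2 lie_bracket_cone_lift_radial[OF X p t] C.D_0_vec[OF LZ z] by simp
qed

lemma coord_vec_cone:
  assumes c: "c \<in> charts_at N p" and t: "t > 0"
  shows "coord_vec (cone_mfd N) (p, t) (cone_chart c) (v, a) = cone_vec N p (coord_vec N p c v) a"
proof (rule C.tangent_eqI[OF C.coord_vec_tangent _ N.cone_chart_charts_at[OF c t]])
  show "cone_vec N p (coord_vec N p c v) a \<in> tangent_space (cone_mfd N) (p, t)"
    by (rule N.cone_vec_tangent[OF N.charts_at_carrier[OF c] t N.coord_vec_tangent[OF c]])
qed (simp_all add: C.coord_vec_self N.cone_chart_charts_at[OF c t] cone_vec_cone_chart[OF c] N.coord_vec_self[OF c])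

text \<open>The lift is injective, so a vanishing curvature of lifts determines the curvature of \<open>N\<close>.\<close>

lemma flat_coneD:
  assumes flat: "flat (cone_mfd N) D"
    and X: "vector_field N U X" and Y: "vector_field N U Y" and Z: "vector_field N U Z" and p: "p \<in> U"
  shows "curvature N D' X Y Z p = h p (Y p) (Z p) *\<^sub>R X p - h p (X p) (Z p) *\<^sub>R Y p" (is "?R = ?S")
proof -
  have pN: "p \<in> carrier N" using N.openin_carrier N.vector_field_openin X p by blast
  \<comment> \<open>The value of \<open>t\<close> is immaterial, because the curvature of lifts does not depend on it.\<close>
  have "curvature (cone_mfd N) D (cone_lift N X) (cone_lift N Y) (cone_lift N Z) (p, 1) = 0"
    using flat N.vector_field_cone_lift[OF X] N.vector_field_cone_lift[OF Y] N.vector_field_cone_lift[OF Z] p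
    unfolding flat_def by (metis SigmaI greaterThan_iff zero_less_one)
  then have "cone_vec N p (?R - ?S) 0 = cone_vec N p 0 0"
    by (simp add: curvature_lift_lift_lift[OF X Y Z p] cone_vec_0)
  then have "?R - ?S = 0"
    by (rule N.cone_vec_inject[OF pN _ N.tangent_space_0, rotated])
      (intro N.tangent_space_diff N.tangent_space_scaleR N.curvature_tangent[OF X Y Z p]
        N.vector_field_tangent[OF X p] N.vector_field_tangent[OF Y p])
  then show ?thesis by simp
qed

text \<open>Lifts of coordinate fields together with \<open>\<xi>\<close> form a local frame of the cone, so the curvature
  of \<open>N\<close> matters on coordinate fields only.\<close>

lemma flat_coneI:
  assumes unit: "\<And>p c i j k. c \<in> charts_at N p \<Longrightarrow> i \<in> Basis \<Longrightarrow> j \<in> Basis \<Longrightarrow> k \<in> Basis \<Longrightarrow>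
    curvature N D' (\<lambda>q. coord_vec N q c i) (\<lambda>q. coord_vec N q c j) (\<lambda>q. coord_vec N q c k) p =
    h p (coord_vec N p c j) (coord_vec N p c k) *\<^sub>R coord_vec N p c i -
    h p (coord_vec N p c i) (coord_vec N p c k) *\<^sub>R coord_vec N p c j"
  shows "flat (cone_mfd N) D"
  unfolding flat_def
proof (intro allI impI ballI)
  fix W X Y Z z
  assume X: "vector_field (cone_mfd N) W X" and Y: "vector_field (cone_mfd N) W Y" and Z: "vector_field (cone_mfd N) W Z"
    and z: "z \<in> W"
  have "z \<in> carrier (cone_mfd N)" using C.openin_carrier C.vector_field_openin X z by blast
  then obtain p t where pt: "z = (p, t)" "p \<in> carrier N" "t > 0" by (auto simp: carrier_cone)
  obtain c where c: "c \<in> charts_at N p" using N.carrier_charts_at pt by blast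
  have c': "c \<in> atlas N" "p \<in> chart_dom c" using c by (auto simp: charts_at_def)
  define F where "F = (\<lambda>i q. coord_vec N q c i)"
  \<comment> \<open>The basis of the product consists of the vectors \<open>(i, 0)\<close> and \<open>(0, 1)\<close>.\<close>
  define E :: "'e \<times> real \<Rightarrow> 'a \<times> real \<Rightarrow> ('a \<times> real, 'e \<times> real) tvec"
    where "E = (\<lambda>e. if snd e = 0 then cone_lift N (F (fst e)) else cone_radial N)"
  have F: "vector_field N (chart_dom c) (F i)" for i
    unfolding F_def by (rule N.vector_field_coord_vec[OF c'(1)])
  note R = N.vector_field_cone_radial[OF N.openin_chart_dom[OF c'(1)]]
  note LF = N.vector_field_cone_lift[OF F]
  have z': "(p, t) \<in> chart_dom c \<times> {0<..}" using c' pt by simp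
  have "curvature (cone_mfd N) D X Y Z (p, t) = 0"
  proof (rule C.curvature_eq_0_from_frame[OF X Y Z z[unfolded pt(1)] N.cone_chart_charts_at[OF c pt(3)], where E = E])
    fix e :: "'e \<times> real" and w :: "'a \<times> real"
    assume e: "e \<in> Basis" and "w \<in> chart_dom (cone_chart c)"
    then obtain q s where w: "w = (q, s)" "q \<in> chart_dom c" "s > 0" by (auto simp: chart_dom_cone_chart)
    have q: "c \<in> charts_at N q" by (rule N.charts_atI[OF c'(1) w(2)])
    show "E e w = coord_vec (cone_mfd N) w (cone_chart c) e"
      using e coord_vec_cone[OF q w(3)] N.tangent_eqI[OF N.coord_vec_tangent[OF q, of 0] N.tangent_space_0 q]
      by (auto simp: E_def F_def w cone_lift_def cone_radial_def Basis_prod_def N.coord_vec_self[OF q])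
  next
    have lll: "curvature (cone_mfd N) D (cone_lift N (F i)) (cone_lift N (F j)) (cone_lift N (F k)) (p, t) = 0"
      if "i \<in> Basis" "j \<in> Basis" "k \<in> Basis" for i j k
      unfolding curvature_lift_lift_lift[OF F F F c'(2) pt(3)] using unit[OF c that]
      by (simp add: F_def cone_vec_0)
    have rl: "curvature (cone_mfd N) D (cone_radial N) (cone_lift N (F i)) A (p, t) = 0"
      if "vector_field (cone_mfd N) (chart_dom c \<times> {0<..}) A"
        "curvature (cone_mfd N) D (cone_lift N (F i)) (cone_radial N) A (p, t) = 0" for A i
      using C.curvature_antisym[OF R LF that(1) z'] that(2) by simp
    have rr: "curvature (cone_mfd N) D (cone_radial N) (cone_radial N) A (p, t) = 0"
      if "vector_field (cone_mfd N) (chart_dom c \<times> {0<..}) A" for A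
      unfolding C.curvature_torsion_free[OF R R that z'] by simp
    fix i j k :: "'e \<times> real" assume "i \<in> Basis" "j \<in> Basis" "k \<in> Basis"
    then show "curvature (cone_mfd N) D (E i) (E j) (E k) (p, t) = 0"
      using lll curvature_lift_lift_radial[OF F F c'(2) pt(3)] curvature_lift_radial_radial[OF F c'(2) pt(3)]
        curvature_lift_radial_lift[OF F F c'(2) pt(3)] rl[OF R] rl[OF LF] rr[OF R] rr[OF LF]
      by (auto simp: E_def Basis_prod_def)
  qed
  then show "curvature (cone_mfd N) D X Y Z z = 0" unfolding pt(1) .
qed

end

section \<open>Cones over surfaces\<close>

lemma (in smooth_mfd) independent_coord_vec:
  assumes c: "c \<in> charts_at M p" and ij: "i \<in> Basis" "j \<in> Basis" "i \<noteq> j"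
  shows "coord_vec M p c i \<noteq> coord_vec M p c j" "independent {coord_vec M p c i, coord_vec M p c j}"
proof -
  let ?x = "coord_vec M p c i" and ?y = "coord_vec M p c j"
  have x: "?x c = i" and y: "?y c = j" by (simp_all add: coord_vec_self c)
  have xy: "?x \<noteq> r *\<^sub>R ?y" for r
  proof
    assume "?x = r *\<^sub>R ?y"
    then have "i = r *\<^sub>R j" using x y by (metis scaleR_fun_apply)
    then have "i \<bullet> i = r * (j \<bullet> i)" by (metis inner_scaleR_left)
    then show False using ij by (simp add: inner_Basis)
  qed
  have "?y \<noteq> 0" using y ij(2) by (metis nonzero_Basis zero_fun_apply)
  then show "?x \<noteq> ?y" "independent {?x, ?y}"
    using xy xy[of 1] by (auto simp: independent_insert span_singleton)
qed

text \<open>On a surface two independent vectors \<open>x, y\<close> span the tangent space. The component of \<open>R(x,y) y\<close> along \<open>x\<close> is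
  prescribed by the sectional curvature and the one along \<open>y\<close> vanishes by skew-symmetry, which fixes
  \<open>R(x,y) y\<close>; antisymmetry in the first two arguments gives \<open>R(x,y) x\<close>.\<close>

lemma (in riemannian_mfd) curvature_unit_surface:
  assumes dim: "DIM('e) = 2" and sec: "has_sectional_curvature M g D k" and k: "k p = 1"
    and c: "c \<in> charts_at M p" and Basis: "i \<in> Basis" "j \<in> Basis" "l \<in> Basis"
  shows "curvature M D (\<lambda>q. coord_vec M q c i) (\<lambda>q. coord_vec M q c j) (\<lambda>q. coord_vec M q c l) p =
    g p (coord_vec M p c j) (coord_vec M p c l) *\<^sub>R coord_vec M p c i -
    g p (coord_vec M p c i) (coord_vec M p c l) *\<^sub>R coord_vec M p c j"
proof -
  have c': "c \<in> atlas M" "p \<in> chart_dom c" using c by (auto simp: charts_at_def)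
  have pM: "p \<in> carrier M" by (rule charts_at_carrier[OF c])
  define F where "F = (\<lambda>i q. coord_vec M q c i)"
  have F: "vector_field M (chart_dom c) (F i)" for i
    unfolding F_def by (rule vector_field_coord_vec[OF c'(1)])
  note Fp = vector_field_tangent[OF F c'(2)]
  have two: "curvature M D (F i) (F j) (F j) p = g p (F j p) (F j p) *\<^sub>R F i p - g p (F i p) (F j p) *\<^sub>R F j p" (is "?R = ?S")
    if ij: "i \<in> Basis" "j \<in> Basis" "i \<noteq> j" for i j
  proof -
    have B: "Basis = {i, j}"
      using card_subset_eq[of "Basis :: 'e set" "{i, j}"] ij dim by simp
    have RT: "?R \<in> tangent_space M p" by (rule curvature_tangent[OF F F F c'(2)])
    have ST: "?S \<in> tangent_space M p" by (intro tangent_space_diff tangent_space_scaleR Fp)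
    have "sectional_curvature M g D (F i) (F j) p = 1"
      using sec[unfolded has_sectional_curvature_def, rule_format, OF F F c'(2), of i j]
        independent_coord_vec[OF c ij] k by (simp add: F_def)
    moreover have "g p (F i p) (F i p) * g p (F j p) (F j p) - (g p (F i p) (F j p))\<^sup>2 > 0"
      using gram_determinant_pos[OF pM Fp Fp] independent_coord_vec[OF c ij] by (simp add: F_def)
    ultimately have "g p ?R (F i p) = g p (F i p) (F i p) * g p (F j p) (F j p) - (g p (F i p) (F j p))\<^sup>2"
      by (simp add: sectional_curvature_def)
    then have i: "g p ?R (F i p) = g p ?S (F i p)"
      using metric_sym[OF pM Fp Fp, of i j]
      by (simp add: metric_diff_left metric_scaleR_left pM Fp tangent_space_scaleR power2_eq_square algebra_simps)
    have j: "g p ?R (F j p) = g p ?S (F j p)"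
      using metric_curvature_skew[OF F F F c'(2), of i j j]
      by (simp add: metric_diff_left metric_scaleR_left pM Fp tangent_space_scaleR)
    show ?thesis
    proof (rule metric_nondegenerate[OF pM RT ST])
      fix z assume z: "z \<in> tangent_space M p"
      have "z = (\<Sum>e\<in>Basis. (z c \<bullet> e) *\<^sub>R F e p)"
        unfolding F_def by (rule tangent_coord_expansion[OF z c])
      also have "\<dots> = (z c \<bullet> i) *\<^sub>R F i p + (z c \<bullet> j) *\<^sub>R F j p"
        unfolding B using ij(3) by simp
      finally have z': "z = (z c \<bullet> i) *\<^sub>R F i p + (z c \<bullet> j) *\<^sub>R F j p" .
      have expand: "g p v z = (z c \<bullet> i) * g p v (F i p) + (z c \<bullet> j) * g p v (F j p)"
        if v: "v \<in> tangent_space M p" for v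
        by (subst z') (simp add: metric_add_right metric_scaleR_right pM v Fp tangent_space_scaleR)
      show "g p ?R z = g p ?S z" unfolding expand[OF RT] expand[OF ST] i j ..
    qed
  qed
  have "curvature M D (F i) (F j) (F l) p = g p (F j p) (F l p) *\<^sub>R F i p - g p (F i p) (F l p) *\<^sub>R F j p"
  proof (cases "i = j")
    case True
    then show ?thesis unfolding True curvature_torsion_free[OF F F F c'(2)] by simp
  next
    case False
    then have "Basis = {i, j}"
      using card_subset_eq[of "Basis :: 'e set" "{i, j}"] Basis dim by simp
    then consider "l = j" | "l = i" using Basis by blast
    then show ?thesis
    proof cases
      case 1 then show ?thesis using two[OF Basis(1,2) False] by simp
    next
      case 2 then show ?thesis
        using two[OF Basis(2,1)] False curvature_antisym[OF F F F c'(2), of i j i] by simp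
    qed
  qed
  then show ?thesis by (simp add: F_def)
qed

text \<open>The sectional curvature of two independent fields \<open>X, Y\<close> is the
  quotient of \<open>h(R'(X,Y) Y, X)\<close> and the Gram determinant; for the curvature tensor of the unit sphere both agree.\<close>

lemma (in riemannian_cone) flat_cone_iff_unit_curvature:
  assumes dim: "DIM('e) = 2" and sec: "has_sectional_curvature N h D' k"
  shows "flat (cone_mfd N) D \<longleftrightarrow> (\<forall>p\<in>carrier N. k p = 1)"
proof
  assume flat: "flat (cone_mfd N) D"
  show "\<forall>p\<in>carrier N. k p = 1"
  proof
    fix p assume p: "p \<in> carrier N"
    obtain c where c: "c \<in> charts_at N p" using N.carrier_charts_at p by blast
    have c': "c \<in> atlas N" "p \<in> chart_dom c" using c by (auto simp: charts_at_def)
    have "card (Basis :: 'e set) = Suc (Suc 0)" using dim by simp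
    then obtain i j :: 'e where ij: "i \<in> Basis" "j \<in> Basis" "i \<noteq> j"
      by (metis card_2_iff' numeral_2_eq_2)
    define X where "X = (\<lambda>q. coord_vec N q c i)"
    define Y where "Y = (\<lambda>q. coord_vec N q c j)"
    have X: "vector_field N (chart_dom c) X" and Y: "vector_field N (chart_dom c) Y"
      unfolding X_def Y_def by (rule N.vector_field_coord_vec[OF c'(1)])+
    have ind: "X p \<noteq> Y p" "independent {X p, Y p}"
      unfolding X_def Y_def by (rule N.independent_coord_vec[OF c ij])+
    note T = N.vector_field_tangent[OF X c'(2)] N.vector_field_tangent[OF Y c'(2)]
    have "h p (curvature N D' X Y Y p) (X p) = h p (X p) (X p) * h p (Y p) (Y p) - (h p (X p) (Y p))\<^sup>2"
      unfolding flat_coneD[OF flat X Y Y c'(2)] using N.metric_sym[OF p T]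
      by (simp add: N.metric_diff_left N.metric_scaleR_left p T N.tangent_space_scaleR power2_eq_square)
    then have "sectional_curvature N h D' X Y p = 1"
      using N.gram_determinant_pos[OF p T ind] by (simp add: sectional_curvature_def)
    then show "k p = 1"
      using sec[unfolded has_sectional_curvature_def, rule_format, OF X Y c'(2) ind] by simp
  qed
next
  assume "\<forall>p\<in>carrier N. k p = 1"
  then show "flat (cone_mfd N) D"
    using N.curvature_unit_surface[OF dim sec] N.charts_at_carrier by (intro flat_coneI) blast
qed

theorem theorem2p3:
  fixes N :: "('a, real^2) mfd"
    and P :: "'a \<Rightarrow> ('a, real^2) tvec \<Rightarrow> ('a, real^2) tvec"
    and h :: "'a \<Rightarrow> ('a, real^2) tvec \<Rightarrow> ('a, real^2) tvec \<Rightarrow> real"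
    and nabla' :: "('a, real^2) connection"
    and k' :: "'a \<Rightarrow> real"
    and \<phi> :: "'a \<times> real \<Rightarrow> ('a \<times> real, (real^2) \<times> real) tvec \<Rightarrow> ('a \<times> real, (real^2) \<times> real) tvec"
    and \<xi> :: "'a \<times> real \<Rightarrow> ('a \<times> real, (real^2) \<times> real) tvec"
    and \<eta> :: "'a \<times> real \<Rightarrow> ('a \<times> real, (real^2) \<times> real) tvec \<Rightarrow> real"
    and g :: "'a \<times> real \<Rightarrow> ('a \<times> real, (real^2) \<times> real) tvec \<Rightarrow> ('a \<times> real, (real^2) \<times> real) tvec \<Rightarrow> real"
    and nabla :: "('a \<times> real, (real^2) \<times> real) connection"
  assumes N: "almost_paracomplex_riemannian N P h"
    and nabla': "levi_civita N h nabla'"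
    and k': "has_sectional_curvature N h nabla' k'"
    and cone: "apapR_manifold (cone_mfd N) \<phi> \<xi> \<eta> g"
    and g: "\<And>p t x y a b. p \<in> carrier N \<Longrightarrow> t > 0 \<Longrightarrow>
              x \<in> tangent_space N p \<Longrightarrow> y \<in> tangent_space N p \<Longrightarrow>
              g (p, t) (cone_vec N p x a) (cone_vec N p y b) = t\<^sup>2 * h p x y + a * b"
    and \<phi>: "\<And>p t x a. p \<in> carrier N \<Longrightarrow> t > 0 \<Longrightarrow> x \<in> tangent_space N p \<Longrightarrow>
              \<phi> (p, t) (cone_vec N p x a) = cone_vec N p (P p x) 0"
    and \<xi>: "\<And>p t. p \<in> carrier N \<Longrightarrow> t > 0 \<Longrightarrow> \<xi> (p, t) = cone_vec N p 0 1"
    and \<eta>: "\<And>p t x a. p \<in> carrier N \<Longrightarrow> t > 0 \<Longrightarrow> x \<in> tangent_space N p \<Longrightarrow>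
              \<eta> (p, t) (cone_vec N p x a) = a"
    and nabla: "levi_civita (cone_mfd N) g nabla"
  shows "flat (cone_mfd N) nabla \<longleftrightarrow> (\<forall>p\<in>carrier N. k' p = 1)"
proof -
  have "smooth_manifold N" "riemannian_metric N h"
    using N by (simp_all add: almost_paracomplex_riemannian_def)
  moreover have "smooth_manifold (cone_mfd N)" "riemannian_metric (cone_mfd N) g"
    using cone by (simp_all add: apapR_manifold_def)
  ultimately interpret riemannian_cone N h nabla' g nabla
    using nabla' nabla g by unfold_locales
  show ?thesis by (rule flat_cone_iff_unit_curvature[OF _ k']) simp
qed

end
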